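(* Let $I=\langle h_1,\ldots,h_m\rangle\subseteq\mathbb{R}[x]$ be the ideal generated by $h_1,\ldots,h_m\in\mathbb{R}[x]=\mathbb{R}[x_1,\ldots,x_n]$, and assume that $V_{\mathbb{R}}(I)$ is finite. Let $y\in\mathbb{R}^{\mathbb{N}^n}$ be a sequence satisfying $$M^{\mathbb{R}}(y)\succeq 0,\qquad M^{\mathbb{R}}(h_jy)=0\quad (j=1,\ldots,m).\qquad( * )$$ Then the kernel $\operatorname{Ker} M^{\mathbb{R}}(y)$ is a real radical ideal, $\operatorname{rank} M^{\mathbb{R}}(y)\le |V_{\mathbb{R}}(I)|$, and $I(V_{\mathbb{R}}(I))\subseteq \operatorname{Ker} M^{\mathbb{R}}(y)$, with equality if and only if $M^{\mathbb{R}}(y)$ has maximum rank (among the sequences satisfying $( * )$), equal to $|V_{\mathbb{R}}(I)|$.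
   Context: $V_{\mathbb{C}}(I)=\{v\in\mathbb{C}^n : f(v)=0\ \forall f\in I\}$, $V_{\mathbb{R}}(I)=V_{\mathbb{C}}(I)\cap\mathbb{R}^n$, and for a set $V$ of points, $I(V)$ is the ideal of polynomials vanishing on $V$ (here in $\mathbb{R}[x]$). An ideal $J\subseteq\mathbb{R}[x]$ is real radical if $J=\sqrt[\mathbb{R}]{J}:=\{p\in\mathbb{R}[x] : p^{2k}+\sum_j q_j^2\in J \text{ for some } q_j\in\mathbb{R}[x],\ k\ge 1\}$ (finite sums). For $y=(y_\alpha)_{\alpha\in\mathbb{N}^n}\in\mathbb{R}^{\mathbb{N}^n}$, the moment matrix $M^{\mathbb{R}}(y)$ is the infinite real symmetric matrix indexed by $\mathbb{N}^n$ (equivalently by monomials) with $(\alpha,\beta)$ entry $y_{\alpha+\beta}$. For $p=\sum_\alpha p_\alpha x^\alpha$, $\mathrm{vec}(p)=(p_\alpha)_\alpha$ is its finitely supported coefficient vector. Positive semidefiniteness $M^{\mathbb{R}}(y)\succeq 0$ means $\mathrm{vec}(p)^TM^{\mathbb{R}}(y)\mathrm{vec}(p)\ge 0$ for all $p\in\mathbb{R}[x]$. The kernel is viewed as a set of polynomials: $\operatorname{Ker} M^{\mathbb{R}}(y)=\{p\in\mathbb{R}[x] : M^{\mathbb{R}}(y)\mathrm{vec}(p)=0\}$. For $h\in\mathbb{R}[x]$, $hy:=M^{\mathbb{R}}(y)\mathrm{vec}(h)\in\mathbb{R}^{\mathbb{N}^n}$, i.e. $(hy)_\alpha=\sum_\beta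 h_\beta y_{\alpha+\beta}$. *)

theory Defs
  imports
    "HOL-Analysis.Analysis"
    "HOL-Library.Poly_Mapping"
    "HOL-Library.Function_Algebras"
    "HOL-Library.Extended_Nat"
begin

text \<open>
  Polynomials in the variables \<open>x\<^sub>i\<close>, \<open>i :: 'n\<close>, over the reals are finitely supported functions
  from exponent vectors to coefficients; the product that \<open>Poly_Mapping\<close> puts on this type is
  convolution, i.e. multiplication of polynomials. \<open>Poly_Mapping.lookup p\<close> is the coefficient vector of \<open>p\<close>.
\<close>

type_synonym 'n monomial = "'n \<Rightarrow>\<^sub>0 nat"
type_synonym 'n mpoly = "'n monomial \<Rightarrow>\<^sub>0 real"
type_synonym 'n inf_matrix = "'n monomial \<Rightarrow> 'n monomial \<Rightarrow> real"

section \<open>Ideals and varieties\<close>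

text \<open>Ideals of a commutative ring are its submodules as a module over itself.\<close>

definition is_ideal :: "'a::comm_ring_1 set \<Rightarrow> bool" where
  "is_ideal = module.subspace (*)"

definition ideal_generated_by :: "'a::comm_ring_1 set \<Rightarrow> 'a set" where
  "ideal_generated_by = module.span (*)"

definition peval :: "'n::finite mpoly \<Rightarrow> complex ^ 'n \<Rightarrow> complex" where
  "peval p v = (\<Sum>\<alpha>\<in>Poly_Mapping.keys p. of_real (Poly_Mapping.lookup p \<alpha>) * (\<Prod>i\<in>UNIV. (v $ i) ^ Poly_Mapping.lookup \<alpha> i))"

definition complex_variety :: "'n::finite mpoly set \<Rightarrow> (complex ^ 'n) set" where
  "complex_variety I = {v. \<forall>f\<in>I. peval f v = 0}"

definition real_variety :: "'n::finite mpoly set \<Rightarrow> (complex ^ 'n) set" where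
  "real_variety I = complex_variety I \<inter> {v. \<forall>i. v $ i \<in> \<real>}"

definition vanishing_ideal :: "(complex ^ 'n) set \<Rightarrow> 'n::finite mpoly set" where
  "vanishing_ideal V = {p. \<forall>v\<in>V. peval p v = 0}"

definition real_radical :: "'a::comm_ring_1 set \<Rightarrow> 'a set" where
  "real_radical J = {p. \<exists>k\<ge>1. \<exists>qs. p ^ (2 * k) + (\<Sum>q\<leftarrow>qs. q ^ 2) \<in> J}"

definition is_real_radical_ideal :: "'a::comm_ring_1 set \<Rightarrow> bool" where
  "is_real_radical_ideal J \<longleftrightarrow> is_ideal J \<and> J = real_radical J"

section \<open>Moment matrices\<close>

definition moment_matrix :: "('n monomial \<Rightarrow> real) \<Rightarrow> 'n inf_matrix" where
  "moment_matrix y = (\<lambda>\<alpha> \<beta>. y (\<alpha> + \<beta>))"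

definition mat_vec :: "'n inf_matrix \<Rightarrow> 'n mpoly \<Rightarrow> 'n monomial \<Rightarrow> real" where
  "mat_vec M p = (\<lambda>\<alpha>. \<Sum>\<beta>\<in>Poly_Mapping.keys p. M \<alpha> \<beta> * Poly_Mapping.lookup p \<beta>)"

definition psd :: "'n inf_matrix \<Rightarrow> bool" where
  "psd M \<longleftrightarrow> (\<forall>p. (\<Sum>\<alpha>\<in>Poly_Mapping.keys p. Poly_Mapping.lookup p \<alpha> * mat_vec M p \<alpha>) \<ge> 0)"

definition mat_kernel :: "'n inf_matrix \<Rightarrow> 'n mpoly set" where
  "mat_kernel M = {p. mat_vec M p = 0}"

definition shifted_seq :: "'n mpoly \<Rightarrow> ('n monomial \<Rightarrow> real) \<Rightarrow> 'n monomial \<Rightarrow> real" where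
  "shifted_seq h y = mat_vec (moment_matrix y) h"

global_interpretation fun_space: vector_space "\<lambda>(c::real) (f :: 'a \<Rightarrow> real) x. c * f x"
  by unfold_locales (auto simp: fun_eq_iff algebra_simps)

text \<open>
  The rank is the dimension of the column space. It is infinite if finitely many vectors do not
  suffice to span the columns, whereas \<open>dim\<close> returns the junk value 0 or the cardinality 0 of
  an infinite basis in that case.
\<close>

definition mat_rank :: "'n inf_matrix \<Rightarrow> enat" where
  "mat_rank M =
    (let C = range (\<lambda>\<beta> \<alpha>. M \<alpha> \<beta>)
     in if \<exists>B. finite B \<and> C \<subseteq> fun_space.span B then enat (fun_space.dim C) else \<infinity>)"

text \<open>The condition on \<open>y\<close> for given polynomials \<open>h\<^sub>1, \<dots>, h\<^sub>m\<close>.\<close>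

definition moment_feasible :: "nat \<Rightarrow> (nat \<Rightarrow> 'n mpoly) \<Rightarrow> ('n monomial \<Rightarrow> real) \<Rightarrow> bool" where
  "moment_feasible m h y \<longleftrightarrow>
     psd (moment_matrix y) \<and> (\<forall>j\<in>{1..m}. moment_matrix (shifted_seq (h j) y) = 0)"

end

theory Submission
  imports Defs
begin

text \<open>
  Let \<open>L\<close> be the linear functional on polynomials that sends the monomial with exponent \<open>\<alpha>\<close> to \<open>y \<alpha>\<close>.
  The moment matrix is the matrix of the symmetric bilinear form \<open>(p, q) \<mapsto> L (p * q)\<close>, so
  its kernel \<open>K\<close> is the ideal of all \<open>p\<close> with \<open>L (q * p) = 0\<close> for every \<open>q\<close>, and feasibility of \<open>y\<close> means
  that \<open>L\<close> is nonnegative on squares and that \<open>K\<close> contains the generators of \<open>I\<close>. By the Cauchy-Schwarz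
  inequality \<open>L (p * p) = 0\<close> already forces \<open>p \<in> K\<close>, and this makes \<open>K\<close> a real radical ideal
  (\<open>is_real_radical_ideal_mat_kernel\<close>).

  The inclusion of \<open>I(V)\<close> in \<open>K\<close>, where \<open>V\<close> is the set of real zeros of \<open>I\<close>, is the real Nullstellensatz
  for the real radical ideal \<open>K\<close>: if \<open>p \<notin> K\<close>, there is a real common zero of the generators of \<open>I\<close> at which
  \<open>p\<close> does not vanish (\<open>real_zero_off_hypersurface\<close>). Finiteness of \<open>V\<close> does not make the complex variety
  finite, as \<open>x\<^sup>2 + y\<^sup>2\<close> shows, so this is a genuine statement about real points. It is proved in
  three steps.

  (1) Since \<open>K\<close> is real radical and \<open>p \<notin> K\<close>, no power of \<open>p\<^sup>2\<close> plus a sum of squares lies in \<open>K\<close>. By Zorn's lemma there is a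
  point of the real spectrum of the polynomial ring, represented here by its sign function
  \<open>s\<close> with values \<open>-1, 0, 1\<close>, that vanishes on \<open>K\<close> but not at \<open>p\<close> (\<open>preordering_extends_to_sign_function\<close>).

  (2) The Artin-Lang theorem (\<open>artin_lang\<close>): finitely many values of such an \<open>s\<close> are realised by a
  real point. The variables are treated one after the other. For one variable \<open>T\<close> over a coefficient ring whose signs
  are already realised by a real point, the argument is that of Cohen and Hoermander: in a finite family
  of polynomials in \<open>T\<close> that is closed under derivatives, pseudo-remainders and deletion of leading terms, the signs of
  the coefficients determine the order of all roots and the signs of the family at and between them
  (\<open>correspondence_exists\<close>). Hence the position of \<open>T\<close> among the roots, as prescribed by \<open>s\<close>, can be copied to the
  real line (\<open>sign_transfer\<close>).

  (3) That argument needs the intermediate value theorem for the family on the side of \<open>s\<close>. Instead of a real closed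
  field it suffices to extend \<open>s\<close> so that the product of the family gets as many roots as possible
  (\<open>sign_extension_div_ivt\<close>): a sign change without a root would allow one more root to be adjoined. That a
  root can be adjoined at a sign change is an induction on degrees of identities between weighted sums of squares
  (\<open>no_certificate_at_sign_change\<close>).

  For the rank, let \<open>l a\<close> be the Lagrange polynomials for the finitely many points \<open>a\<close> of \<open>V\<close>. Modulo \<open>I(V)\<close>, hence modulo
  \<open>K\<close>, every polynomial is a combination of the \<open>l a\<close>, so the columns lie in the span of the \<open>card V\<close> images of the
  \<open>l a\<close>; these are distinct and independent exactly when \<open>K = I(V)\<close> (\<open>mat_rank_via_interpolation\<close>). The bound \<open>card V\<close> is
  attained by the moments of the sum of all point evaluations on \<open>V\<close> (\<open>sum_of_evaluations\<close>).
\<close>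

section \<open>Rings with a sign function\<close>

lemma pderiv_two_factors:
  fixes A B h :: "'a::idom poly"
  assumes A: "pderiv A = 1" and B: "pderiv B = 1"
  shows "pderiv (A ^ Suc m * B ^ Suc n * h) =
    A ^ m * B ^ n * (of_nat (Suc m) * B * h + of_nat (Suc n) * A * h + A * B * pderiv h)"
proof -
  have "pderiv (A ^ Suc m) = of_nat (Suc m) * A ^ m" "pderiv (B ^ Suc n) = of_nat (Suc n) * B ^ n"
    by (simp_all only: pderiv_power_Suc A B of_nat_poly[symmetric] mult_1_right)
      (simp_all add: of_nat_poly)
  then show ?thesis by (simp only: pderiv_mult power_Suc) (simp only: algebra_simps)
qed

text \<open>
  The sign function of a prime cone, i.e. of a ring homomorphism into an ordered field. Elements of sign \<open>0\<close> form the
  support, a prime ideal; working modulo the support replaces the passage to the residue domain and its field of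
  fractions, so that every extension below can live on one and the same ring. An inequality \<open>x < y\<close> of the
  ordered domain reads \<open>0 < s (y - x)\<close>.
\<close>

locale sign_function =
  fixes s :: "'a::idom \<Rightarrow> real"
  assumes s_range: "s x \<in> {-1, 0, 1}"
    and s_one: "s 1 = 1"
    and s_minus: "s (- x) = - s x"
    and s_mult: "s (x * y) = s x * s y"
    and s_add: "0 \<le> s x \<Longrightarrow> 0 \<le> s y \<Longrightarrow> 0 \<le> s (x + y)"
    and s_null_add: "s x = 0 \<Longrightarrow> s (x + y) = s y"
begin

lemma s_zero [simp]: "s 0 = 0"
  using s_minus[of 0] by simp

lemma s_null_add': "s y = 0 \<Longrightarrow> s (x + y) = s x"
  by (metis add.commute s_null_add)

lemma s_null_diff: "s y = 0 \<Longrightarrow> s (x - y) = s x"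
  using s_null_add'[of "- y" x] by (simp add: s_minus)

lemma s_cong: "s (x - y) = 0 \<Longrightarrow> s x = s y"
  using s_null_add[of "x - y" y] by simp

lemma s_diff_swap: "s (x - y) = - s (y - x)"
  by (metis minus_diff_eq s_minus)

lemma s_pos_add:
  assumes "0 < s x" "0 \<le> s y"
  shows "0 < s (x + y)"
proof (rule ccontr)
  assume "\<not> ?thesis"
  with s_add[of x y] assms have z: "s (x + y) = 0" by simp
  then have "s (- x) = s y"
    using s_null_add[of "x + y" "- x"] by simp
  with assms show False by (simp add: s_minus)
qed

lemma s_trans1: "0 < s (y - x) \<Longrightarrow> 0 \<le> s (z - y) \<Longrightarrow> 0 < s (z - x)"
  using s_pos_add[of "y - x" "z - y"] by simp

lemma s_trans2: "0 \<le> s (y - x) \<Longrightarrow> 0 < s (z - y) \<Longrightarrow> 0 < s (z - x)"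
  using s_pos_add[of "z - y" "y - x"] by simp

lemma s_trans: "0 \<le> s (y - x) \<Longrightarrow> 0 \<le> s (z - y) \<Longrightarrow> 0 \<le> s (z - x)"
  using s_add[of "z - y" "y - x"] by simp

lemma s_power: "s (x ^ n) = s x ^ n"
  by (induction n) (auto simp: s_one s_mult)

lemma s_of_nat: "0 < n \<Longrightarrow> s (of_nat n) = 1"
proof (induction n)
  case (Suc n)
  show ?case
  proof (cases "n = 0")
    case False
    with Suc have "0 < s (of_nat n + 1)" by (intro s_pos_add) (auto simp: s_one)
    then show ?thesis using s_range[of "of_nat n + 1"] by (auto simp: add.commute)
  qed (simp add: s_one)
qed simp

lemma s_null_mult: "s x = 0 \<Longrightarrow> s (x * y) = 0" "s y = 0 \<Longrightarrow> s (x * y) = 0"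
  by (simp_all add: s_mult)

lemma s_null_sum: "(\<And>i. i \<in> A \<Longrightarrow> s (f i) = 0) \<Longrightarrow> s (sum f A) = 0"
  by (induction A rule: infinite_finite_induct) (auto simp: s_null_add)

lemma finite_has_least:
  assumes "finite W" "W \<noteq> {}"
  shows "\<exists>w\<in>W. \<forall>x\<in>W. 0 \<le> s (x - w)"
  using assms
proof (induction W rule: finite_ne_induct)
  case (insert x F)
  then obtain w where w: "w \<in> F" "\<forall>x\<in>F. 0 \<le> s (x - w)" by blast
  show ?case
  proof (cases "0 \<le> s (x - w)")
    case False
    then have "0 \<le> s (w - x)" using s_diff_swap[of x w] by simp
    then show ?thesis using w s_trans[of w x] by (intro bexI[of _ x]) auto
  qed (use w in auto)
qed auto

lemma finite_has_greatest:
  assumes "finite W" "W \<noteq> {}"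
  shows "\<exists>w\<in>W. \<forall>x\<in>W. 0 \<le> s (w - x)"
proof -
  obtain w where w: "w \<in> uminus ` W" "\<forall>x\<in>uminus ` W. 0 \<le> s (x - w)"
    using finite_has_least[of "uminus ` W"] assms by blast
  then obtain v where "v \<in> W" "w = - v" by blast
  with w(2) show ?thesis by (auto intro!: bexI[of _ v] simp: algebra_simps)
qed

section \<open>Roots of polynomials over a ring with a sign function\<close>

text \<open>
  The polynomials that vanish in the residue domain. Two polynomials that differ by such a polynomial are
  interchangeable in all that follows.
\<close>

definition pnull :: "'a poly \<Rightarrow> bool" where
  "pnull p \<longleftrightarrow> (\<forall>i. s (coeff p i) = 0)"

lemma pnull_0 [simp]: "pnull 0" by (simp add: pnull_def)

lemma pnull_add: "pnull p \<Longrightarrow> pnull q \<Longrightarrow> pnull (p + q)"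
  by (simp add: pnull_def s_null_add)

lemma pnull_minus: "pnull (- p) \<longleftrightarrow> pnull p"
  by (simp add: pnull_def s_minus)

lemma pnull_diff: "pnull p \<Longrightarrow> pnull q \<Longrightarrow> pnull (p - q)"
  using pnull_add[of p "- q"] by (simp add: pnull_minus)

lemma pnull_mult: "pnull p \<Longrightarrow> pnull (p * q)" "pnull q \<Longrightarrow> pnull (p * q)"
  by (auto simp: pnull_def coeff_mult s_mult intro!: s_null_sum)

lemma pnull_diff_trans: "pnull (p - q) \<Longrightarrow> pnull (q - r) \<Longrightarrow> pnull (p - r)"
  using pnull_add[of "p - q" "q - r"] by simp

lemma pnull_diff_mult: "pnull (p - q) \<Longrightarrow> pnull (r * p - r * q)"
  using pnull_mult(2)[of "p - q" r] by (simp add: right_diff_distrib)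

lemma pnull_poly: "pnull p \<Longrightarrow> s (poly p x) = 0"
  unfolding pnull_def poly_altdef by (intro s_null_sum s_null_mult) auto

lemma pnull_diff_poly: "pnull (p - q) \<Longrightarrow> s (poly p x) = s (poly q x)"
  using pnull_poly[of "p - q" x] by (intro s_cong) simp

lemma pnull_pderiv: "pnull p \<Longrightarrow> pnull (pderiv p)"
  by (simp add: pnull_def coeff_pderiv s_null_mult)

lemma pnull_diff_cong: "pnull (p - q) \<Longrightarrow> pnull p \<longleftrightarrow> pnull q"
  using pnull_add[of "p - q" q] pnull_diff[of p "p - q"] by auto

lemma poly_diff_null:
  assumes "s (x - y) = 0"
  shows "s (poly p x) = s (poly p y)"
proof (rule s_cong)
  have "s (poly p x - poly p y) = s ((x - y) * poly (synthetic_div p y) x)"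
    using arg_cong[OF synthetic_div_correct'[of y p], of "\<lambda>q. poly q x"]
    by (intro arg_cong[of _ _ s]) (simp add: algebra_simps)
  with assms show "s (poly p x - poly p y) = 0" by (simp add: s_mult)
qed

lemma split_root:
  assumes "s (poly p u) = 0"
  shows "pnull (p - [:-u, 1:] * synthetic_div p u)"
proof -
  have "p - [:-u, 1:] * synthetic_div p u = [:poly p u:]"
    using synthetic_div_correct'[of u p] by (simp add: algebra_simps)
  with assms show ?thesis by (auto simp: pnull_def coeff_pCons split: nat.split)
qed

lemma split_root_eval:
  assumes "s (poly p u) = 0"
  shows "s (poly p x) = s (x - u) * s (poly (synthetic_div p u) x)"
proof -
  have "poly ([:-u, 1:] * synthetic_div p u) x = (x - u) * poly (synthetic_div p u) x"
    by (simp add: algebra_simps)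
  then show ?thesis using pnull_diff_poly[OF split_root[OF assms], of x] by (simp add: s_mult)
qed

text \<open>
  The formal leading coefficient may have sign \<open>0\<close>; deleting leading terms yields a representative
  whose degree is the true degree over the residue domain.
\<close>

lemma truncate_null:
  "\<exists>p'. degree p' \<le> degree p \<and> pnull (p - p') \<and> (p' = 0 \<or> s (lead_coeff p') \<noteq> 0)"
proof (induction "degree p" arbitrary: p rule: less_induct)
  case less
  show ?case
  proof (cases "s (lead_coeff p) = 0")
    case True
    define q where "q = p - monom (lead_coeff p) (degree p)"
    have n: "pnull (p - q)" using True by (simp add: q_def pnull_def)
    show ?thesis
    proof (cases "degree p = 0")
      case deg: True
      then have "pnull p" using True
        by (auto simp: pnull_def) (metis coeff_eq_0 gr0I s_zero)
      then show ?thesis by (intro exI[of _ 0]) auto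
    next
      case False
      have "degree q < degree p"
      proof (rule degree_lessI)
        show "q \<noteq> 0 \<or> 0 < degree p" using False by simp
        show "\<forall>k\<ge>degree p. coeff q k = 0"
          by (auto simp: q_def coeff_eq_0)
      qed
      from less[OF this] obtain p' where "degree p' \<le> degree q" "pnull (q - p')"
        "p' = 0 \<or> s (lead_coeff p') \<noteq> 0" by blast
      with n \<open>degree q < degree p\<close> show ?thesis
        by (intro exI[of _ p']) (auto intro: pnull_diff_trans)
    qed
  qed (intro exI[of _ p], auto)
qed

text \<open>
  Each root that is split off lowers the degree, so splitting off the root \<open>u\<close> terminates.
\<close>

lemma root_multiplicity:
  assumes "\<not> pnull p"
  shows "\<exists>m q. pnull (p - [:-u, 1:] ^ m * q) \<and> s (poly q u) \<noteq> 0"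
  using assms
proof (induction "degree p" arbitrary: p rule: less_induct)
  case less
  show ?case
  proof (cases "s (poly p u) = 0")
    case True
    note sp = split_root[OF True]
    let ?q = "synthetic_div p u"
    have nq: "\<not> pnull ?q"
      using less.prems sp pnull_diff_cong pnull_mult(2) by blast
    then have "degree p \<noteq> 0" by (metis pnull_0 synthetic_div_eq_0_iff)
    then have "degree ?q < degree p" by (simp add: degree_synthetic_div)
    from less.hyps[OF this nq] obtain m q where q: "pnull (?q - [:-u, 1:] ^ m * q)" "s (poly q u) \<noteq> 0"
      by blast
    have "pnull (p - [:-u, 1:] ^ Suc m * q)"
      using pnull_diff_trans[OF sp pnull_diff_mult[OF q(1), of "[:-u, 1:]"]]
      by (simp only: power_Suc mult.assoc)
    with q(2) show ?thesis by blast
  qed (intro exI[of _ 0] exI[of _ p], auto)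
qed

text \<open>
  Roots are counted up to elements of sign \<open>0\<close>, hence the formulation by representatives.
\<close>

lemma finite_roots:
  assumes "\<not> pnull p"
  shows "\<exists>Y. finite Y \<and> card Y \<le> degree p \<and> (\<forall>y\<in>Y. s (poly p y) = 0) \<and>
    (\<forall>x. s (poly p x) = 0 \<longrightarrow> (\<exists>y\<in>Y. s (x - y) = 0))"
  using assms
proof (induction "degree p" arbitrary: p rule: less_induct)
  case less
  show ?case
  proof (cases "\<exists>u. s (poly p u) = 0")
    case True
    then obtain u where u: "s (poly p u) = 0" by blast
    note sp = split_root[OF u]
    let ?q = "synthetic_div p u"
    have nq: "\<not> pnull ?q"
      using less.prems sp pnull_diff_cong pnull_mult(2) by blast
    then have "degree p \<noteq> 0" by (metis pnull_0 synthetic_div_eq_0_iff)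
    then have d: "degree ?q < degree p" by (simp add: degree_synthetic_div)
    have ev: "s (poly p x) = s (x - u) * s (poly ?q x)" for x
      by (rule split_root_eval[OF u])
    from less.hyps[OF d nq] obtain Y where "finite Y" "card Y \<le> degree ?q"
      "\<forall>y\<in>Y. s (poly ?q y) = 0" "\<forall>x. s (poly ?q x) = 0 \<longrightarrow> (\<exists>y\<in>Y. s (x - y) = 0)"
      by blast
    with d show ?thesis
      by (intro exI[of _ "insert u Y"]) (auto simp: ev card_insert_if)
  qed (intro exI[of _ "{}"], auto)
qed

definition ivt :: "'a poly \<Rightarrow> bool" where
  "ivt p \<longleftrightarrow> (\<forall>a b. 0 < s (b - a) \<longrightarrow> s (poly p a) * s (poly p b) < 0 \<longrightarrow>
     (\<exists>c. 0 < s (c - a) \<and> 0 < s (b - c) \<and> s (poly p c) = 0))"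

text \<open>
  The proofs of Rolle's theorem and of its consequences apply the intermediate value theorem to cofactors of \<open>p\<close> and of
  its derivative. Requiring it for all divisors of \<open>p\<close> keeps the hypothesis local to \<open>p\<close>.
\<close>

definition div_ivt :: "'a poly \<Rightarrow> bool" where
  "div_ivt p \<longleftrightarrow> (\<forall>q k. pnull (p - q * k) \<longrightarrow> ivt k)"

lemma ivt_same_sign:
  assumes "ivt p" "0 < s (b - a)"
    and "\<And>c. 0 < s (c - a) \<Longrightarrow> 0 < s (b - c) \<Longrightarrow> s (poly p c) \<noteq> 0"
    and "s (poly p a) \<noteq> 0" "s (poly p b) \<noteq> 0"
  shows "s (poly p a) = s (poly p b)"
  using assms(1)[unfolded ivt_def, rule_format, OF assms(2)] assms(3,4,5)
    s_range[of "poly p a"] s_range[of "poly p b"]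
  by auto

lemma div_ivt_ivt: "div_ivt p \<Longrightarrow> ivt p"
  unfolding div_ivt_def by (metis diff_self mult_1 pnull_0)

text \<open>
  Let \<open>w\<close> be the next root after \<open>u\<close> and split off the two roots with their multiplicities \<open>m\<close> and \<open>n\<close>, leaving \<open>h\<close>.
  The derivative is \<open>(x - u)\<^sup>m\<^sup>-\<^sup>1 (x - w)\<^sup>n\<^sup>-\<^sup>1 K\<close> with \<open>K = m (x - w) h + n (x - u) h + (x - u) (x - w) h'\<close>.
  As \<open>h\<close> has the same sign at \<open>u\<close> and at \<open>w\<close>, the cofactor \<open>K\<close> changes its sign between them.
\<close>

lemma rolle:
  assumes np: "\<not> pnull p" and dp: "div_ivt p" and dd: "div_ivt (pderiv p)"
    and uv: "0 < s (v - u)" and pu: "s (poly p u) = 0" and pv: "s (poly p v) = 0"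
  shows "\<exists>c. 0 < s (c - u) \<and> 0 < s (v - c) \<and> s (poly (pderiv p) c) = 0"
proof -
  obtain Y where Y: "finite Y" "\<forall>y\<in>Y. s (poly p y) = 0"
    "\<forall>x. s (poly p x) = 0 \<longrightarrow> (\<exists>y\<in>Y. s (x - y) = 0)"
    using finite_roots[OF np] by blast
  \<comment> \<open>Representatives of the roots in the interval open at u and closed at v; the least one
    is the root next to u.\<close>
  define W where "W = {y\<in>Y. 0 < s (y - u) \<and> 0 \<le> s (v - y)}"
  obtain y where "y \<in> Y" "s (v - y) = 0" using Y(3) pv by blast
  then have "y \<in> W" using uv s_trans1[of v u y] s_diff_swap[of v y] by (auto simp: W_def)
  with Y(1) obtain w where w: "w \<in> W" "\<forall>x\<in>W. 0 \<le> s (x - w)"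
    using finite_has_least[of W] by (auto simp: W_def)
  have uw: "0 < s (w - u)" and wv: "0 \<le> s (v - w)" and pw: "s (poly p w) = 0"
    using w Y(2) by (auto simp: W_def)
  have gap: "s (poly p x) \<noteq> 0" if "0 < s (x - u)" "0 < s (w - x)" for x
  proof
    assume "s (poly p x) = 0"
    then obtain y where y: "y \<in> Y" "s (x - y) = 0" using Y(3) by blast
    have yx: "s (y - x) = 0" using s_diff_swap[of x y] y by simp
    have "0 < s (y - u)" using s_trans1[of x u y] that(1) yx by simp
    moreover have "0 < s (w - y)" using s_trans2[of x y w] that(2) y(2) by simp
    moreover from this have "0 \<le> s (v - y)" using s_trans[of w y v] wv by simp
    ultimately have "y \<in> W" using y(1) by (simp add: W_def)
    moreover have "0 < s (w - y)" using that(2) y(2) s_trans2[of x y w] by simp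
    ultimately show False using w(2) s_diff_swap[of w y] by force
  qed
  obtain m q where q: "pnull (p - [:-u, 1:] ^ m * q)" "s (poly q u) \<noteq> 0"
    using root_multiplicity[OF np] by blast
  then have "\<not> pnull q" using pnull_poly by blast
  then obtain n h where h: "pnull (q - [:-w, 1:] ^ n * h)" "s (poly h w) \<noteq> 0"
    using root_multiplicity by blast
  have ev: "s (poly p x) = s (x - u) ^ m * s (poly q x)" for x
    using pnull_diff_poly[OF q(1), of x] by (simp add: s_mult s_power)
  have evq: "s (poly q x) = s (x - w) ^ n * s (poly h x)" for x
    using pnull_diff_poly[OF h(1), of x] by (simp add: s_mult s_power)
  have hu: "s (poly h u) \<noteq> 0" using q(2) evq[of u] by auto
  have m: "m \<noteq> 0" using pu q(2) ev[of u] by (auto intro: ccontr)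
  have n: "n \<noteq> 0" using pw h(2) uw ev[of w] evq[of w] by (auto intro: ccontr)
  let ?A = "[:-u, 1:]" and ?B = "[:-w, 1:]"
  have pz: "pnull (p - ?A ^ m * ?B ^ n * h)"
    using pnull_diff_trans[OF q(1) pnull_diff_mult[OF h(1), of "?A ^ m"]] by (simp only: mult.assoc)
  obtain m' n' where m': "m = Suc m'" and n': "n = Suc n'"
    using m n not0_implies_Suc by meson
  define K where "K = of_nat m * ?B * h + of_nat n * ?A * h + ?A * ?B * pderiv h"
  have dA: "pderiv ?A = 1" and dB: "pderiv ?B = 1" by (simp_all add: pderiv_pCons)
  have "pderiv (?A ^ m * ?B ^ n * h) = ?A ^ m' * ?B ^ n' * K"
    unfolding m' n' K_def by (rule pderiv_two_factors[OF dA dB])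
  with pnull_pderiv[OF pz] have dz: "pnull (pderiv p - ?A ^ m' * ?B ^ n' * K)"
    by (simp only: pderiv_diff)
  have evK: "poly K x = of_nat m * ((x - w) * poly h x) + of_nat n * ((x - u) * poly h x) +
      (x - u) * ((x - w) * poly (pderiv h) x)" for x
    by (simp add: K_def algebra_simps)
  have Ku: "s (poly K u) = s (u - w) * s (poly h u)"
    using s_of_nat[of m] m by (simp add: evK s_mult)
  have Kw: "s (poly K w) = s (w - u) * s (poly h w)"
    using s_of_nat[of n] n by (simp add: evK s_mult)
  have wu: "s (u - w) = - 1" "s (w - u) = 1" using uw s_range[of "w - u"] s_diff_swap[of u w] by auto
  have "\<exists>c. 0 < s (c - u) \<and> 0 < s (w - c) \<and> s (poly K c) = 0"
  proof (rule ccontr)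
    assume no: "\<not> ?thesis"
    have "ivt K" using dd dz unfolding div_ivt_def by blast
    then have "s (poly K u) = s (poly K w)"
      by (rule ivt_same_sign) (use no uw Ku Kw wu hu h(2) in auto)
    then have "s (poly h u) = - s (poly h w)" using Ku Kw wu by simp
    moreover have "ivt h" using dp pz unfolding div_ivt_def by blast
    ultimately obtain c where "0 < s (c - u)" "0 < s (w - c)" "s (poly h c) = 0"
      using uw h(2) unfolding ivt_def
      by (metis mult_minus_left neg_less_0_iff_less not_real_square_gt_zero)
    with gap[of c] ev[of c] evq[of c] show False by auto
  qed
  then obtain c where c: "0 < s (c - u)" "0 < s (w - c)" "s (poly K c) = 0" by blast
  have "s (poly (pderiv p) c) = 0"
    using pnull_diff_poly[OF dz, of c] c(3) by (simp add: s_mult)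
  with c s_trans1[of w c v] wv show ?thesis by blast
qed

text \<open>
  A root at which the derivative does not vanish is simple, and by Rolle's theorem it is the only one in the interval and
  the end points are not roots either; the cofactor of the linear factor therefore keeps its sign.
\<close>

lemma sign_change_at_root:
  assumes np: "\<not> pnull p" and dp: "div_ivt p" and dd: "div_ivt (pderiv p)"
    and zx: "0 < s (x - z)" and xz: "0 < s (z' - x)" and px: "s (poly p x) = 0"
    and nd: "\<And>c. 0 < s (c - z) \<Longrightarrow> 0 < s (z' - c) \<Longrightarrow> s (poly (pderiv p) c) \<noteq> 0"
  shows "s (poly p z) * s (poly p z') < 0"
proof -
  note sp = split_root[OF px]
  define h where "h = synthetic_div p x"
  have ev: "s (poly p y) = s (y - x) * s (poly h y)" for y
    unfolding h_def by (rule split_root_eval[OF px])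
  have dz: "pnull (pderiv p - (h + [:-x, 1:] * pderiv h))"
    using pnull_pderiv[OF sp] by (simp add: pderiv_diff pderiv_add pderiv_smult pderiv_mult pderiv_pCons h_def algebra_simps)
  have "s (poly (pderiv p) x) = s (poly h x)"
    using pnull_diff_poly[OF dz, of x] by simp
  then have hx: "s (poly h x) \<noteq> 0" using nd[OF zx xz] by simp
  have no2: "s (poly p y) \<noteq> 0" if y: "0 \<le> s (y - z)" "0 \<le> s (z' - y)" "s (y - x) \<noteq> 0" for y
  proof
    assume py: "s (poly p y) = 0"
    consider "0 < s (y - x)" | "0 < s (x - y)"
      using y(3) s_diff_swap[of x y] by linarith
    then show False
    proof cases
      case 1
      obtain c where "0 < s (c - x)" "0 < s (y - c)" "s (poly (pderiv p) c) = 0"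
        using rolle[OF np dp dd 1 px py] by blast
      then show False using nd[of c] s_trans1[of x z c] s_trans1[of y c z'] zx y by auto
    next
      case 2
      obtain c where "0 < s (c - y)" "0 < s (x - c)" "s (poly (pderiv p) c) = 0"
        using rolle[OF np dp dd 2 py px] by blast
      then show False using nd[of c] s_trans2[of y z c] s_trans1[of x c z'] xz y by auto
    qed
  qed
  have zz: "0 < s (z' - z)" using zx xz s_trans1[of x z z'] by simp
  have hz: "s (poly h z) \<noteq> 0" "s (poly h z') \<noteq> 0"
    using no2[of z] no2[of z'] ev[of z] ev[of z'] zz zx xz s_diff_swap[of z x] by auto
  have "ivt h" using dp sp unfolding div_ivt_def h_def by blast
  then have "s (poly h z) = s (poly h z')"
  proof (rule ivt_same_sign[OF _ zz _ hz])
    fix c assume c: "0 < s (c - z)" "0 < s (z' - c)"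
    show "s (poly h c) \<noteq> 0"
    proof (cases "s (c - x) = 0")
      case True
      then show ?thesis using hx poly_diff_null by simp
    next
      case False
      then show ?thesis using no2[of c] ev[of c] c by auto
    qed
  qed
  moreover have "s (z - x) = - 1" "s (z' - x) = 1"
    using zx xz s_range[of "x - z"] s_range[of "z' - x"] s_diff_swap[of z x] by auto
  ultimately show ?thesis using ev[of z] ev[of z'] hz
    by (auto simp: zero_less_mult_iff)
qed

end

section \<open>Existence and extension of sign functions\<close>

definition preordering :: "'a::comm_ring_1 set \<Rightarrow> bool" where
  "preordering P \<longleftrightarrow> (\<forall>x\<in>P. \<forall>y\<in>P. x + y \<in> P \<and> x * y \<in> P) \<and> (\<forall>x. x * x \<in> P)"

lemma preordering_adjoin:
  assumes P: "preordering P"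
  shows "preordering {t + a * u | t u. t \<in> P \<and> u \<in> P}" (is "preordering ?Q")
  unfolding preordering_def
proof (intro conjI ballI allI)
  have cl: "x + y \<in> P" "x * y \<in> P" "z * z \<in> P" if "x \<in> P" "y \<in> P" for x y z
    using P that by (auto simp: preordering_def)
  have sq: "z * z \<in> P" for z
    using P by (auto simp: preordering_def)
  fix x y assume "x \<in> ?Q" "y \<in> ?Q"
  then obtain t u t' u' where *: "x = t + a * u" "y = t' + a * u'" "t \<in> P" "u \<in> P" "t' \<in> P" "u' \<in> P"
    by blast
  have "x + y = (t + t') + a * (u + u')"
    unfolding * by (simp add: algebra_simps)
  then show "x + y \<in> ?Q" using cl(1) * by blast
  have "x * y = (t * t' + (a * a) * (u * u')) + a * (t * u' + u * t')"
    unfolding * by (simp add: algebra_simps)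
  moreover have "t * t' + (a * a) * (u * u') \<in> P" "t * u' + u * t' \<in> P"
    using * by (intro cl(1) cl(2) sq; simp)+
  ultimately show "x * y \<in> ?Q" by blast
next
  fix x
  have "x * x = x * x + a * (0 * 0)" by simp
  moreover have "x * x \<in> P" "0 * 0 \<in> P" using P unfolding preordering_def by blast+
  ultimately show "x * x \<in> ?Q" by blast
qed

lemma maximal_preordering:
  assumes T: "preordering T" and TM: "T \<inter> uminus ` M = {}"
  obtains P where "preordering P" "T \<subseteq> P" "P \<inter> uminus ` M = {}"
    "\<And>Q. preordering Q \<Longrightarrow> P \<subseteq> Q \<Longrightarrow> Q \<inter> uminus ` M = {} \<Longrightarrow> Q = P"
proof -
  let ?A = "{P. preordering P \<and> T \<subseteq> P \<and> P \<inter> uminus ` M = {}}"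
  have "\<exists>P\<in>?A. \<forall>Q\<in>?A. P \<subseteq> Q \<longrightarrow> Q = P"
  proof (rule subset_Zorn_nonempty)
    show "?A \<noteq> {}" using T TM by blast
    fix C assume C: "C \<noteq> {}" "subset.chain ?A C"
    then have sub: "C \<subseteq> ?A" and lin: "\<And>X Y. X \<in> C \<Longrightarrow> Y \<in> C \<Longrightarrow> X \<subseteq> Y \<or> Y \<subseteq> X"
      by (auto simp: subset_chain_def)
    have "preordering (\<Union>C)"
      unfolding preordering_def
    proof (intro conjI ballI allI)
      fix x y assume "x \<in> \<Union>C" "y \<in> \<Union>C"
      then obtain X where "X \<in> C" "x \<in> X" "y \<in> X" using lin by blast
      moreover from this have "preordering X" using sub by blast
      ultimately show "x + y \<in> \<Union>C" "x * y \<in> \<Union>C" by (auto simp: preordering_def)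
    next
      fix x show "x * x \<in> \<Union>C" using C(1) sub by (force simp: preordering_def)
    qed
    then show "\<Union>C \<in> ?A" using C(1) sub by blast
  qed
  then obtain P where P: "P \<in> ?A" and max: "\<forall>Q\<in>?A. P \<subseteq> Q \<longrightarrow> Q = P" by (elim bexE)
  show ?thesis
  proof (rule that)
    show "Q = P" if "preordering Q" "P \<subseteq> Q" "Q \<inter> uminus ` M = {}" for Q
      using max that P by blast
  qed (use P in auto)
qed

text \<open>
  A preordering that is maximal among those disjoint from \<open>- M\<close> is a prime cone. If \<open>a\<close> is not in it, then
  \<open>a u = - (m + t)\<close> for some \<open>m \<in> M\<close> and some \<open>t\<close>, \<open>u\<close> in the cone; multiplying two such identities shows
  that \<open>a\<close> or \<open>- a\<close> lies in the cone and that the support is prime.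
\<close>

lemma preordering_extends_to_sign_function:
  fixes T M :: "'a::idom set"
  assumes T: "preordering T" and TM: "T \<inter> uminus ` M = {}" and MT: "M \<subseteq> T"
    and M1: "1 \<in> M" and MM: "\<And>x y. x \<in> M \<Longrightarrow> y \<in> M \<Longrightarrow> x * y \<in> M"
  shows "\<exists>s. sign_function s \<and> (\<forall>t\<in>T. 0 \<le> s t) \<and> (\<forall>m\<in>M. s m = 1)"
proof -
  obtain P where P: "preordering P" and TP: "T \<subseteq> P" and PM: "P \<inter> uminus ` M = {}"
    and max: "\<And>Q. preordering Q \<Longrightarrow> P \<subseteq> Q \<Longrightarrow> Q \<inter> uminus ` M = {} \<Longrightarrow> Q = P"
    using maximal_preordering[OF T TM] by blast
  have add: "x + y \<in> P" and mult: "x * y \<in> P" if "x \<in> P" "y \<in> P" for x y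
    using P that by (auto simp: preordering_def)
  have sq: "x * x \<in> P" for x using P by (simp add: preordering_def)
  have zero: "0 \<in> P" using sq[of 0] by simp
  have one: "1 \<in> P" using sq[of 1] by simp
  have adj: "\<exists>m\<in>M. \<exists>t\<in>P. \<exists>u\<in>P. a * u = - (m + t)" if a: "a \<notin> P" for a
  proof -
    let ?Q = "{t + a * u | t u. t \<in> P \<and> u \<in> P}"
    have "P \<subseteq> ?Q" 
    proof
      fix x assume "x \<in> P"
      then show "x \<in> ?Q" using zero by (intro CollectI exI[of _ x] exI[of _ 0]) simp
    qed
    moreover have "a \<in> ?Q" 
      using zero one by (intro CollectI exI[of _ 0] exI[of _ 1]) simp
    ultimately have "?Q \<inter> uminus ` M \<noteq> {}"
      using max[OF preordering_adjoin[OF P]] a by blast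
    then obtain z where "z \<in> ?Q" "z \<in> uminus ` M" by blast
    then obtain m t u where "m \<in> M" "t \<in> P" "u \<in> P" "- m = t + a * u" by auto
    moreover from this have "a * u = - (m + t)" by (simp add: algebra_simps)
    ultimately show ?thesis by blast
  qed
  have no: "- m \<notin> P" if "m \<in> M" for m using PM that by blast
  have total: "a \<in> P \<or> - a \<in> P" for a
  proof (rule ccontr)
    assume "\<not> ?thesis"
    then obtain m t u m' t' u' where *: "m \<in> M" "t \<in> P" "u \<in> P" "a * u = - (m + t)"
      "m' \<in> M" "t' \<in> P" "u' \<in> P" "- a * u' = - (m' + t')"
      using adj[of a] adj[of "- a"] by blast
    have "(a * u) * (- a * u') = (m + t) * (m' + t')"
      unfolding *(4,8) by (simp only: minus_mult_minus)
    then have "(m + t) * (m' + t') = - ((a * a) * (u * u'))" by (simp add: mult_ac)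
    then have "- ((m + t) * (m' + t')) = (a * a) * (u * u')" by (simp only: minus_minus)
    moreover have "- (m * m') = - ((m + t) * (m' + t')) + (m * t' + t * m' + t * t')"
      by (simp add: algebra_simps)
    ultimately have "- (m * m') = (a * a) * (u * u') + (m * t' + t * m' + t * t')" by simp
    moreover have "m \<in> P" "m' \<in> P" using *(1,5) MT TP by blast+
    then have "(a * a) * (u * u') + (m * t' + t * m' + t * t') \<in> P"
      using *(2,3,6,7) by (intro add mult[OF sq mult] mult)
    ultimately show False using no[OF MM[OF *(1,5)]] by simp
  qed
  \<comment> \<open>The support of the cone.\<close>
  define N where "N = {x \<in> P. - x \<in> P}"
  have N_minus: "x \<in> N \<Longrightarrow> - x \<in> N" for x by (simp add: N_def)
  have N_mult: "x * y \<in> N" if "x \<in> N" for x y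
    using total[of y] mult[of x y] mult[of "- x" y] mult[of x "- y"] mult[of "- x" "- y"] that
    by (auto simp: N_def)
  have N_prime0: False if ab: "a * b \<in> N" and a: "a \<notin> P" and b: "b \<notin> P" for a b
  proof -
    obtain m t u m' t' u' where *: "m \<in> M" "t \<in> P" "u \<in> P" "a * u = - (m + t)"
      "m' \<in> M" "t' \<in> P" "u' \<in> P" "b * u' = - (m' + t')"
      using adj[OF a] adj[OF b] by blast
    have "(a * u) * (b * u') = (m + t) * (m' + t')"
      unfolding *(4,8) by (simp only: minus_mult_minus)
    then have "(m + t) * (m' + t') = (a * b) * (u * u')" by (simp add: mult_ac)
    moreover have "- (m * m') = - ((m + t) * (m' + t')) + (m * t' + t * m' + t * t')"
      by (simp add: algebra_simps)
    ultimately have eq: "- (m * m') = - ((a * b) * (u * u')) + (m * t' + t * m' + t * t')" by simp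
    have "- ((a * b) * (u * u')) \<in> P"
      using N_minus[OF N_mult[OF ab]] by (simp add: N_def)
    moreover have "m \<in> P" "m' \<in> P" using *(1,5) MT TP by blast+
    ultimately have "- ((a * b) * (u * u')) + (m * t' + t * m' + t * t') \<in> P"
      using *(2,3,6,7) by (intro add mult)
    then show False using no[OF MM[OF *(1,5)]] eq by simp
  qed
  have N_prime: "a \<in> N \<or> b \<in> N" if "a * b \<in> N" for a b
  proof (rule ccontr)
    assume c: "\<not> ?thesis"
    obtain a' where a': "a' = a \<or> a' = - a" "a' \<notin> P" using c by (auto simp: N_def)
    obtain b' where b': "b' = b \<or> b' = - b" "b' \<notin> P" using c by (auto simp: N_def)
    have "a' * b' \<in> N" using that a'(1) b'(1) N_minus[of "a * b"] by auto
    with N_prime0 a' b' show False by blast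
  qed
  define s where "s x = (if x \<in> N then 0 else if x \<in> P then 1 else (-1::real))" for x
  have s_nonneg: "0 \<le> s x \<longleftrightarrow> x \<in> P" for x by (auto simp: s_def N_def)
  have s_null: "s x = 0 \<longleftrightarrow> x \<in> N" for x by (auto simp: s_def)
  have s_rng: "s x \<in> {-1, 0, 1}" for x by (simp add: s_def)
  have s_min: "s (- x) = - s x" for x using total[of x] by (auto simp: s_def N_def)
  have s_pos: "s (x * y) = s x * s y" if "x \<in> P" "y \<in> P" for x y
    using mult[OF that] N_prime[of x y] N_mult[of x y] N_mult[of y x] that
    by (auto simp: s_def mult.commute)
  have "sign_function s"
  proof
    show "s x \<in> {-1, 0, 1}" for x by (rule s_rng)
    show "s 1 = 1" using no[OF M1] one by (auto simp: s_def N_def)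
    show "s (- x) = - s x" for x by (rule s_min)
    show "s (x * y) = s x * s y" for x y
      using total[of x] total[of y] s_pos[of x y] s_pos[of "- x" y] s_pos[of x "- y"] s_pos[of "- x" "- y"]
      by (auto simp: s_min)
    show "0 \<le> s x \<Longrightarrow> 0 \<le> s y \<Longrightarrow> 0 \<le> s (x + y)" for x y
      using add by (simp add: s_nonneg)
    show "s (x + y) = s y" if "s x = 0" for x y
    proof -
      have x: "x \<in> P" "- x \<in> P" using that by (auto simp: s_null N_def)
      have "y \<in> P \<longleftrightarrow> x + y \<in> P" for y
        using add[OF x(1), of y] add[OF x(2), of "x + y"] by auto
      moreover from this[of "- x - y"] have "- y \<in> P \<longleftrightarrow> - (x + y) \<in> P"
        by (simp add: algebra_simps)
      ultimately show ?thesis by (auto simp: s_def N_def)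
    qed
  qed
  moreover have "s m = 1" if "m \<in> M" for m
    using that MT TP no by (auto simp: s_def N_def)
  ultimately show ?thesis using TP s_nonneg by blast
qed

lemma ex_pseudo_division:
  fixes g :: "'a::idom poly"
  assumes "0 < degree g"
  shows "\<exists>e Q r. smult (lead_coeff g ^ e) f = g * Q + r \<and> degree r < degree g"
proof -
  have "g \<noteq> 0" using assms by auto
  obtain Q r where "pseudo_divmod f g = (Q, r)" by fastforce
  from pseudo_divmod[OF \<open>g \<noteq> 0\<close> this] assms show ?thesis by (metis degree_0)
qed

context sign_function
begin

text \<open>
  The preordering of the polynomial ring that is generated by the nonnegative constants.
\<close>

inductive_set weighted_sos :: "'a poly set" where
  zero: "0 \<in> weighted_sos"
| step: "0 \<le> s c \<Longrightarrow> q \<in> weighted_sos \<Longrightarrow> smult c (f * f) + q \<in> weighted_sos"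

lemma weighted_sos_add: "p \<in> weighted_sos \<Longrightarrow> q \<in> weighted_sos \<Longrightarrow> p + q \<in> weighted_sos"
  by (induction rule: weighted_sos.induct) (auto simp: add.assoc intro: weighted_sos.step)

lemma weighted_sos_square: "0 \<le> s c \<Longrightarrow> smult c (f * f) \<in> weighted_sos"
  using weighted_sos.step[OF _ weighted_sos.zero] by simp

lemma weighted_sos_smult_square: "p \<in> weighted_sos \<Longrightarrow> 0 \<le> s c \<Longrightarrow> smult c (f * f) * p \<in> weighted_sos"
proof (induction rule: weighted_sos.induct)
  case (step d q g)
  have "smult c (f * f) * (smult d (g * g) + q) = smult (c * d) ((f * g) * (f * g)) + smult c (f * f) * q"
    by (simp add: distrib_left mult_ac)
  then show ?case using step weighted_sos.step[of "c * d" "smult c (f * f) * q" "f * g"] by (simp add: s_mult)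
qed (simp add: weighted_sos.zero)

lemma weighted_sos_mult: "p \<in> weighted_sos \<Longrightarrow> q \<in> weighted_sos \<Longrightarrow> p * q \<in> weighted_sos"
proof (induction rule: weighted_sos.induct)
  case (step c p f)
  then have "smult c (f * f) * q + p * q \<in> weighted_sos" by (intro weighted_sos_add weighted_sos_smult_square)
  then show ?case by (simp only: distrib_right)
qed (simp add: weighted_sos.zero)

lemma weighted_sos_smult: "p \<in> weighted_sos \<Longrightarrow> 0 \<le> s c \<Longrightarrow> smult c p \<in> weighted_sos"
  using weighted_sos_smult_square[of p c 1] by simp

lemma weighted_sos_poly_nonneg: "p \<in> weighted_sos \<Longrightarrow> 0 \<le> s (poly p x)"
  by (induction rule: weighted_sos.induct) (auto intro!: s_add simp: s_mult)

text \<open>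
  Pseudo-division of each squared polynomial by \<open>g\<close>. An even power of the leading coefficient is a harmless positive weight.
\<close>

lemma weighted_sos_reduce:
  assumes "q \<in> weighted_sos" and g: "0 < degree g"
  shows "\<exists>e Q. \<exists>r\<in>weighted_sos. smult (lead_coeff g ^ (2 * e)) q = g * Q + r \<and> degree r \<le> 2 * degree g - 2"
  using assms(1)
proof (induction rule: weighted_sos.induct)
  case zero
  show ?case by (intro exI[of _ 0] bexI[of _ 0]) (auto simp: weighted_sos.zero)
next
  case (step c q f)
  let ?l = "lead_coeff g"
  obtain e Q r where IH: "r \<in> weighted_sos" "smult (?l ^ (2 * e)) q = g * Q + r" "degree r \<le> 2 * degree g - 2"
    using step.IH by blast
  obtain e' Q' R where D: "smult (?l ^ e') f = g * Q' + R" "degree R < degree g"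
    using ex_pseudo_division[OF g] by blast
  have sq: "0 \<le> s (?l ^ (2 * k))" for k by (simp add: s_power power_mult)
  have "smult (?l ^ (2 * e')) (f * f) = (g * Q' + R) * (g * Q' + R)"
    unfolding D(1)[symmetric] by (simp add: mult_2 power_add)
  then have "smult (?l ^ (2 * (e + e'))) (smult c (f * f) + q) =
    smult (?l ^ (2 * e) * c) ((g * Q' + R) * (g * Q' + R)) + smult (?l ^ (2 * e')) (g * Q + r)"
    unfolding IH(2)[symmetric]
    by (simp add: smult_add_right power_add mult_ac)
      (metis (no_types, opaque_lifting) mult.commute smult_smult)
  also have "\<dots> = g * (smult (?l ^ (2 * e) * c) (Q' * (g * Q' + R) + R * Q') + smult (?l ^ (2 * e')) Q) +
     (smult (?l ^ (2 * e) * c) (R * R) + smult (?l ^ (2 * e')) r)" (is "_ = _ + ?r")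
    by (simp add: algebra_simps smult_add_right)
  finally have eq: "smult (?l ^ (2 * (e + e'))) (smult c (f * f) + q) = g * (smult (?l ^ (2 * e) * c) (Q' * (g * Q' + R) + R * Q') + smult (?l ^ (2 * e')) Q) + ?r" .
  have "?r \<in> weighted_sos"
    using step.hyps(1) sq IH(1) by (intro weighted_sos.step weighted_sos_smult) (auto simp: s_mult)
  moreover have "degree (smult (?l ^ (2 * e) * c) (R * R)) \<le> 2 * degree g - 2"
    using degree_smult_le[of "?l ^ (2 * e) * c" "R * R"] degree_mult_le[of R R] D(2) by linarith
  then have "degree ?r \<le> 2 * degree g - 2"
    using IH(3) degree_smult_le[of "?l ^ (2 * e')" r] by (intro degree_add_le) linarith+
  ultimately show ?case using eq by blast
qed

text \<open>
  If \<open>m + q = g H\<close>, one may reduce \<open>q\<close> modulo \<open>g\<close>, so that the left hand side has degree at most \<open>2 deg g - 2\<close> and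
  \<open>H\<close> has smaller degree than \<open>g\<close>. The left hand side is positive at \<open>a\<close> and at \<open>b\<close>, so \<open>H\<close> has the same
  signs as \<open>g\<close> there, and the identity is a certificate of the same kind for \<open>H\<close>. Infinite descent.
\<close>

lemma no_certificate_at_sign_change:
  assumes "s (poly g a) * s (poly g b) < 0" "0 < s m" "q \<in> weighted_sos"
  shows "\<not> pnull ([:m:] + q - g * H)"
  using assms
proof (induction "degree g" arbitrary: g H m q rule: less_induct)
  case less
  show ?case
  proof
    assume nul: "pnull ([:m:] + q - g * H)"
    obtain g' where g': "degree g' \<le> degree g" "pnull (g - g')" "g' = 0 \<or> s (lead_coeff g') \<noteq> 0"
      using truncate_null by blast
    have sg: "s (poly g x) = s (poly g' x)" for x by (rule pnull_diff_poly[OF g'(2)])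
    have "g' \<noteq> 0" using less.prems(1) by (auto simp: sg)
    have d: "0 < degree g'"
    proof (rule ccontr)
      assume "\<not> ?thesis"
      then obtain c where "g' = [:c:]" by (metis degree_0_id gr0I)
      then show False using less.prems(1) by (simp add: sg not_less)
    qed
    obtain e Q r where r: "r \<in> weighted_sos" "smult (lead_coeff g' ^ (2 * e)) q = g' * Q + r"
      "degree r \<le> 2 * degree g' - 2"
      using weighted_sos_reduce[OF less.prems(3) d] by blast
    define c where "c = lead_coeff g' ^ (2 * e)"
    have c: "s c = 1"
      using g'(3) \<open>g' \<noteq> 0\<close> s_range[of "lead_coeff g'"] by (auto simp: c_def s_power power_mult)
    have cm: "0 < s (c * m)" using less.prems(2) by (simp add: s_mult c)
    have "pnull (([:m:] + q - g * H) + (g - g') * H)"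
      by (intro pnull_add nul pnull_mult(1) g'(2))
    then have "pnull ([:c:] * ([:m:] + q - g' * H))"
      by (intro pnull_mult(2)) (simp add: algebra_simps)
    moreover have "[:c:] * ([:m:] + q - g' * H) = [:c * m:] + r - g' * (smult c H - Q)"
      using r(2)[folded c_def] by (simp add: algebra_simps smult_add_right smult_diff_right)
    ultimately have n1: "pnull ([:c * m:] + r - g' * (smult c H - Q))" by simp
    obtain H' where H': "pnull ((smult c H - Q) - H')" "H' = 0 \<or> s (lead_coeff H') \<noteq> 0"
      using truncate_null by blast
    have n2: "pnull ([:c * m:] + r - g' * H')"
      using pnull_add[OF n1 pnull_diff_mult[OF H'(1), of g']] by (simp add: algebra_simps)
    have pos: "s (poly g' x) * s (poly H' x) = 1" for x
    proof -
      have "0 < s (poly ([:c * m:] + r) x)"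
        using cm weighted_sos_poly_nonneg[OF r(1), of x] by (simp add: s_pos_add)
      moreover have "s (poly ([:c * m:] + r) x) = s (poly (g' * H') x)"
        by (rule pnull_diff_poly[OF n2])
      ultimately show ?thesis using s_range[of "poly g' x * poly H' x"] by (auto simp: s_mult)
    qed
    then have "H' \<noteq> 0" by fastforce
    \<comment> \<open>Comparing coefficients: the product has true degree equal to the sum of the degrees.\<close>
    have "s (coeff (g' * H') (degree g' + degree H')) \<noteq> 0"
      using g'(3) \<open>g' \<noteq> 0\<close> H'(2) \<open>H' \<noteq> 0\<close> by (simp add: coeff_mult_degree_sum s_mult)
    moreover have "s (coeff ([:c * m:] + r) (degree g' + degree H') - coeff (g' * H') (degree g' + degree H')) = 0"
      using n2 unfolding pnull_def coeff_diff by blast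
    ultimately have "coeff ([:c * m:] + r) (degree g' + degree H') \<noteq> 0"
      using s_cong by fastforce
    then have "degree g' + degree H' \<le> degree ([:c * m:] + r)" by (rule le_degree)
    also have "\<dots> \<le> 2 * degree g' - 2" using r(3) by (intro degree_add_le) auto
    finally have "degree H' < degree g" using d g'(1) by linarith
    moreover have "s (poly H' a) * s (poly H' b) < 0"
    proof -
      have "s (poly H' x) = s (poly g' x)" for x
        using pos[of x] s_range[of "poly g' x"] by auto
      then show ?thesis using less.prems(1) by (simp add: sg)
    qed
    ultimately have "\<not> pnull ([:c * m:] + r - H' * g')"
      using less.hyps cm r(1) by blast
    with n2 show False by (simp add: mult.commute)
  qed
qed

text \<open>
  The multiplicative set of positive constants keeps the positive elements positive, so that \<open>s\<close> is extended and not
  merely specialised.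
\<close>

lemma sign_function_extension:
  assumes T: "preordering T" and null: "\<And>p. pnull p \<Longrightarrow> p \<in> T"
    and nonneg: "\<And>c. 0 < s c \<Longrightarrow> [:c:] \<in> T" and neg: "\<And>c. 0 < s c \<Longrightarrow> - [:c:] \<notin> T"
  shows "\<exists>s'. sign_function s' \<and> (\<forall>x. s' [:x:] = s x) \<and> (\<forall>t\<in>T. 0 \<le> s' t)"
proof -
  let ?M = "(\<lambda>c. [:c:]) ` {c. 0 < s c}"
  have M1: "1 \<in> ?M" by (rule image_eqI[of _ _ 1]) (auto simp: s_one)
  have "\<exists>s'. sign_function s' \<and> (\<forall>t\<in>T. 0 \<le> s' t) \<and> (\<forall>m\<in>?M. s' m = 1)"
  proof (rule preordering_extends_to_sign_function[OF T _ _ M1])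
    show "x * y \<in> ?M" if "x \<in> ?M" "y \<in> ?M" for x y
      using that by (auto simp: s_mult intro!: image_eqI[of _ _ "_ * _"])
  qed (use nonneg neg in auto)
  then obtain s' where s': "sign_function s'" "\<forall>t\<in>T. 0 \<le> s' t" "\<forall>m\<in>?M. s' m = 1" by blast
  interpret s': sign_function s' by (rule s'(1))
  have "s' [:x:] = s x" for x
  proof -
    consider "s x = 1" | "s (- x) = 1" | "s x = 0" using s_range[of x] by (auto simp: s_minus)
    then show ?thesis
    proof cases
      case 2
      then have "s' [:- x:] = 1" using s'(3) by simp
      then show ?thesis using 2 s'.s_minus[of "[:x:]"] by (simp add: s_minus)
    next
      case 3
      then have "pnull [:x:]" "pnull (- [:x:])"
        by (auto simp: pnull_def coeff_pCons s_minus split: nat.split)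
      then have "0 \<le> s' [:x:]" "0 \<le> s' (- [:x:])" using null s'(2) by blast+
      then show ?thesis using 3 s'.s_minus[of "[:x:]"] by simp
    qed (use s'(3) in auto)
  qed
  with s' show ?thesis by blast
qed

text \<open>
  The preordering generated by the nonnegative constants and the ideal of \<open>g\<close> contains no negative constant, by
  \<open>no_certificate_at_sign_change\<close>; in the extension the variable is a root of \<open>g\<close>.
\<close>

lemma adjoin_root:
  assumes sc: "s (poly g a) * s (poly g b) < 0"
  shows "\<exists>s'. sign_function s' \<and> (\<forall>x. s' [:x:] = s x) \<and> s' g = 0"
proof -
  define T where "T = {t. \<exists>q\<in>weighted_sos. \<exists>H. pnull (t - (q + g * H))}"
  have TI: "t \<in> T" if "q \<in> weighted_sos" "pnull (t - (q + g * H))" for t q H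
    using that by (auto simp: T_def)
  have "preordering T"
    unfolding preordering_def
  proof (intro conjI ballI allI)
    fix x y assume "x \<in> T" "y \<in> T"
    then obtain q H q' H' where *: "q \<in> weighted_sos" "pnull (x - (q + g * H))" "q' \<in> weighted_sos" "pnull (y - (q' + g * H'))"
      by (auto simp: T_def)
    show "x + y \<in> T"
      by (rule TI[OF weighted_sos_add[OF *(1,3)], of _ "H + H'"])
        (use pnull_add[OF *(2,4)] in \<open>simp add: algebra_simps\<close>)
    have "pnull ((x - (q + g * H)) * y + (q + g * H) * (y - (q' + g * H')))"
      by (intro pnull_add pnull_mult(1)[OF *(2)] pnull_mult(2)[OF *(4)])
    then show "x * y \<in> T"
      by (intro TI[OF weighted_sos_mult[OF *(1,3)], of _ "q * H' + H * q' + H * g * H'"]) (simp add: algebra_simps)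
  next
    fix x show "x * x \<in> T"
      using weighted_sos_square[of 1 x] by (intro TI[of "x * x" _ 0]) (auto simp: s_one)
  qed
  moreover have "p \<in> T" if "pnull p" for p
    using that by (intro TI[of 0 _ 0]) (auto simp: weighted_sos.zero)
  moreover have "[:c:] \<in> T" if "0 < s c" for c
    using that weighted_sos_square[of c 1] by (intro TI[of "[:c:]" _ 0]) auto
  moreover have "- [:c:] \<notin> T" if c: "0 < s c" for c
  proof
    assume "- [:c:] \<in> T"
    then obtain q H where q: "q \<in> weighted_sos" "pnull (- [:c:] - (q + g * H))" by (auto simp: T_def)
    from q(2) have "pnull (- (- [:c:] - (q + g * H)))" by (simp only: pnull_minus)
    also have "- (- [:c:] - (q + g * H)) = [:c:] + q - g * (- H)" by simp
    finally show False using no_certificate_at_sign_change[OF sc c q(1)] by blast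
  qed
  ultimately obtain s' where s': "sign_function s'" "\<forall>x. s' [:x:] = s x" "\<forall>t\<in>T. 0 \<le> s' t"
    using sign_function_extension by blast
  interpret s': sign_function s' by (rule s'(1))
  have "g \<in> T" by (rule TI[of 0 _ 1]) (auto simp: weighted_sos.zero)
  moreover have "- g \<in> T" by (rule TI[of 0 _ "-1"]) (auto simp: weighted_sos.zero)
  ultimately have "0 \<le> s' g" "0 \<le> s' (- g)" using s'(3) by blast+
  then have "s' g = 0" by (simp add: s'.s_minus)
  with s' show ?thesis by blast
qed

text \<open>
  The order in which the leading coefficient decides makes the variable larger than every quotient of elements of the
  ground ring. It is not enough to exceed the elements themselves: a positive \<open>c\<close> may be infinitely small and
  the ring need not contain its inverse.
\<close>

lemma adjoin_infinite:
  "\<exists>s'. sign_function s' \<and> (\<forall>x. s' [:x:] = s x) \<and> (\<forall>c x. 0 < s c \<longrightarrow> 0 < s' [:x, c:])"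
proof -
  define T where "T = {t. \<exists>p. pnull (t - p) \<and> (p = 0 \<or> 0 < s (lead_coeff p))}"
  have TI: "t \<in> T" if "pnull (t - p)" "p = 0 \<or> 0 < s (lead_coeff p)" for t p
    using that by (auto simp: T_def)
  have "preordering T"
    unfolding preordering_def
  proof (intro conjI ballI allI)
    fix x y assume "x \<in> T" "y \<in> T"
    then obtain p q where *: "pnull (x - p)" "p = 0 \<or> 0 < s (lead_coeff p)"
      "pnull (y - q)" "q = 0 \<or> 0 < s (lead_coeff q)"
      by (auto simp: T_def)
    have "0 < s (lead_coeff (p + q))" if pq: "0 < s (lead_coeff p)" "0 < s (lead_coeff q)"
    proof -
      consider "degree p < degree q" | "degree q < degree p" | "degree p = degree q" by linarith
      then show ?thesis
      proof cases
        case 1 then show ?thesis using pq by (metis lead_coeff_add_le)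
      next
        case 2 then show ?thesis using pq by (metis lead_coeff_add_le add.commute)
      next
        case 3
        have "0 < s (lead_coeff p + lead_coeff q)" using pq by (simp add: s_pos_add)
        then have "coeff (p + q) (degree p) \<noteq> 0" using 3 by auto
        then have "degree (p + q) = degree p"
          using 3 by (metis antisym degree_add_le le_degree order_refl)
        with 3 \<open>0 < s (lead_coeff p + lead_coeff q)\<close> show ?thesis by simp
      qed
    qed
    then have "p + q = 0 \<or> 0 < s (lead_coeff (p + q))" using * by auto
    moreover have "pnull (x + y - (p + q))"
      using pnull_add[OF *(1,3)] by (simp add: algebra_simps)
    ultimately show "x + y \<in> T" using TI by blast
    have "pnull ((x - p) * y + p * (y - q))"
      by (intro pnull_add pnull_mult(1)[OF *(1)] pnull_mult(2)[OF *(3)])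
    then have "pnull (x * y - p * q)" by (simp add: algebra_simps)
    moreover have "p * q = 0 \<or> 0 < s (lead_coeff (p * q))"
      using * by (auto simp: lead_coeff_mult s_mult)
    ultimately show "x * y \<in> T" using TI by blast
  next
    fix x
    obtain p where p: "pnull (x - p)" "p = 0 \<or> s (lead_coeff p) \<noteq> 0" using truncate_null by blast
    have "pnull ((x - p) * (x + p))" by (rule pnull_mult(1)[OF p(1)])
    then have "pnull (x * x - p * p)" by (simp add: algebra_simps)
    moreover have "p * p = 0 \<or> 0 < s (lead_coeff (p * p))"
      using p(2) by (auto simp: lead_coeff_mult s_mult zero_less_mult_iff)
    ultimately show "x * x \<in> T" using TI by blast
  qed
  moreover have "p \<in> T" if "pnull p" for p using that by (intro TI[of _ 0]) auto
  moreover have "[:c:] \<in> T" if "0 < s c" for c using that by (intro TI[of _ "[:c:]"]) auto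
  moreover have "- [:c:] \<notin> T" if c: "0 < s c" for c
  proof
    assume "- [:c:] \<in> T"
    then obtain p where p: "pnull (- [:c:] - p)" "p = 0 \<or> 0 < s (lead_coeff p)" by (auto simp: T_def)
    have p0: "s (- c - coeff p 0) = 0" using p(1) by (auto simp: pnull_def dest: spec[of _ 0])
    show False
    proof (cases "degree p = 0")
      case True
      then show False using s_cong[OF p0] p(2) c by (auto simp: s_minus)
    next
      case False
      then have "s (coeff (- [:c:] - p) (degree p)) = - s (lead_coeff p)"
        by (cases "degree p") (auto simp: s_minus)
      then show False using p False unfolding pnull_def by auto
    qed
  qed
  ultimately obtain s' where s': "sign_function s'" "\<forall>x. s' [:x:] = s x" "\<forall>t\<in>T. 0 \<le> s' t"
    using sign_function_extension by blast
  interpret s': sign_function s' by (rule s'(1))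
  have "0 < s' [:x, c:]" if "0 < s c" for x c
  proof -
    \<comment> \<open>Membership in the cone gives only a weak inequality; lowering the constant term by one
      makes it strict.\<close>
    have "[:x - 1, c:] \<in> T" by (rule TI[of _ "[:x - 1, c:]"]) (use that in auto)
    then have "0 < s' (1 + [:x - 1, c:])"
      using s'(3) by (intro s'.s_pos_add) (auto simp: s'.s_one)
    then show ?thesis by (simp add: one_pCons)
  qed
  with s' show ?thesis by blast
qed

end

section \<open>Ring homomorphisms\<close>

definition ring_morphism :: "('a::comm_ring_1 \<Rightarrow> 'b::comm_ring_1) \<Rightarrow> bool" where
  "ring_morphism e \<longleftrightarrow> e 1 = 1 \<and> (\<forall>x y. e (x + y) = e x + e y \<and> e (x * y) = e x * e y)"

lemma ring_morphismD:
  assumes "ring_morphism e"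
  shows "e 1 = 1" "e (x + y) = e x + e y" "e (x * y) = e x * e y" "e 0 = 0" "e (- x) = - e x"
    "e (x - y) = e x - e y"
proof -
  show *: "e 1 = 1" "e (x + y) = e x + e y" "e (x * y) = e x * e y" for x y
    using assms by (auto simp: ring_morphism_def)
  show **: "e 0 = 0" using *(2)[of 0 0] by simp
  show ***: "e (- x) = - e x" for x using *(2)[of x "- x"] ** by (simp add: eq_neg_iff_add_eq_0 add.commute)
  show "e (x - y) = e x - e y" using *(2)[of x "- y"] *** by simp
qed

lemma ring_morphism_sum: "ring_morphism e \<Longrightarrow> e (sum f A) = (\<Sum>i\<in>A. e (f i))"
  by (induction A rule: infinite_finite_induct) (auto simp: ring_morphismD)

lemma ring_morphism_power: "ring_morphism e \<Longrightarrow> e (x ^ n) = e x ^ n"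
  by (induction n) (auto simp: ring_morphismD)

lemma ring_morphism_comp: "ring_morphism e \<Longrightarrow> ring_morphism e' \<Longrightarrow> ring_morphism (\<lambda>x. e' (e x))"
  by (simp add: ring_morphism_def)

lemma ring_morphism_id: "ring_morphism (\<lambda>x. x)"
  by (simp add: ring_morphism_def)

lemma ring_morphism_const_poly: "ring_morphism (\<lambda>x. [:x:])"
  by (simp add: ring_morphism_def one_pCons)

lemma ring_morphism_map_poly:
  assumes "ring_morphism e"
  shows "ring_morphism (map_poly e)"
  unfolding ring_morphism_def
proof (intro conjI allI)
  note e = ring_morphismD[OF assms]
  show "map_poly e 1 = 1" by (simp add: e(1))
  fix p q
  show "map_poly e (p + q) = map_poly e p + map_poly e q"
    by (simp add: poly_eq_iff coeff_map_poly e)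
  show "map_poly e (p * q) = map_poly e p * map_poly e q"
    by (simp add: poly_eq_iff coeff_map_poly e coeff_mult ring_morphism_sum[OF assms])
qed

lemma ring_morphism_poly: "ring_morphism (\<lambda>p. poly p x)"
  by (simp add: ring_morphism_def)

lemma ring_morphism_poly_map_poly:
  "ring_morphism e \<Longrightarrow> ring_morphism (\<lambda>p. poly (map_poly e p) x)"
  by (intro ring_morphism_comp[OF ring_morphism_map_poly ring_morphism_poly])

lemma map_poly_pCons_morphism: "ring_morphism e \<Longrightarrow> map_poly e (pCons a p) = pCons (e a) (map_poly e p)"
  by (intro map_poly_pCons) (simp add: ring_morphismD)

lemma morphism_poly: "ring_morphism h \<Longrightarrow> h (poly p x) = poly (map_poly h p) (h x)"
  by (induction p) (auto simp: ring_morphismD map_poly_pCons_morphism)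

lemma map_poly_comp_morphism:
  assumes "ring_morphism e" "ring_morphism h"
  shows "map_poly h (map_poly e p) = map_poly (\<lambda>x. h (e x)) p"
  by (rule poly_eqI) (simp add: coeff_map_poly ring_morphismD[OF assms(1)] ring_morphismD[OF assms(2)])

lemma poly_map_const_poly_X:
  fixes g :: "'a::comm_ring_1 poly"
  shows "poly (map_poly (\<lambda>x. [:x:]) g) [:0, 1:] = g"
proof (induction g)
  case (pCons a p)
  then show ?case by (simp add: map_poly_pCons_morphism[OF ring_morphism_const_poly])
qed simp

lemma sign_function_comp:
  assumes "sign_function s" "ring_morphism e"
  shows "sign_function (\<lambda>x. s (e x))"
proof -
  interpret sign_function s by fact
  note e = ring_morphismD[OF assms(2)]
  show ?thesis by standard (use s_range in \<open>auto simp: e s_one s_minus s_mult s_null_add intro: s_add\<close>)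
qed

section \<open>Evaluation of multivariate polynomials\<close>

definition cst :: "real \<Rightarrow> 'i mpoly" where "cst r = Poly_Mapping.single 0 r"
definition var :: "'i \<Rightarrow> 'i mpoly" where "var i = Poly_Mapping.single (Poly_Mapping.single i 1) 1"

definition mono_value :: "('i \<Rightarrow> 'b::comm_ring_1) \<Rightarrow> 'i monomial \<Rightarrow> 'b" where
  "mono_value v m = (\<Prod>i\<in>Poly_Mapping.keys m. v i ^ Poly_Mapping.lookup m i)"

definition insertion :: "(real \<Rightarrow> 'b::comm_ring_1) \<Rightarrow> ('i \<Rightarrow> 'b) \<Rightarrow> 'i mpoly \<Rightarrow> 'b" where
  "insertion e v p = (\<Sum>m\<in>Poly_Mapping.keys p. e (Poly_Mapping.lookup p m) * mono_value v m)"

lemma update_eq_add_single: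
  "k \<notin> Poly_Mapping.keys f \<Longrightarrow> Poly_Mapping.update k v f = Poly_Mapping.single k v + f"
  by (rule poly_mapping_eqI)
    (auto simp: lookup_update lookup_add lookup_single when_def in_keys_iff)

lemma mpoly_induct [case_names cst var add mult]:
  assumes cst: "\<And>r. P (cst r)" and var: "\<And>i. P (var i)"
    and add: "\<And>p q. P p \<Longrightarrow> P q \<Longrightarrow> P (p + q)" and mult: "\<And>p q. P p \<Longrightarrow> P q \<Longrightarrow> P (p * q)"
  shows "P (p :: 'i mpoly)"
proof -
  have one: "P 1" using cst[of 1] by (simp add: cst_def)
  have pow: "P (Poly_Mapping.single (Poly_Mapping.single i k) 1)" for i k
  proof (induction k)
    case (Suc k)
    have "Poly_Mapping.single (Poly_Mapping.single i (Suc k)) (1::real) =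
      var i * Poly_Mapping.single (Poly_Mapping.single i k) 1"
      by (simp add: var_def mult_single flip: single_add)
    with Suc mult var show ?case by simp
  qed (use one in simp)
  have mon: "P (Poly_Mapping.single m 1)" for m
  proof (induction m rule: update_induct)
    case (update f a b)
    have "Poly_Mapping.single (Poly_Mapping.update a b f) (1::real) =
      Poly_Mapping.single (Poly_Mapping.single a b) 1 * Poly_Mapping.single f 1"
      using update by (simp add: update_eq_add_single mult_single)
    with update mult pow show ?case by simp
  qed (use one in simp)
  have trm: "P (Poly_Mapping.single m r)" for m r
    using mult[OF cst[of r] mon[of m]] by (simp add: cst_def mult_single)
  show ?thesis
  proof (induction p rule: update_induct)
    case const show ?case using cst[of 0] by (simp add: cst_def)
  next
    case (update f a b)
    then show ?case using add[OF trm[of a b], of f] by (simp add: update_eq_add_single)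
  qed
qed

text \<open>
  Constants and variables generate the polynomial ring.
\<close>

lemma morphism_eqI:
  assumes "ring_morphism e" "ring_morphism e'" "\<And>r. e (cst r) = e' (cst r)" "\<And>i. e (var i) = e' (var i)"
  shows "e p = e' p"
  by (induction p rule: mpoly_induct) (auto simp: assms(3,4) ring_morphismD[OF assms(1)] ring_morphismD[OF assms(2)])

lemma mono_value_superset:
  "finite A \<Longrightarrow> Poly_Mapping.keys m \<subseteq> A \<Longrightarrow> mono_value v m = (\<Prod>i\<in>A. v i ^ Poly_Mapping.lookup m i)"
  unfolding mono_value_def by (rule prod.mono_neutral_left) (auto simp: in_keys_iff)

lemma mono_value_add: "mono_value v (m + n) = mono_value v m * mono_value v n"
proof -
  let ?A = "Poly_Mapping.keys m \<union> Poly_Mapping.keys n"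
  have "Poly_Mapping.keys (m + n) \<subseteq> ?A" by (rule Poly_Mapping.keys_add)
  then show ?thesis
    by (simp add: mono_value_superset[of ?A] lookup_add power_add prod.distrib)
qed

context
  fixes e :: "real \<Rightarrow> 'b::comm_ring_1"
  assumes e: "ring_morphism e"
begin

lemma insertion_superset:
  "finite A \<Longrightarrow> Poly_Mapping.keys p \<subseteq> A \<Longrightarrow> insertion e v p = (\<Sum>m\<in>A. e (Poly_Mapping.lookup p m) * mono_value v m)"
  unfolding insertion_def by (rule sum.mono_neutral_left) (auto simp: in_keys_iff ring_morphismD[OF e])

lemma insertion_add: "insertion e v (p + q) = insertion e v p + insertion e v q"
proof -
  let ?A = "Poly_Mapping.keys p \<union> Poly_Mapping.keys q"
  have "Poly_Mapping.keys (p + q) \<subseteq> ?A" by (rule Poly_Mapping.keys_add)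
  then show ?thesis
    by (simp add: insertion_superset[of ?A] lookup_add ring_morphismD[OF e] distrib_right sum.distrib)
qed

lemma insertion_single: "insertion e v (Poly_Mapping.single m r) = e r * mono_value v m"
  by (subst insertion_superset[of "{m}"]) auto

lemma insertion_zero: "insertion e v 0 = 0"
  by (simp add: insertion_def)

lemma insertion_mult_single:
  "insertion e v (Poly_Mapping.single m r * q) = e r * mono_value v m * insertion e v q"
proof (induction q rule: update_induct)
  case (update f a b)
  then show ?case
    by (simp add: update_eq_add_single distrib_left insertion_add mult_single insertion_single
        mono_value_add ring_morphismD[OF e] mult_ac)
qed (simp add: insertion_zero)

lemma insertion_mult: "insertion e v (p * q) = insertion e v p * insertion e v q"
proof (induction p rule: update_induct)
  case (update f a b)
  then show ?case
    by (simp add: update_eq_add_single distrib_right insertion_add insertion_mult_single insertion_single)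
qed (simp add: insertion_zero)

lemma insertion_cst: "insertion e v (cst r) = e r"
  by (simp add: cst_def insertion_single mono_value_def)

lemma insertion_var: "insertion e v (var i) = v i"
  by (simp add: var_def insertion_single mono_value_def ring_morphismD[OF e])

lemma ring_morphism_insertion: "ring_morphism (insertion e v)"
  using insertion_cst[of v 1]
  by (simp add: ring_morphism_def cst_def ring_morphismD[OF e] insertion_add insertion_mult)

end

lemma ring_morphism_cst: "ring_morphism cst"
  by (simp add: ring_morphism_def cst_def single_add mult_single)

section \<open>Adjoining as many roots as possible\<close>

type_synonym poly_omega = "nat mpoly"

definition shift :: "poly_omega \<Rightarrow> poly_omega" where
  "shift = insertion cst (\<lambda>i. var (Suc i))"

text \<open>
  An isomorphism from the polynomials in \<open>x\<^sub>0, x\<^sub>1, \<dots>\<close> onto the polynomials in \<open>T = x\<^sub>0\<close> over the same ring: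
  by renaming the remaining variables, the ring is a univariate polynomial ring over itself. The coefficient embedding
  becomes the endomorphism \<open>shift\<close>. This is what allows repeated extensions without changing the type.
\<close>

definition unshift :: "poly_omega \<Rightarrow> poly_omega poly" where
  "unshift = insertion (\<lambda>r. [:cst r:]) (\<lambda>i. case i of 0 \<Rightarrow> [:0, 1:] | Suc k \<Rightarrow> [:var k:])"

lemma ring_morphism_shift: "ring_morphism shift"
  unfolding shift_def by (rule ring_morphism_insertion[OF ring_morphism_cst])

lemma shift_cst: "shift (cst r) = cst r" and shift_var: "shift (var i) = var (Suc i)"
  by (simp_all add: shift_def insertion_cst insertion_var ring_morphism_cst)

lemma ring_morphism_cst_poly: "ring_morphism (\<lambda>r. [:cst r:])"
  by (rule ring_morphism_comp[OF ring_morphism_cst ring_morphism_const_poly])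

lemma ring_morphism_unshift: "ring_morphism unshift"
  unfolding unshift_def by (rule ring_morphism_insertion[OF ring_morphism_cst_poly])

lemma unshift_cst: "unshift (cst r) = [:cst r:]" and unshift_var_0: "unshift (var 0) = [:0, 1:]"
  and unshift_var_Suc: "unshift (var (Suc i)) = [:var i:]"
  by (simp_all add: unshift_def insertion_cst insertion_var ring_morphism_cst_poly)

lemma unshift_shift: "unshift (shift p) = [:p:]"
  by (rule morphism_eqI[OF ring_morphism_comp[OF ring_morphism_shift ring_morphism_unshift] ring_morphism_const_poly])
    (simp_all add: shift_cst shift_var unshift_cst unshift_var_Suc)

lemma poly_unshift: "poly (map_poly shift (unshift p)) (var 0) = p"
proof (rule morphism_eqI[where e' = "\<lambda>x. x", OF ring_morphism_comp[OF ring_morphism_unshift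
      ring_morphism_poly_map_poly[OF ring_morphism_shift]] ring_morphism_id])
  show "poly (map_poly shift (unshift (cst r))) (var 0) = cst r" for r
    by (simp add: unshift_cst map_poly_pCons_morphism[OF ring_morphism_shift] shift_cst)
  show "poly (map_poly shift (unshift (var i))) (var 0) = var i" for i
    by (cases i) (simp_all add: unshift_var_0 unshift_var_Suc map_poly_pCons_morphism[OF ring_morphism_shift]
        shift_var ring_morphismD[OF ring_morphism_shift])
qed

text \<open>
  The residue domain of \<open>s'\<close> is an ordered extension of that of \<open>s\<close>, via \<open>h\<close>. Both live on the same ring, but \<open>h\<close>
  need not be the identity.
\<close>

definition sign_extension :: "(poly_omega \<Rightarrow> real) \<Rightarrow> (poly_omega \<Rightarrow> real) \<Rightarrow> (poly_omega \<Rightarrow> poly_omega) \<Rightarrow> bool" where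
  "sign_extension s s' h \<longleftrightarrow> sign_function s' \<and> ring_morphism h \<and> (\<forall>x. s' (h x) = s x)"

lemma sign_extension_refl: "sign_function s \<Longrightarrow> sign_extension s s (\<lambda>x. x)"
  by (simp add: sign_extension_def ring_morphism_id)

lemma sign_extension_trans:
  "sign_extension s s' h \<Longrightarrow> sign_extension s' s'' h' \<Longrightarrow> sign_extension s s'' (\<lambda>x. h' (h x))"
  by (simp add: sign_extension_def ring_morphism_comp)

lemma sign_extension_unshift:
  assumes "sign_function s'" "\<And>x. s' [:x:] = s x"
  shows "sign_extension s (\<lambda>x. s' (unshift x)) shift"
  using assms by (simp add: sign_extension_def sign_function_comp ring_morphism_unshift ring_morphism_shift unshift_shift)

lemma sign_extension_root:
  assumes "sign_function s" "s (poly g a) * s (poly g b) < 0"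
  shows "\<exists>s' h c. sign_extension s s' h \<and> s' (poly (map_poly h g) c) = 0"
proof -
  obtain s' where s': "sign_function s'" "\<forall>x. s' [:x:] = s x" "s' g = 0"
    using sign_function.adjoin_root[OF assms] by blast
  have "unshift (poly (map_poly shift g) (var 0)) = poly (map_poly (\<lambda>x. [:x:]) g) [:0, 1:]"
    by (simp add: morphism_poly[OF ring_morphism_unshift] unshift_var_0 unshift_shift
        map_poly_comp_morphism[OF ring_morphism_shift ring_morphism_unshift])
  then have "s' (unshift (poly (map_poly shift g) (var 0))) = 0"
    using s'(3) by (simp add: poly_map_const_poly_X)
  with sign_extension_unshift[of s' s] s' show ?thesis by blast
qed

lemma sign_extension_infinite:
  assumes "sign_function s"
  shows "\<exists>s' h B. sign_extension s s' h \<and> (\<forall>c x. 0 < s c \<longrightarrow> 0 < s' (h c * B + h x))"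
proof -
  obtain s' where s': "sign_function s'" "\<forall>x. s' [:x:] = s x" "\<forall>c x. 0 < s c \<longrightarrow> 0 < s' [:x, c:]"
    using sign_function.adjoin_infinite[OF assms] by blast
  have "0 < s' (unshift (shift c * var 0 + shift x))" if "0 < s c" for c x
    using s'(3) that by (simp add: ring_morphismD[OF ring_morphism_unshift] unshift_var_0 unshift_shift)
  with sign_extension_unshift[of s' s] s' show ?thesis by blast
qed

context sign_function
begin

text \<open>
  Over a domain the leading coefficients of the true degrees multiply.
\<close>

lemma pnull_prime: 
  assumes "pnull (p * q)"
  shows "pnull p \<or> pnull q"
proof -
  obtain p' where p': "pnull (p - p')" "p' = 0 \<or> s (lead_coeff p') \<noteq> 0" using truncate_null by blast
  obtain q' where q': "pnull (q - q')" "q' = 0 \<or> s (lead_coeff q') \<noteq> 0" using truncate_null by blast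
  have "pnull ((p - p') * q + p' * (q - q'))"
    by (intro pnull_add pnull_mult(1)[OF p'(1)] pnull_mult(2)[OF q'(1)])
  then have "pnull (p * q - p' * q')" by (simp add: algebra_simps)
  with assms have "pnull (p' * q')" using pnull_diff_cong by blast
  then have "s (lead_coeff p' * lead_coeff q') = 0"
    unfolding pnull_def by (metis coeff_mult_degree_sum)
  then have "p' = 0 \<or> q' = 0" using p'(2) q'(2) by (auto simp: s_mult)
  then show ?thesis using p'(1) q'(1) by auto
qed

lemma pnull_prod_finite: "finite F \<Longrightarrow> pnull (\<Prod>F) \<Longrightarrow> \<exists>p\<in>F. pnull p"
proof (induction F rule: finite_induct)
  case empty
  then show ?case by (auto simp: pnull_def dest: spec[of _ 0] simp: s_one)
qed (auto dest: pnull_prime)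

lemma div_ivt_dvd: "div_ivt p \<Longrightarrow> q dvd p \<Longrightarrow> div_ivt q"
  unfolding div_ivt_def
proof (intro allI impI, elim dvdE)
  fix r q' k assume *: "\<forall>q k. pnull (p - q * k) \<longrightarrow> ivt k" "pnull (q - q' * k)" "p = q * r"
  have "pnull (r * q - r * (q' * k))" by (rule pnull_diff_mult[OF *(2)])
  then have "pnull (p - (r * q') * k)" by (simp add: *(3) mult_ac)
  with *(1) show "ivt k" by blast
qed

lemma distinct_roots_card_le:
  assumes np: "\<not> pnull p" and Y: "finite Y" "\<forall>y\<in>Y. s (poly p y) = 0"
    "\<forall>y\<in>Y. \<forall>y'\<in>Y. y \<noteq> y' \<longrightarrow> s (y - y') \<noteq> 0"
  shows "card Y \<le> degree p"
proof -
  obtain Z where Z: "finite Z" "card Z \<le> degree p" "\<forall>x. s (poly p x) = 0 \<longrightarrow> (\<exists>y\<in>Z. s (x - y) = 0)"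
    using finite_roots[OF np] by blast
  then obtain f where f: "\<And>y. y \<in> Y \<Longrightarrow> f y \<in> Z \<and> s (y - f y) = 0" using Y(2) by metis
  have "inj_on f Y"
  proof (rule inj_onI, rule ccontr)
    fix y y' assume *: "y \<in> Y" "y' \<in> Y" "f y = f y'" "y \<noteq> y'"
    have "s ((y - f y) - (y' - f y')) = 0"
      using f[OF *(1)] f[OF *(2)] by (simp add: s_null_diff)
    then show False using Y(3) * by simp
  qed
  then have "card Y \<le> card Z" using f Z(1) by (intro card_inj_on_le[of f]) auto
  with Z(2) show ?thesis by simp
qed

text \<open>
  Every root of \<open>k\<close> lies outside the interval, so dividing by its linear factor preserves the sign change.
\<close>

lemma rootless_divisor:
  assumes "pnull (p - q * k)" "0 < s (b - a)" "s (poly k a) * s (poly k b) < 0"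
    "\<And>c. 0 < s (c - a) \<Longrightarrow> 0 < s (b - c) \<Longrightarrow> s (poly k c) \<noteq> 0"
  shows "\<exists>q' k'. pnull (p - q' * k') \<and> s (poly k' a) * s (poly k' b) < 0 \<and> (\<forall>c. s (poly k' c) \<noteq> 0)"
  using assms
proof (induction "degree k" arbitrary: q k rule: less_induct)
  case less
  show ?case
  proof (cases "\<exists>r. s (poly k r) = 0")
    case True
    then obtain r where r: "s (poly k r) = 0" by blast
    let ?k = "synthetic_div k r"
    have ev: "s (poly k x) = s (x - r) * s (poly ?k x)" for x by (rule split_root_eval[OF r])
    have "degree k \<noteq> 0"
    proof
      assume "degree k = 0"
      then have "?k = 0" by (simp add: synthetic_div_eq_0_iff)
      with less.prems(3) show False by (simp add: ev)
    qed
    then have "degree ?k < degree k" by (simp add: degree_synthetic_div)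
    moreover have "pnull (p - (q * [:-r, 1:]) * ?k)"
      using pnull_diff_trans[OF less.prems(1) pnull_diff_mult[OF split_root[OF r], of q]]
      by (simp only: mult.assoc)
    moreover have "s (a - r) = s (b - r)"
    proof -
      have "\<not> (0 < s (r - a) \<and> 0 < s (b - r))" using less.prems(4)[of r] r by blast
      moreover have "s (a - r) \<noteq> 0" "s (b - r) \<noteq> 0" using less.prems(3) by (auto simp: ev)
      moreover have "0 < s (b - r)" if "0 < s (a - r)"
        using that less.prems(2) s_trans1[of a r b] by simp
      ultimately show ?thesis
        using s_range[of "a - r"] s_range[of "b - r"] s_diff_swap[of r a] by auto
    qed
    then have "s (poly ?k a) * s (poly ?k b) < 0"
      using less.prems(3) s_range[of "b - r"] by (auto simp: ev)
    moreover have "s (poly ?k c) \<noteq> 0" if "0 < s (c - a)" "0 < s (b - c)" for c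
      using less.prems(4)[OF that] by (auto simp: ev)
    ultimately show ?thesis using less.hyps[of ?k "q * [:-r, 1:]"] less.prems(2) by blast
  qed (use less.prems in blast)
qed

end

lemma sign_extension_pnull:
  assumes "sign_extension s s' h" "sign_function s"
  shows "sign_function.pnull s' (map_poly h p) \<longleftrightarrow> sign_function.pnull s p"
  using assms by (simp add: sign_extension_def sign_function.pnull_def coeff_map_poly ring_morphismD)

text \<open>
  The number of distinct roots of \<open>p\<close> in an extension is at most its degree, so some extension has the maximal number. A
  sign change of a divisor without a root in between yields, by \<open>rootless_divisor\<close>, a divisor with a sign change and no
  root at all; a root adjoined to that divisor is a new root of \<open>p\<close>.
\<close>

lemma sign_extension_div_ivt_single:
  assumes s: "sign_function s" and np: "\<not> sign_function.pnull s p"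
  shows "\<exists>s' h. sign_extension s s' h \<and> sign_function.div_ivt s' (map_poly h p)"
proof -
  define roots where "roots n \<longleftrightarrow> (\<exists>s' h Y. sign_extension s s' h \<and> finite Y \<and> card Y = n \<and>
      (\<forall>y\<in>Y. s' (poly (map_poly h p) y) = 0) \<and> (\<forall>y\<in>Y. \<forall>y'\<in>Y. y \<noteq> y' \<longrightarrow> s' (y - y') \<noteq> 0))" for n
  have bound: "n \<le> degree p" if "roots n" for n
  proof -
    from that obtain s' h Y where *: "sign_extension s s' h" "finite Y" "card Y = n"
      "\<forall>y\<in>Y. s' (poly (map_poly h p) y) = 0" "\<forall>y\<in>Y. \<forall>y'\<in>Y. y \<noteq> y' \<longrightarrow> s' (y - y') \<noteq> 0"
      unfolding roots_def by (elim exE conjE) (rule that)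
    have "sign_function s'" using *(1) by (simp add: sign_extension_def)
    from sign_function.distinct_roots_card_le[OF this _ *(2,4,5)] np *(1,3) s
    have "n \<le> degree (map_poly h p)" by (simp add: sign_extension_pnull)
    also have "\<dots> \<le> degree p" by (rule map_poly_degree_leq)
    finally show ?thesis .
  qed
  have "roots 0" unfolding roots_def using sign_extension_refl[OF s] by (intro exI[of _ s] exI[of _ "\<lambda>x. x"] exI[of _ "{}"]) auto
  then obtain n where n: "roots n" and n_max: "\<And>m. roots m \<Longrightarrow> m \<le> n"
    using bound by (metis (full_types) GreatestI_nat Greatest_le_nat)
  from n obtain s' h Y where *: "sign_extension s s' h" "finite Y" "card Y = n"
    "\<forall>y\<in>Y. s' (poly (map_poly h p) y) = 0" "\<forall>y\<in>Y. \<forall>y'\<in>Y. y \<noteq> y' \<longrightarrow> s' (y - y') \<noteq> 0"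
    unfolding roots_def by (elim exE conjE) (rule that)
  interpret s': sign_function s' using *(1) by (simp add: sign_extension_def)
  have h: "ring_morphism h" using *(1) by (simp add: sign_extension_def)
  have "s'.div_ivt (map_poly h p)"
    unfolding s'.div_ivt_def s'.ivt_def
  proof (intro allI impI, rule ccontr)
    fix q k a b
    assume "s'.pnull (map_poly h p - q * k)" "0 < s' (b - a)" "s' (poly k a) * s' (poly k b) < 0"
      "\<nexists>c. 0 < s' (c - a) \<and> 0 < s' (b - c) \<and> s' (poly k c) = 0"
    then obtain q k where qk: "s'.pnull (map_poly h p - q * k)" "s' (poly k a) * s' (poly k b) < 0"
      "\<forall>c. s' (poly k c) \<noteq> 0"
      using s'.rootless_divisor[of "map_poly h p" q k b a] by blast
    obtain s'' h' c where **: "sign_extension s' s'' h'" "s'' (poly (map_poly h' k) c) = 0"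
      using sign_extension_root[OF s'.sign_function_axioms qk(2)] by blast
    interpret s'': sign_function s'' using **(1) by (simp add: sign_extension_def)
    have h': "ring_morphism h'" and s'': "\<And>x. s'' (h' x) = s' x"
      using **(1) by (auto simp: sign_extension_def)
    let ?hh = "\<lambda>x. h' (h x)"
    have mp: "map_poly ?hh p = map_poly h' (map_poly h p)"
      by (simp add: map_poly_comp_morphism[OF h h'])
    \<comment> \<open>The old roots persist and stay distinct, and the adjoined root differs from all of them
      because k had no root.\<close>
    have old: "s'' (poly (map_poly ?hh p) (h' y)) = 0" if "y \<in> Y" for y
      using *(4) that by (simp add: mp s'' flip: morphism_poly[OF h'])
    have "s''.pnull (map_poly h' (map_poly h p - q * k))"
      using qk(1) sign_extension_pnull[OF **(1) s'.sign_function_axioms] by simp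
    then have "s''.pnull (map_poly ?hh p - map_poly h' q * map_poly h' k)"
      by (simp add: mp ring_morphismD[OF ring_morphism_map_poly[OF h']])
    from s''.pnull_diff_poly[OF this, of c] **(2)
    have new: "s'' (poly (map_poly ?hh p) c) = 0" by (simp add: s''.s_mult)
    have cY: "s'' (c - h' y) \<noteq> 0" for y
    proof
      assume "s'' (c - h' y) = 0"
      from s''.poly_diff_null[OF this, of "map_poly h' k"] **(2)
      have "s'' (h' (poly k y)) = 0" by (simp add: morphism_poly[OF h'])
      with qk(3) show False by (simp add: s'')
    qed
    have dist: "s'' (h' y - h' y') = s' (y - y')" for y y'
      by (simp flip: s'' ring_morphismD(6)[OF h'])
    have "inj_on h' Y"
      by (rule inj_onI) (metis *(5) dist diff_self s''.s_zero)
    moreover have "c \<notin> h' ` Y" using cY by (metis diff_self imageE s''.s_zero)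
    ultimately have "card (insert c (h' ` Y)) = Suc n"
      using *(2,3) by (simp add: card_image)
    moreover have "\<forall>y\<in>insert c (h' ` Y). \<forall>y'\<in>insert c (h' ` Y). y \<noteq> y' \<longrightarrow> s'' (y - y') \<noteq> 0"
      using cY *(5) dist s''.s_diff_swap[of _ c] by auto
    ultimately have "roots (Suc n)"
      unfolding roots_def using sign_extension_trans[OF *(1) **(1)] *(2) old new
      by (intro exI[of _ s''] exI[of _ ?hh] exI[of _ "insert c (h' ` Y)"]) auto
    with n_max show False by fastforce
  qed
  with *(1) show ?thesis by blast
qed

text \<open>
  A divisor of a member of the family divides the product of the family.
\<close>

lemma sign_extension_div_ivt:
  assumes s: "sign_function s" and F: "finite F"
  shows "\<exists>s' h. sign_extension s s' h \<and>
    (\<forall>f\<in>F. \<not> sign_function.pnull s f \<longrightarrow> sign_function.div_ivt s' (map_poly h f))"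
proof -
  interpret sign_function s by fact
  let ?G = "{f\<in>F. \<not> pnull f}"
  have "\<not> pnull (\<Prod>?G)" using pnull_prod_finite[of ?G] F by auto
  then obtain s' h where *: "sign_extension s s' h" "sign_function.div_ivt s' (map_poly h (\<Prod>?G))"
    using sign_extension_div_ivt_single[OF s] by blast
  interpret s': sign_function s' using *(1) by (simp add: sign_extension_def)
  have h: "ring_morphism h" using *(1) by (simp add: sign_extension_def)
  have "s'.div_ivt (map_poly h f)" if "f \<in> ?G" for f
  proof (rule s'.div_ivt_dvd[OF *(2)])
    have "\<Prod>?G = f * \<Prod>(?G - {f})" using that F by (intro prod.remove) auto
    then show "map_poly h f dvd map_poly h (\<Prod>?G)"
      by (simp add: ring_morphismD[OF ring_morphism_map_poly[OF h]])
  qed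
  with *(1) show ?thesis by blast
qed

section \<open>Models of a family of univariate polynomials\<close>

definition drop_lead :: "'c::comm_ring_1 poly \<Rightarrow> 'c poly" where
  "drop_lead f = f - monom (lead_coeff f) (degree f)"

text \<open>
  A family \<open>F\<close> of polynomials in one variable, interpreted through \<open>e\<close> in an ordered domain.
  Beyond the bound \<open>B\<close> and before \<open>- B\<close>, a member whose leading coefficient has nonzero sign has the sign of its
  leading term, so \<open>B\<close> and \<open>- B\<close> serve
  as end points of the unbounded intervals.
\<close>

locale sign_model = sign_function s
  for s :: "'a::idom \<Rightarrow> real" +
  fixes e :: "'c::idom \<Rightarrow> 'a" and F :: "'c poly set" and B :: 'a
  assumes e: "ring_morphism e"
    and fin: "finite F"
    and closed_pderiv: "f \<in> F \<Longrightarrow> 0 < degree f \<Longrightarrow> pderiv f \<in> F"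
    and closed_drop_lead: "f \<in> F \<Longrightarrow> 0 < degree f \<Longrightarrow> drop_lead f \<in> F"
    and closed_rem: "f \<in> F \<Longrightarrow> g \<in> F \<Longrightarrow> 0 < degree g \<Longrightarrow> degree g \<le> degree f \<Longrightarrow>
      \<exists>k q. \<exists>r\<in>F. smult (lead_coeff g ^ k) f = g * q + r \<and> degree r < degree g"
    and ivt_F: "f \<in> F \<Longrightarrow> s (e (lead_coeff f)) \<noteq> 0 \<Longrightarrow> div_ivt (map_poly e f)"
    and B_pos: "0 < s B"
    and B_right: "f \<in> F \<Longrightarrow> s (e (lead_coeff f)) \<noteq> 0 \<Longrightarrow> 0 \<le> s (x - B) \<Longrightarrow>
      s (poly (map_poly e f) x) = s (e (lead_coeff f))"
    and B_left: "f \<in> F \<Longrightarrow> s (e (lead_coeff f)) \<noteq> 0 \<Longrightarrow> s (x + B) \<le> 0 \<Longrightarrow>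
      s (poly (map_poly e f) x) = (-1) ^ degree f * s (e (lead_coeff f))"
begin

definition sg :: "'c poly \<Rightarrow> 'a \<Rightarrow> real" where
  "sg f x = s (poly (map_poly e f) x)"

text \<open>
  The formal degree is the true degree. Since the signs of the coefficients decide this, two models with the same
  coefficient signs have the same regular members.
\<close>

definition regular :: "'c poly \<Rightarrow> bool" where
  "regular f \<longleftrightarrow> s (e (lead_coeff f)) \<noteq> 0"

lemma sg_cong: "s (x - y) = 0 \<Longrightarrow> sg f x = sg f y"
  unfolding sg_def by (rule poly_diff_null)

lemma sg_const: "degree f = 0 \<Longrightarrow> sg f x = s (e (lead_coeff f))"
  by (elim degree_eq_zeroE) (simp add: sg_def map_poly_pCons_morphism[OF e])

lemma sg_drop_lead: "\<not> regular f \<Longrightarrow> sg f x = sg (drop_lead f) x"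
proof -
  assume "\<not> regular f"
  then have "pnull (map_poly e f - map_poly e (drop_lead f))"
    by (auto simp: pnull_def drop_lead_def regular_def coeff_map_poly ring_morphismD[OF e])
  then show ?thesis unfolding sg_def by (rule pnull_diff_poly)
qed

lemma sg_rem:
  assumes "smult (lead_coeff g ^ k) f = g * q + r" "sg g x = 0"
  shows "s (e (lead_coeff g)) ^ k * sg f x = sg r x"
proof -
  have "poly (map_poly e (smult (lead_coeff g ^ k) f)) x =
      poly (map_poly e g) x * poly (map_poly e q) x + poly (map_poly e r) x"
    unfolding assms(1) by (simp add: ring_morphismD[OF ring_morphism_map_poly[OF e]])
  also have "map_poly e (smult (lead_coeff g ^ k) f) = smult (e (lead_coeff g) ^ k) (map_poly e f)"
    by (simp add: map_poly_smult ring_morphismD[OF e] ring_morphism_power[OF e])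
  finally have "s (e (lead_coeff g) ^ k * poly (map_poly e f) x) =
    s (poly (map_poly e g) x * poly (map_poly e q) x + poly (map_poly e r) x)" by simp
  then show ?thesis using assms(2) by (simp add: s_mult s_power sg_def s_null_add)
qed

lemma regular_not_pnull: "regular f \<Longrightarrow> \<not> pnull (map_poly e f)"
  by (auto simp: regular_def pnull_def coeff_map_poly ring_morphismD[OF e])

lemma map_poly_pderiv: "map_poly e (pderiv f) = pderiv (map_poly e f)"
proof -
  have "e (of_nat n) = of_nat n" for n
    by (induction n) (auto simp: ring_morphismD[OF e])
  then show ?thesis
    by (simp add: poly_eq_iff coeff_map_poly coeff_pderiv ring_morphismD[OF e]
        del: of_nat_Suc)
qed

lemma regular_pderiv:
  assumes "regular f" "0 < degree f"
  shows "regular (pderiv f)" "degree (pderiv f) = degree f - 1"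
proof -
  obtain n where n: "degree f = Suc n" using assms(2) gr0_conv_Suc by blast
  have eof: "e (of_nat k) = of_nat k" for k
    by (induction k) (auto simp: ring_morphismD[OF e])
  have c: "s (e (coeff (pderiv f) n)) = s (e (lead_coeff f))"
    using s_of_nat[of "Suc n"]
    by (simp add: coeff_pderiv n ring_morphismD[OF e] eof s_mult del: of_nat_Suc)
  then have "coeff (pderiv f) n \<noteq> 0"
    using assms(1) by (auto simp: regular_def ring_morphismD[OF e])
  then have "n \<le> degree (pderiv f)" by (rule le_degree)
  moreover have "degree (pderiv f) \<le> n"
    by (rule degree_le) (auto simp: coeff_pderiv n coeff_eq_0)
  ultimately show d: "degree (pderiv f) = degree f - 1" using n by simp
  show "regular (pderiv f)" using c assms(1) by (simp add: regular_def d n)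
qed

lemma regular_inside:
  assumes "f \<in> F" "regular f" "sg f x = 0"
  shows "0 < s (B - x)" "0 < s (x + B)"
proof -
  show "0 < s (B - x)"
    using B_right[of f x] assms s_diff_swap[of B x] s_range[of "B - x"]
    by (auto simp: regular_def sg_def)
  show "0 < s (x + B)"
    using B_left[of f x] assms s_range[of "x + B"] by (auto simp: regular_def sg_def)
qed

definition gap :: "'c poly \<Rightarrow> 'a \<Rightarrow> 'a \<Rightarrow> bool" where
  "gap f a b \<longleftrightarrow> (\<forall>c. 0 < s (c - a) \<longrightarrow> 0 < s (b - c) \<longrightarrow> sg f c \<noteq> 0)"

lemma regular_rolle:
  assumes f: "f \<in> F" "regular f" "0 < degree f" and ab: "0 < s (b - a)" "sg f a = 0" "sg f b = 0"
  shows "\<not> gap (pderiv f) a b"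
  using rolle[of "map_poly e f" b a] regular_not_pnull[OF f(2)] ivt_F[OF f(1)] f
    ivt_F[OF closed_pderiv[OF f(1,3)]] regular_pderiv[OF f(2,3)] ab
  by (auto simp: regular_def gap_def sg_def map_poly_pderiv)

lemma regular_sign_change_at_root:
  assumes f: "f \<in> F" "regular f" "0 < degree f"
    and x: "0 < s (x - a)" "0 < s (b - x)" "sg f x = 0" and g: "gap (pderiv f) a b"
  shows "sg f a * sg f b < 0"
  unfolding sg_def
  by (rule sign_change_at_root[OF regular_not_pnull[OF f(2)] ivt_F[OF f(1)] _ x(1,2)])
    (use f x g ivt_F[OF closed_pderiv[OF f(1,3)]] regular_pderiv[OF f(2,3)]
      in \<open>auto simp: regular_def gap_def sg_def map_poly_pderiv\<close>)

text \<open>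
  At most one end point of an interval without roots of \<open>f\<close> and of its derivative is a root of \<open>f\<close>, by Rolle's theorem; so
  the signs at the end points determine the sign inside.
\<close>

lemma sign_in_gap:
  assumes f: "f \<in> F" "regular f" "0 < degree f"
    and g: "gap f a b" "gap (pderiv f) a b" and x: "0 < s (x - a)" "0 < s (b - x)"
  shows "sg f x = (if sg f a \<noteq> 0 then sg f a else sg f b)"
proof -
  have ivt: "ivt (map_poly e f)" using ivt_F[OF f(1)] f(2) div_ivt_ivt by (simp add: regular_def)
  have fx: "sg f x \<noteq> 0" using g(1) x by (simp add: gap_def)
  have "0 < s (b - a)" using x s_trans1[of x a b] by simp
  then have "sg f a \<noteq> 0 \<or> sg f b \<noteq> 0" using regular_rolle[OF f] g(2) by blast
  moreover have "sg f a = sg f x" if "sg f a \<noteq> 0"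
    unfolding sg_def
  proof (rule ivt_same_sign[OF ivt x(1)])
    show "s (poly (map_poly e f) c) \<noteq> 0" if "0 < s (c - a)" "0 < s (x - c)" for c
      using g(1) that x s_trans1[of x c b] by (auto simp: gap_def sg_def)
  qed (use that fx in \<open>auto simp: sg_def\<close>)
  moreover have "sg f x = sg f b" if "sg f b \<noteq> 0"
    unfolding sg_def
  proof (rule ivt_same_sign[OF ivt x(2)])
    show "s (poly (map_poly e f) c) \<noteq> 0" if "0 < s (c - x)" "0 < s (b - c)" for c
      using g(1) that x s_trans1[of x a c] by (auto simp: gap_def sg_def)
  qed (use that fx in \<open>auto simp: sg_def\<close>)
  ultimately show ?thesis by auto
qed

lemma separated_by_point:
  assumes "s (x - z) < s (x' - z)"
  shows "s (x - x') = -1"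
proof -
  have "0 < s (x' - x)"
    using assms s_trans1[of z x x'] s_trans2[of z x x'] s_range[of "x - z"] s_range[of "x' - z"]
      s_diff_swap[of z x] by auto
  then show ?thesis using s_diff_swap[of x x'] s_range[of "x' - x"] by auto
qed

lemma neighbours:
  assumes \<rho>: "finite A" "B \<in> A" "- B \<in> A" and x: "0 < s (B - x)" "0 < s (x + B)"
    and ne: "\<forall>z\<in>A. s (x - z) \<noteq> 0"
  shows "\<exists>z\<in>A. \<exists>z'\<in>A. 0 < s (x - z) \<and> 0 < s (z' - x) \<and>
    (\<forall>v\<in>A. 0 \<le> s (z - v) \<or> 0 \<le> s (v - z'))"
proof -
  let ?L = "{z\<in>A. 0 < s (x - z)}" and ?U = "{z\<in>A. 0 < s (z - x)}"
  have "- B \<in> ?L" "B \<in> ?U" using \<rho> x by auto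
  then have "?L \<noteq> {}" "?U \<noteq> {}" "finite ?L" "finite ?U" using \<rho>(1) by auto
  then obtain z z' where z: "z \<in> ?L" "\<forall>v\<in>?L. 0 \<le> s (z - v)" and z': "z' \<in> ?U" "\<forall>v\<in>?U. 0 \<le> s (v - z')"
    using finite_has_greatest[of ?L] finite_has_least[of ?U] by blast
  have "v \<in> ?L \<or> v \<in> ?U" if "v \<in> A" for v
    using ne that s_diff_swap[of v x] by force
  with z z' show ?thesis by blast
qed

end

section \<open>Corresponding roots in two models\<close>

locale two_models = M: sign_model s1 e1 F B1 + N: sign_model s2 e2 F B2
  for s1 :: "'a::idom \<Rightarrow> real" and e1 :: "'c::idom \<Rightarrow> 'a" and B1
    and s2 :: "'b::idom \<Rightarrow> real" and e2 :: "'c \<Rightarrow> 'b" and B2 and F +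
  assumes coeffs_agree: "f \<in> F \<Longrightarrow> s1 (e1 (coeff f i)) = s2 (e2 (coeff f i))"
begin

lemma two_models_swap: "two_models s2 e2 B2 s1 e1 B1 F"
  by (intro two_models.intro M.sign_model_axioms N.sign_model_axioms two_models_axioms.intro
      coeffs_agree[symmetric])

lemma regular_agree: "f \<in> F \<Longrightarrow> M.regular f \<longleftrightarrow> N.regular f"
  by (simp add: M.regular_def N.regular_def coeffs_agree)

end

text \<open>
  A relation between the roots of the subfamily \<open>G\<close> in the first model and those in the second, compatible with the
  order and with the signs of \<open>G\<close>. It is a relation rather than a bijection because elements of sign
  \<open>0\<close> are not identified. The sentinels \<open>B\<close> and \<open>- B\<close> of the models are included.
\<close>

locale correspondence = two_models s1 e1 B1 s2 e2 B2 F
  for s1 :: "'a::idom \<Rightarrow> real" and e1 :: "'c::idom \<Rightarrow> 'a" and B1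
    and s2 :: "'b::idom \<Rightarrow> real" and e2 :: "'c \<Rightarrow> 'b" and B2 and F +
  fixes G :: "'c poly set" and \<rho> :: "('a \<times> 'b) set"
  assumes G_subset: "G \<subseteq> F"
    and G_pderiv: "g \<in> G \<Longrightarrow> 0 < degree g \<Longrightarrow> pderiv g \<in> G"
    and G_drop_lead: "g \<in> G \<Longrightarrow> 0 < degree g \<Longrightarrow> drop_lead g \<in> G"
    and finite_corr: "finite \<rho>"
    and B_corr: "(B1, B2) \<in> \<rho>" "(- B1, - B2) \<in> \<rho>"
    and order_corr: "(z, w) \<in> \<rho> \<Longrightarrow> (z', w') \<in> \<rho> \<Longrightarrow> s1 (z - z') = s2 (w - w')"
    and sign_corr: "(z, w) \<in> \<rho> \<Longrightarrow> g \<in> G \<Longrightarrow> M.sg g z = N.sg g w"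
    and root_corr: "(z, w) \<in> \<rho> \<Longrightarrow> (z, w) \<noteq> (B1, B2) \<Longrightarrow> (z, w) \<noteq> (- B1, - B2) \<Longrightarrow>
       \<exists>g\<in>G. M.regular g \<and> 0 < degree g \<and> M.sg g z = 0"
    and cover1: "g \<in> G \<Longrightarrow> M.regular g \<Longrightarrow> 0 < degree g \<Longrightarrow> M.sg g x = 0 \<Longrightarrow> \<exists>z w. (z, w) \<in> \<rho> \<and> s1 (x - z) = 0"
    and cover2: "g \<in> G \<Longrightarrow> N.regular g \<Longrightarrow> 0 < degree g \<Longrightarrow> N.sg g y = 0 \<Longrightarrow> \<exists>z w. (z, w) \<in> \<rho> \<and> s2 (y - w) = 0"
begin

text \<open>
  Having the same position among the corresponding points.
\<close>

definition cut :: "'a \<Rightarrow> 'b \<Rightarrow> bool" where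
  "cut x y \<longleftrightarrow> (\<forall>(z, w)\<in>\<rho>. s1 (x - z) = s2 (y - w))"

lemma cutD: "cut x y \<Longrightarrow> (z, w) \<in> \<rho> \<Longrightarrow> s1 (x - z) = s2 (y - w)"
  by (auto simp: cut_def)

lemma corr_swap: "correspondence s2 e2 B2 s1 e1 B1 F G (prod.swap ` \<rho>)"
proof (intro correspondence.intro two_models_swap correspondence_axioms.intro)
  have r: "M.regular g \<longleftrightarrow> N.regular g" if "g \<in> G" for g using G_subset regular_agree that by blast
  fix z w assume zw: "(w, z) \<in> prod.swap ` \<rho>" 
  show "N.sg g w = M.sg g z" if "g \<in> G" for g
    using zw sign_corr[of z w g] that by auto
  show "\<exists>g\<in>G. N.regular g \<and> 0 < degree g \<and> N.sg g w = 0" if "(w, z) \<noteq> (B2, B1)" "(w, z) \<noteq> (- B2, - B1)"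
    using zw root_corr[of z w] sign_corr[of z w] r that by fastforce
  fix z' w' assume "(w', z') \<in> prod.swap ` \<rho>"
  with zw show "s2 (w - w') = s1 (z - z')" using order_corr[of z w z' w'] by auto
next
  show "\<exists>z w. (z, w) \<in> prod.swap ` \<rho> \<and> s2 (x - z) = 0"
    if "g \<in> G" "N.regular g" "0 < degree g" "N.sg g x = 0" for g x
    using cover2[OF that] by auto
  show "\<exists>z w. (z, w) \<in> prod.swap ` \<rho> \<and> s1 (x - w) = 0"
    if "g \<in> G" "M.regular g" "0 < degree g" "M.sg g x = 0" for g x
    using cover1[OF that] by auto
qed (use G_subset G_pderiv G_drop_lead finite_corr B_corr in \<open>auto intro: rev_image_eqI\<close>)

lemma corr_gap:
  assumes g: "g \<in> G" "M.regular g"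
    and zw: "(z, w) \<in> \<rho>" "(z', w') \<in> \<rho>"
    and no: "\<And>v u. (v, u) \<in> \<rho> \<Longrightarrow> 0 \<le> s1 (z - v) \<or> 0 \<le> s1 (v - z')"
  shows "M.gap g z z'" "N.gap g w w'"
proof -
  have rN: "N.regular g" using g G_subset regular_agree by blast
  show "M.gap g z z'"
    unfolding M.gap_def
  proof (intro allI impI notI)
    fix c assume c: "0 < s1 (c - z)" "0 < s1 (z' - c)" "M.sg g c = 0"
    show False
    proof (cases "degree g = 0")
      case True then show False using M.sg_const[of g c] c(3) g(2) by (simp add: M.regular_def)
    next
      case False
      then obtain v u where v: "(v, u) \<in> \<rho>" "s1 (c - v) = 0" using cover1[OF g _ c(3)] by auto
      have "0 < s1 (v - z)" "0 < s1 (z' - v)"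
        using c v M.s_trans1[of c z v] M.s_trans2[of c v z'] M.s_diff_swap[of c v] by auto
      with no[OF v(1)] show False using M.s_diff_swap[of z v] M.s_diff_swap[of v z'] by auto
    qed
  qed
  show "N.gap g w w'"
    unfolding N.gap_def
  proof (intro allI impI notI)
    fix c assume c: "0 < s2 (c - w)" "0 < s2 (w' - c)" "N.sg g c = 0"
    show False
    proof (cases "degree g = 0")
      case True then show False using N.sg_const[of g c] c(3) rN by (simp add: N.regular_def)
    next
      case False
      then obtain v u where v: "(v, u) \<in> \<rho>" "s2 (c - u) = 0" using cover2[OF g(1) rN _ c(3)] by auto
      have "0 < s2 (u - w)" "0 < s2 (w' - u)"
        using c v N.s_trans1[of c w u] N.s_trans2[of c u w'] N.s_diff_swap[of c u] by auto
      then have "0 < s1 (v - z)" "0 < s1 (z' - v)"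
        using order_corr[OF v(1) zw(1)] order_corr[OF zw(2) v(1)] by auto
      with no[OF v(1)] show False using M.s_diff_swap[of z v] M.s_diff_swap[of v z'] by auto
    qed
  qed
qed

lemma corr_neighbours:
  assumes x: "0 < s1 (B1 - x)" "0 < s1 (x + B1)" and ne: "\<And>z w. (z, w) \<in> \<rho> \<Longrightarrow> s1 (x - z) \<noteq> 0"
  obtains z w z' w' where "(z, w) \<in> \<rho>" "(z', w') \<in> \<rho>" "0 < s1 (x - z)" "0 < s1 (z' - x)"
    "\<And>v u. (v, u) \<in> \<rho> \<Longrightarrow> 0 \<le> s1 (z - v) \<or> 0 \<le> s1 (v - z')"
proof -
  have "B1 \<in> fst ` \<rho>" "- B1 \<in> fst ` \<rho>" using B_corr by force+
  moreover have "\<forall>z\<in>fst ` \<rho>. s1 (x - z) \<noteq> 0" using ne by auto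
  ultimately have "\<exists>z\<in>fst ` \<rho>. \<exists>z'\<in>fst ` \<rho>. 0 < s1 (x - z) \<and> 0 < s1 (z' - x) \<and>
    (\<forall>v\<in>fst ` \<rho>. 0 \<le> s1 (z - v) \<or> 0 \<le> s1 (v - z'))"
    using finite_corr x by (intro M.neighbours) auto
  then show ?thesis using that by fastforce
qed

lemma between_cut:
  assumes zw: "(z, w) \<in> \<rho>" "(z', w') \<in> \<rho>" and x: "0 < s1 (x - z)" "0 < s1 (z' - x)"
    and no: "\<And>v u. (v, u) \<in> \<rho> \<Longrightarrow> 0 \<le> s1 (z - v) \<or> 0 \<le> s1 (v - z')"
    and y: "0 < s2 (y - w)" "0 < s2 (w' - y)"
  shows "cut x y"
  unfolding cut_def
proof (intro ballI, clarify)
  fix v u assume v: "(v, u) \<in> \<rho>"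
  from no[OF v] show "s1 (x - v) = s2 (y - u)"
  proof
    assume zv: "0 \<le> s1 (z - v)"
    then have "0 \<le> s2 (w - u)" using order_corr[OF zw(1) v] by simp
    with zv x y have "0 < s1 (x - v)" "0 < s2 (y - u)"
      using M.s_trans2[of z v x] N.s_trans2[of w u y] by auto
    then show ?thesis using M.s_range[of "x - v"] N.s_range[of "y - u"] by auto
  next
    assume zv: "0 \<le> s1 (v - z')"
    then have "0 \<le> s2 (u - w')" using order_corr[OF v zw(2)] by simp
    with zv x y have "0 < s1 (v - x)" "0 < s2 (u - y)"
      using M.s_trans1[of z' x v] N.s_trans1[of w' y u] by auto
    then show ?thesis using M.s_range[of "v - x"] N.s_range[of "u - y"]
      M.s_diff_swap[of x v] N.s_diff_swap[of y u] by auto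
  qed
qed

text \<open>
  Between neighbouring corresponding points no regular member of \<open>G\<close> has a root, so \<open>sign_in_gap\<close> computes its
  sign from the end points, in both models in the same way. Members that are not regular are replaced by
  their truncations.
\<close>

lemma cut_sign:
  assumes c: "cut x y" and x: "0 < s1 (B1 - x)" "0 < s1 (x + B1)" and "g \<in> G"
  shows "M.sg g x = N.sg g y"
  using \<open>g \<in> G\<close>
proof (induction "degree g" arbitrary: g rule: less_induct)
  case less
  then have g: "g \<in> F" using G_subset by blast
  show ?case
  proof (cases "\<exists>z w. (z, w) \<in> \<rho> \<and> s1 (x - z) = 0")
    case True
    then obtain z w where z: "(z, w) \<in> \<rho>" "s1 (x - z) = 0" by blast
    moreover from this have "s2 (y - w) = 0" using c by (auto dest: cutD)
    ultimately show ?thesis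
      using sign_corr[OF z(1) less.prems] M.sg_cong[of x z g] N.sg_cong[of y w g] by simp
  next
    case False
    then obtain z w z' w' where zw: "(z, w) \<in> \<rho>" "(z', w') \<in> \<rho>" "0 < s1 (x - z)" "0 < s1 (z' - x)"
      and no: "\<And>v u. (v, u) \<in> \<rho> \<Longrightarrow> 0 \<le> s1 (z - v) \<or> 0 \<le> s1 (v - z')"
      using corr_neighbours[OF x] by blast
    show ?thesis
    proof (cases "degree g = 0")
      case True
      then show ?thesis using M.sg_const N.sg_const coeffs_agree[OF g] by simp
    next
      case deg: False
      show ?thesis
      proof (cases "M.regular g")
        case True
        then have rN: "N.regular g" using regular_agree g by blast
        have "s1 (x - z) = s2 (y - w)" "s1 (x - z') = s2 (y - w')"
          using c zw(1,2) by (auto dest: cutD)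
        then have y: "0 < s2 (y - w)" "0 < s2 (w' - y)"
          using zw(3,4) M.s_diff_swap[of x z'] N.s_diff_swap[of y w'] by auto
        have dg: "pderiv g \<in> G" "M.regular (pderiv g)"
          using G_pderiv less.prems deg M.regular_pderiv True by auto
        note gaps = corr_gap[OF less.prems True zw(1,2) no] corr_gap[OF dg zw(1,2) no]
        have "M.sg g x = (if M.sg g z \<noteq> 0 then M.sg g z else M.sg g z')"
          using gaps deg zw True g by (intro M.sign_in_gap) auto
        moreover have "N.sg g y = (if N.sg g w \<noteq> 0 then N.sg g w else N.sg g w')"
          using gaps deg y rN g by (intro N.sign_in_gap) auto
        ultimately show ?thesis using sign_corr[OF zw(1) less.prems] sign_corr[OF zw(2) less.prems] by simp
      next
        case False
        then have "\<not> N.regular g" using regular_agree g by blast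
        moreover have "drop_lead g \<in> G" using G_drop_lead less.prems deg by simp
        moreover have "degree (drop_lead g) < degree g"
          unfolding drop_lead_def using deg by (intro degree_lessI) (auto simp: coeff_eq_0)
        ultimately show ?thesis
          using less.hyps[of "drop_lead g"] M.sg_drop_lead[OF False] N.sg_drop_lead by simp
      qed
    qed
  qed
qed

end

lemma degree_drop_lead_less: "0 < degree f \<Longrightarrow> degree (drop_lead f) < degree f"
  unfolding drop_lead_def by (intro degree_lessI) (auto simp: coeff_eq_0)

context correspondence
begin

text \<open>
  Apart from the sentinels, the known points are roots of polynomials \<open>g\<close> of the family already treated, and at such a root the sign of \<open>f\<close> is
  that of its pseudo-remainder modulo \<open>g\<close>, up to a power of the leading coefficient of \<open>g\<close>.
\<close>

lemma sign_of_new_polynomial: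
  assumes f: "f \<in> F" and tr: "0 < degree f \<Longrightarrow> drop_lead f \<in> G"
    and rem: "\<And>g. g \<in> G \<Longrightarrow> 0 < degree g \<Longrightarrow> \<exists>k q. \<exists>r\<in>G. smult (lead_coeff g ^ k) f = g * q + r"
    and zw: "(z, w) \<in> \<rho>"
  shows "M.sg f z = N.sg f w"
proof (cases "degree f = 0")
  case True
  then show ?thesis by (simp add: M.sg_const N.sg_const coeffs_agree[OF f])
next
  case deg: False
  show ?thesis
  proof (cases "M.regular f")
    case False
    then show ?thesis
      using sign_corr[OF zw tr] deg M.sg_drop_lead N.sg_drop_lead regular_agree[OF f] by simp
  next
    case reg: True
    then have rN: "N.regular f" using regular_agree[OF f] by simp
    consider "(z, w) = (B1, B2)" | "(z, w) = (- B1, - B2)"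
      | g where "g \<in> G" "M.regular g" "0 < degree g" "M.sg g z = 0"
      using root_corr[OF zw] by blast
    then show ?thesis
    proof cases
      case 1
      then show ?thesis
        using M.B_right[OF f, of B1] N.B_right[OF f, of B2] reg rN coeffs_agree[OF f]
        by (simp add: M.sg_def N.sg_def M.regular_def N.regular_def)
    next
      case 2
      then show ?thesis
        using M.B_left[OF f, of "- B1"] N.B_left[OF f, of "- B2"] reg rN coeffs_agree[OF f]
        by (simp add: M.sg_def N.sg_def M.regular_def N.regular_def)
    next
      case 3
      obtain k q r where r: "r \<in> G" "smult (lead_coeff g ^ k) f = g * q + r"
        using rem 3 by blast
      have "g \<in> F" using 3 G_subset by blast
      have "N.sg g w = 0" using sign_corr[OF zw 3(1)] 3(4) by simp
      from M.sg_rem[OF r(2) 3(4)] N.sg_rem[OF r(2) this] sign_corr[OF zw r(1)]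
      show ?thesis using 3(2) coeffs_agree[OF \<open>g \<in> F\<close>]
        by (metis M.regular_def mult_left_cancel power_not_zero)
    qed
  qed
qed

context
  fixes f
  assumes f: "f \<in> F" "M.regular f" "0 < degree f" "pderiv f \<in> G"
begin

text \<open>
  In an interval between known points the derivative has no root, so a root of \<open>f\<close> inside makes the signs at the end points
  opposite. These are the same in the other model, where the intermediate value theorem provides a root.
\<close>

lemma root_transfer:
  assumes old: "\<And>z w. (z, w) \<in> \<rho> \<Longrightarrow> M.sg f z = N.sg f w" and x: "M.sg f x = 0"
  shows "(\<exists>z w. (z, w) \<in> \<rho> \<and> s1 (x - z) = 0) \<or> (\<exists>y. N.sg f y = 0 \<and> cut x y)"
proof (cases "\<exists>z w. (z, w) \<in> \<rho> \<and> s1 (x - z) = 0")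
  case False
  then obtain z w z' w' where zw: "(z, w) \<in> \<rho>" "(z', w') \<in> \<rho>" "0 < s1 (x - z)" "0 < s1 (z' - x)"
    and no: "\<And>v u. (v, u) \<in> \<rho> \<Longrightarrow> 0 \<le> s1 (z - v) \<or> 0 \<le> s1 (v - z')"
    using corr_neighbours[OF M.regular_inside[OF f(1,2) x]] by blast
  have rN: "N.regular f" using f regular_agree by blast
  have zz: "0 < s1 (z' - z)" using zw M.s_trans1[of x z z'] by simp
  then have ww: "0 < s2 (w' - w)" using order_corr[OF zw(2,1)] by simp
  note gap = corr_gap[OF f(4) M.regular_pderiv(1)[OF f(2,3)] zw(1,2) no]
  have "M.sg f z * M.sg f z' < 0"
    by (rule M.regular_sign_change_at_root[OF f(1,2,3) zw(3,4) x gap(1)])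
  then have "N.sg f w * N.sg f w' < 0" using old zw(1,2) by simp
  moreover have "N.ivt (map_poly e2 f)"
    using N.ivt_F[OF f(1)] rN N.div_ivt_ivt by (simp add: N.regular_def)
  ultimately obtain y where "0 < s2 (y - w)" "0 < s2 (w' - y)" "N.sg f y = 0"
    using ww unfolding N.ivt_def N.sg_def by blast
  moreover from this have "cut x y" using no by (intro between_cut[OF zw])
  ultimately show ?thesis by blast
qed blast

text \<open>
  Two roots in the same gap would force a root of the derivative in that gap, where there is none.
\<close>

lemma root_unique_in_cut:
  assumes x: "M.sg f x = 0" "M.sg f x' = 0"
    and same: "\<And>z w. (z, w) \<in> \<rho> \<Longrightarrow> s1 (x - z) = s1 (x' - z)"
  shows "s1 (x - x') = 0"
proof (cases "\<exists>z w. (z, w) \<in> \<rho> \<and> s1 (x - z) = 0")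
  case True
  then obtain z w where "(z, w) \<in> \<rho>" "s1 (x - z) = 0" by blast
  with same[of z w] show ?thesis
    using M.s_null_diff[of "x' - z" "x - z"] by simp
next
  case False
  then obtain z w z' w' where zw: "(z, w) \<in> \<rho>" "(z', w') \<in> \<rho>" "0 < s1 (x - z)" "0 < s1 (z' - x)"
    and no: "\<And>v u. (v, u) \<in> \<rho> \<Longrightarrow> 0 \<le> s1 (z - v) \<or> 0 \<le> s1 (v - z')"
    using corr_neighbours[OF M.regular_inside[OF f(1,2) x(1)]] by blast
  have x': "0 < s1 (x' - z)" "0 < s1 (z' - x')"
    using same[OF zw(1)] same[OF zw(2)] zw(3,4) M.s_diff_swap[of x z'] M.s_diff_swap[of x' z'] by auto
  have gap: "M.gap (pderiv f) z z'"
    by (rule corr_gap(1)[OF f(4) M.regular_pderiv(1)[OF f(2,3)] zw(1,2) no])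
  have sub: "M.gap (pderiv f) a b" if "0 < s1 (a - z)" "0 < s1 (z' - b)" for a b
    unfolding M.gap_def
  proof (intro allI impI)
    fix c assume "0 < s1 (c - a)" "0 < s1 (b - c)"
    with that have "0 < s1 (c - z)" "0 < s1 (z' - c)"
      using M.s_trans1[of a z c] M.s_trans1[of b c z'] by auto
    with gap show "M.sg (pderiv f) c \<noteq> 0" by (simp add: M.gap_def)
  qed
  have "\<not> 0 < s1 (x' - x)"
    using M.regular_rolle[OF f(1,2,3) _ x(1,2)] sub[OF zw(3) x'(2)] by blast
  moreover have "\<not> 0 < s1 (x - x')"
    using M.regular_rolle[OF f(1,2,3) _ x(2,1)] sub[OF x'(1) zw(4)] by blast
  ultimately show ?thesis using M.s_diff_swap[of x x'] by simp
qed

end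

end

text \<open>
  The new roots of \<open>f\<close> are matched by their position among the known points; by Rolle's theorem there is at most one in each
  gap, so the position determines the root up to an element of sign \<open>0\<close>.
\<close>

lemma (in correspondence) correspondence_insert:
  assumes f: "f \<in> F" and pd: "0 < degree f \<Longrightarrow> pderiv f \<in> G" and tr: "0 < degree f \<Longrightarrow> drop_lead f \<in> G"
    and rem: "\<And>g. g \<in> G \<Longrightarrow> 0 < degree g \<Longrightarrow> \<exists>k q. \<exists>r\<in>G. smult (lead_coeff g ^ k) f = g * q + r"
  shows "\<exists>\<rho>'. correspondence s1 e1 B1 s2 e2 B2 F (insert f G) \<rho>'"
proof -
  note old = sign_of_new_polynomial[OF f tr rem]
  interpret S: correspondence s2 e2 B2 s1 e1 B1 F G "prod.swap ` \<rho>" by (rule corr_swap)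
  have S_cut: "S.cut y x \<longleftrightarrow> cut x y" for x y
    by (auto simp: S.cut_def cut_def)
  show ?thesis
  proof (cases "M.regular f \<and> 0 < degree f")
    case False
    have "correspondence s1 e1 B1 s2 e2 B2 F (insert f G) \<rho>"
    proof (intro correspondence.intro two_models_axioms correspondence_axioms.intro)
      fix g assume g: "g \<in> insert f G"
      show "0 < degree g \<Longrightarrow> pderiv g \<in> insert f G" "0 < degree g \<Longrightarrow> drop_lead g \<in> insert f G"
        using g pd tr G_pderiv G_drop_lead by auto
      show "M.sg g z = N.sg g w" if "(z, w) \<in> \<rho>" for z w
        using g old sign_corr that by auto
      show "\<exists>z w. (z, w) \<in> \<rho> \<and> s1 (x - z) = 0" if "M.regular g" "0 < degree g" "M.sg g x = 0" for x
        using cover1 False g that by blast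
      show "\<exists>z w. (z, w) \<in> \<rho> \<and> s2 (y - w) = 0" if "N.regular g" "0 < degree g" "N.sg g y = 0" for y
        using cover2 False g that regular_agree[OF f] by blast
    next
      show "\<exists>g\<in>insert f G. M.regular g \<and> 0 < degree g \<and> M.sg g z = 0"
        if "(z, w) \<in> \<rho>" "(z, w) \<noteq> (B1, B2)" "(z, w) \<noteq> (- B1, - B2)" for z w
        using root_corr[OF that] by blast
    qed (use f G_subset finite_corr B_corr order_corr in auto)
    then show ?thesis by blast
  next
    case True
    then have rM: "M.regular f" and deg: "0 < degree f" and rN: "N.regular f"
      using regular_agree[OF f] by auto
    have pdf: "pderiv f \<in> G" using pd deg .
    obtain Y1 where Y1: "finite Y1" "\<forall>x\<in>Y1. M.sg f x = 0"
      "\<And>x. M.sg f x = 0 \<Longrightarrow> \<exists>x1\<in>Y1. s1 (x - x1) = 0"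
      using M.finite_roots[OF M.regular_not_pnull[OF rM]] unfolding M.sg_def by blast
    obtain Y2 where Y2: "finite Y2" "\<forall>y\<in>Y2. N.sg f y = 0"
      "\<And>y. N.sg f y = 0 \<Longrightarrow> \<exists>y1\<in>Y2. s2 (y - y1) = 0"
      using N.finite_roots[OF N.regular_not_pnull[OF rN]] unfolding N.sg_def by blast
    \<comment> \<open>Only representatives of the roots are matched, to keep the relation finite.\<close>
    define \<nu> where "\<nu> = {(x, y). x \<in> Y1 \<and> y \<in> Y2 \<and> cut x y}"
    have \<nu>: "M.sg f x = 0" "N.sg f y = 0" "cut x y" "x \<in> Y1" "y \<in> Y2" if "(x, y) \<in> \<nu>" for x y
      using that Y1 Y2 by (auto simp: \<nu>_def)
    have cut_null: "cut x y \<longleftrightarrow> cut x' y'" if "s1 (x - x') = 0" "s2 (y - y') = 0" for x y x' y'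
    proof -
      have "s1 (x - z) = s1 (x' - z)" "s2 (y - w) = s2 (y' - w)" for z w
        using that by (auto intro!: M.s_cong N.s_cong)
      then show ?thesis by (simp add: cut_def)
    qed
    have cov1: "\<exists>z w. (z, w) \<in> \<rho> \<union> \<nu> \<and> s1 (x - z) = 0" if x: "M.sg f x = 0" for x
    proof (cases "\<exists>z w. (z, w) \<in> \<rho> \<and> s1 (x - z) = 0")
      case False
      then obtain y where y: "N.sg f y = 0" "cut x y"
        using root_transfer[OF f rM deg pdf old x] by blast
      obtain x1 y1 where "x1 \<in> Y1" "y1 \<in> Y2" "s1 (x - x1) = 0" "s2 (y - y1) = 0"
        using Y1(3)[OF x] Y2(3)[OF y(1)] by blast
      with y(2) cut_null show ?thesis by (auto simp: \<nu>_def)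
    qed blast
    have cov2: "\<exists>z w. (z, w) \<in> \<rho> \<union> \<nu> \<and> s2 (y - w) = 0" if y: "N.sg f y = 0" for y
    proof (cases "\<exists>z w. (z, w) \<in> \<rho> \<and> s2 (y - w) = 0")
      case False
      have "N.sg f w = M.sg f z" if "(w, z) \<in> prod.swap ` \<rho>" for w z
        using old[of z w] that by auto
      from S.root_transfer[OF f rN deg pdf this y] False
      obtain x where x: "M.sg f x = 0" "cut x y" by (auto simp: S_cut)
      obtain x1 y1 where "x1 \<in> Y1" "y1 \<in> Y2" "s1 (x - x1) = 0" "s2 (y - y1) = 0"
        using Y1(3)[OF x(1)] Y2(3)[OF y] by blast
      with x(2) cut_null show ?thesis by (auto simp: \<nu>_def)
    qed blast
    have ord_new: "s1 (x - x') = s2 (y - y')" if xy: "(x, y) \<in> \<nu>" "(x', y') \<in> \<nu>" for x y x' y'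
    proof (cases "\<forall>z w. (z, w) \<in> \<rho> \<longrightarrow> s1 (x - z) = s1 (x' - z)")
      case True
      have "s1 (x - x') = 0"
        by (rule root_unique_in_cut[OF f rM deg pdf]) (use \<nu>[OF xy(1)] \<nu>[OF xy(2)] True in auto)
      moreover have "s2 (y - y') = 0"
        by (rule S.root_unique_in_cut[OF f rN deg pdf])
          (use \<nu>[OF xy(1)] \<nu>[OF xy(2)] True in \<open>auto simp flip: cutD\<close>)
      ultimately show ?thesis by simp
    next
      case False
      then obtain z w where z: "(z, w) \<in> \<rho>" "s1 (x - z) \<noteq> s1 (x' - z)" by blast
      have yw: "s1 (x - z) = s2 (y - w)" "s1 (x' - z) = s2 (y' - w)"
        using \<nu>(3)[OF xy(1)] \<nu>(3)[OF xy(2)] cutD z(1) by blast+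
      show ?thesis
      proof (cases "s1 (x - z) < s1 (x' - z)")
        case True
        then show ?thesis using M.separated_by_point[of x z x'] N.separated_by_point[of y w y'] yw by simp
      next
        case False
        then show ?thesis using z(2) M.separated_by_point[of x' z x] N.separated_by_point[of y' w y] yw
            M.s_diff_swap[of x x'] N.s_diff_swap[of y y'] by simp
      qed
    qed
    have "correspondence s1 e1 B1 s2 e2 B2 F (insert f G) (\<rho> \<union> \<nu>)"
    proof (intro correspondence.intro two_models_axioms correspondence_axioms.intro)
      have "\<nu> \<subseteq> Y1 \<times> Y2" by (auto simp: \<nu>_def)
      then show "finite (\<rho> \<union> \<nu>)" using finite_corr Y1(1) Y2(1) finite_subset by blast
    next
      fix g assume g: "g \<in> insert f G"
      show "0 < degree g \<Longrightarrow> pderiv g \<in> insert f G" "0 < degree g \<Longrightarrow> drop_lead g \<in> insert f G"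
        using g pd tr G_pderiv G_drop_lead by auto
      show "M.sg g z = N.sg g w" if zw: "(z, w) \<in> \<rho> \<union> \<nu>" for z w
      proof (cases "(z, w) \<in> \<rho>")
        case True
        then show ?thesis using g old sign_corr by auto
      next
        case False
        then have \<nu>': "(z, w) \<in> \<nu>" using zw by blast
        show ?thesis
        proof (cases "g = f")
          case True
          then show ?thesis using \<nu>[OF \<nu>'] by simp
        next
          case False
          then have "g \<in> G" using g by blast
          then show ?thesis
            using cut_sign[OF \<nu>(3)[OF \<nu>'] M.regular_inside[OF f rM \<nu>(1)[OF \<nu>']]] by blast
        qed
      qed
      show "\<exists>z w. (z, w) \<in> \<rho> \<union> \<nu> \<and> s1 (x - z) = 0" if "M.regular g" "0 < degree g" "M.sg g x = 0" for x
        using cover1[of g x] cov1[of x] g that by blast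
      show "\<exists>z w. (z, w) \<in> \<rho> \<union> \<nu> \<and> s2 (y - w) = 0" if "N.regular g" "0 < degree g" "N.sg g y = 0" for y
        using cover2[of g y] cov2[of y] g that by blast
    next
      show "\<exists>g\<in>insert f G. M.regular g \<and> 0 < degree g \<and> M.sg g z = 0"
        if "(z, w) \<in> \<rho> \<union> \<nu>" "(z, w) \<noteq> (B1, B2)" "(z, w) \<noteq> (- B1, - B2)" for z w
        using root_corr[of z w] that \<nu>(1)[of z w] rM deg by blast
    next
      fix z w z' w' assume zw: "(z, w) \<in> \<rho> \<union> \<nu>" and zw': "(z', w') \<in> \<rho> \<union> \<nu>"
      have mixed: "s1 (x - v) = s2 (y - u) \<and> s1 (v - x) = s2 (u - y)" if "(x, y) \<in> \<nu>" "(v, u) \<in> \<rho>" for x y v u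
        using cutD[OF \<nu>(3)[OF that(1)] that(2)] M.s_diff_swap[of v x] N.s_diff_swap[of u y] by simp
      show "s1 (z - z') = s2 (w - w')"
        using zw zw' order_corr ord_new mixed by blast
    qed (use f G_subset B_corr in auto)
    then show ?thesis by blast
  qed
qed

context two_models
begin

text \<open>
  The family is built up by increasing degree, one polynomial at a time, so that derivatives, truncations and
  pseudo-remainders are available when a polynomial is added.
\<close>

lemma correspondence_exists: "\<exists>\<rho>. correspondence s1 e1 B1 s2 e2 B2 F F \<rho>"
proof -
  let ?low = "\<lambda>d. {f\<in>F. degree f < d}"
  have "\<exists>\<rho>. correspondence s1 e1 B1 s2 e2 B2 F (?low d) \<rho>" for d
  proof (induction d)
    case 0
    have "s1 (B1 + B1) = 1" "s2 (B2 + B2) = 1"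
      using M.s_pos_add[of B1 B1] M.B_pos M.s_range[of "B1 + B1"]
        N.s_pos_add[of B2 B2] N.B_pos N.s_range[of "B2 + B2"] by auto
    moreover from this have "s1 (- B1 - B1) = -1" "s2 (- B2 - B2) = -1"
      using M.s_minus[of "B1 + B1"] N.s_minus[of "B2 + B2"] by auto
    ultimately have "correspondence s1 e1 B1 s2 e2 B2 F {} {(B1, B2), (- B1, - B2)}"
      by (intro correspondence.intro two_models_axioms correspondence_axioms.intro) auto
    then show ?case by auto
  next
    case (Suc d)
    let ?new = "{f\<in>F. degree f = d}"
    have "finite ?new" using M.fin by simp
    have "\<exists>\<rho>. correspondence s1 e1 B1 s2 e2 B2 F (?low d \<union> E) \<rho>" if "E \<subseteq> ?new" for E
      using finite_subset[OF that \<open>finite ?new\<close>] that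
    proof (induction E rule: finite_induct)
      case empty
      then show ?case using Suc by simp
    next
      case (insert f E)
      then obtain \<rho> where "correspondence s1 e1 B1 s2 e2 B2 F (?low d \<union> E) \<rho>" by auto
      then interpret C: correspondence s1 e1 B1 s2 e2 B2 F "?low d \<union> E" \<rho> .
      have f: "f \<in> F" "degree f = d" using insert.prems by auto
      have "\<exists>\<rho>'. correspondence s1 e1 B1 s2 e2 B2 F (insert f (?low d \<union> E)) \<rho>'"
      proof (rule C.correspondence_insert[OF f(1)])
        assume deg: "0 < degree f"
        have "degree (pderiv f) < degree f"
          using deg by (intro degree_lessI) (auto simp: coeff_pderiv coeff_eq_0)
        then show "pderiv f \<in> ?low d \<union> E" using M.closed_pderiv[OF f(1) deg] f(2) by simp
        show "drop_lead f \<in> ?low d \<union> E"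
          using M.closed_drop_lead[OF f(1) deg] degree_drop_lead_less[OF deg] f(2) by simp
      next
        fix g assume g: "g \<in> ?low d \<union> E" "0 < degree g"
        then have "g \<in> F" "degree g \<le> degree f" using f(2) insert.prems by auto
        with M.closed_rem[OF f(1) this(1) g(2)] obtain k q r where
          "r \<in> F" "smult (lead_coeff g ^ k) f = g * q + r" "degree r < degree g" by blast
        moreover from this have "r \<in> ?low d \<union> E" using \<open>degree g \<le> degree f\<close> f(2) by simp
        ultimately show "\<exists>k q. \<exists>r\<in>?low d \<union> E. smult (lead_coeff g ^ k) f = g * q + r" by blast
      qed
      then show ?case by simp
    qed
    from this[of ?new] have "\<exists>\<rho>. correspondence s1 e1 B1 s2 e2 B2 F (?low d \<union> ?new) \<rho>" by simp
    also have "?low d \<union> ?new = ?low (Suc d)" by auto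
    finally show ?case .
  qed
  moreover obtain d where "\<forall>f\<in>F. degree f < d"
    using finite_nat_set_iff_bounded[of "degree ` F"] M.fin by auto
  then have "?low d = F" by auto
  ultimately show ?thesis by metis
qed

text \<open>
  It is enough to find \<open>y\<close> with the same position as \<open>x\<close>: a corresponding point if \<open>x\<close> is one, and otherwise any point of
  the matching gap.
\<close>

lemma sign_transfer:
  assumes x: "0 < s1 (B1 - x)" "0 < s1 (x + B1)"
    and dense: "\<And>a b. 0 < s2 (b - a) \<Longrightarrow> \<exists>c. 0 < s2 (c - a) \<and> 0 < s2 (b - c)"
  shows "\<exists>y. \<forall>f\<in>F. M.sg f x = N.sg f y"
proof -
  obtain \<rho> where "correspondence s1 e1 B1 s2 e2 B2 F F \<rho>" using correspondence_exists by blast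
  then interpret C: correspondence s1 e1 B1 s2 e2 B2 F F \<rho> .
  have "\<exists>y. C.cut x y"
  proof (cases "\<exists>z w. (z, w) \<in> \<rho> \<and> s1 (x - z) = 0")
    case True
    then obtain z w where z: "(z, w) \<in> \<rho>" "s1 (x - z) = 0" by blast
    have "s1 (x - v) = s2 (w - u)" if "(v, u) \<in> \<rho>" for v u
      using M.s_cong[of "x - v" "z - v"] z C.order_corr[OF z(1) that] by simp
    then show ?thesis by (auto simp: C.cut_def)
  next
    case False
    then obtain z w z' w' where zw: "(z, w) \<in> \<rho>" "(z', w') \<in> \<rho>" "0 < s1 (x - z)" "0 < s1 (z' - x)"
      and no: "\<And>v u. (v, u) \<in> \<rho> \<Longrightarrow> 0 \<le> s1 (z - v) \<or> 0 \<le> s1 (v - z')"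
      using C.corr_neighbours[OF x] by blast
    have "0 < s2 (w' - w)" using C.order_corr[OF zw(2,1)] zw(3,4) M.s_trans1[of x z z'] by simp
    then obtain y where "0 < s2 (y - w)" "0 < s2 (w' - y)" using dense by blast
    then have "C.cut x y" using no by (intro C.between_cut[OF zw])
    then show ?thesis by blast
  qed
  then show ?thesis using C.cut_sign[OF _ x] by blast
qed

end

section \<open>Closing a finite family under remainders and derivatives\<close>

definition prem :: "'c::idom poly \<Rightarrow> 'c poly \<Rightarrow> 'c poly" where
  "prem f g = (SOME r. \<exists>k q. smult (lead_coeff g ^ k) f = g * q + r \<and> degree r < degree g)"

lemma prem_remainder:
  assumes "0 < degree g"
  shows "\<exists>k q. smult (lead_coeff g ^ k) f = g * q + prem f g \<and> degree (prem f g) < degree g"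
proof -
  have "\<exists>r k q. smult (lead_coeff g ^ k) f = g * q + r \<and> degree r < degree g"
    using ex_pseudo_division[OF assms, of f] by blast
  then show ?thesis unfolding prem_def by (rule someI_ex)
qed

inductive_set rem_closure :: "'c::idom poly set \<Rightarrow> 'c poly set" for C where
  base: "f \<in> C \<Longrightarrow> f \<in> rem_closure C"
| deriv: "f \<in> rem_closure C \<Longrightarrow> 0 < degree f \<Longrightarrow> pderiv f \<in> rem_closure C"
| drop_lead: "f \<in> rem_closure C \<Longrightarrow> 0 < degree f \<Longrightarrow> drop_lead f \<in> rem_closure C"
| remainder: "f \<in> rem_closure C \<Longrightarrow> g \<in> rem_closure C \<Longrightarrow> 0 < degree g \<Longrightarrow> degree g \<le> degree f \<Longrightarrow>
    prem f g \<in> rem_closure C"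

lemma degree_pderiv_less: "0 < degree f \<Longrightarrow> degree (pderiv f) < degree f"
  by (intro degree_lessI) (auto simp: coeff_pderiv coeff_eq_0)

text \<open>
  Each operation produces a polynomial of smaller degree than all its arguments. So the elements of degree at least \<open>d\<close>
  come from the finite set at the start or from elements of degree greater than \<open>d\<close>, and there is a bound for all degrees.
\<close>

lemma finite_rem_closure:
  assumes C: "finite C"
  shows "finite (rem_closure C)"
proof -
  obtain D where D: "\<forall>f\<in>C. degree f < D"
    using finite_nat_set_iff_bounded[of "degree ` C"] C by auto
  have bound: "degree f < D" if "f \<in> rem_closure C" for f
    using that
  proof induction
    case (remainder f g)
    then show ?case using prem_remainder[of g f] by auto
  qed (use D in \<open>auto intro: less_trans[OF degree_pderiv_less] less_trans[OF degree_drop_lead_less]\<close>)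
  have "finite {f \<in> rem_closure C. D \<le> degree f + k}" for k
  proof (induction k)
    case 0
    have "{f \<in> rem_closure C. D \<le> degree f + 0} = {}" using bound by force
    then show ?case by (metis finite.emptyI)
  next
    case (Suc k)
    let ?A = "{f \<in> rem_closure C. D \<le> degree f + k}"
    have "{f \<in> rem_closure C. D \<le> degree f + Suc k} \<subseteq>
      C \<union> pderiv ` ?A \<union> drop_lead ` ?A \<union> (\<lambda>(f, g). prem f g) ` (?A \<times> ?A)"
    proof
      fix f assume "f \<in> {f \<in> rem_closure C. D \<le> degree f + Suc k}"
      then have f: "f \<in> rem_closure C" "D \<le> degree f + Suc k" by auto
      from f(1) show "f \<in> C \<union> pderiv ` ?A \<union> drop_lead ` ?A \<union> (\<lambda>(f, g). prem f g) ` (?A \<times> ?A)"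
      proof cases
        case (deriv g)
        then have "g \<in> ?A" using degree_pderiv_less[of g] f(2) by simp
        with deriv show ?thesis by blast
      next
        case (drop_lead g)
        then have "g \<in> ?A" using degree_drop_lead_less[of g] f(2) by simp
        with drop_lead show ?thesis by blast
      next
        case (remainder g h)
        then have "degree f < degree h" using prem_remainder by blast
        then have "g \<in> ?A" "h \<in> ?A" using remainder f(2) by auto
        with remainder show ?thesis by blast
      qed blast
    qed
    then show ?case
      by (rule finite_subset) (use C Suc in \<open>auto intro!: finite_imageI finite_cartesian_product\<close>)
  qed
  from this[of D] show ?thesis by simp
qed

section \<open>Signs beyond all roots\<close>

lemma poly_map_poly_reflect:
  assumes "ring_morphism e"
  shows "poly (map_poly e (pcompose f [:0, -1:])) x = poly (map_poly e f) (- x)"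
proof (induction f)
  case (pCons a f)
  show ?case
    using pCons.IH
    by (simp add: pcompose_pCons map_poly_pCons_morphism[OF assms] ring_morphismD[OF assms]
        ring_morphismD[OF ring_morphism_map_poly[OF assms]])
qed (simp add: pcompose_0)

lemma lead_coeff_reflect:
  fixes f :: "'c::idom poly"
  shows "degree (pcompose f [:0, -1:]) = degree f"
    "lead_coeff (pcompose f [:0, -1:]) = lead_coeff f * (-1) ^ degree f"
  by (simp add: degree_pcompose) (subst lead_coeff_comp; simp)

context sign_function
begin

context
  fixes e :: "'c::idom \<Rightarrow> 'a" and B
  assumes e: "ring_morphism e" and B: "\<And>c k. 0 < s (e c) \<Longrightarrow> 0 < s (e c * B + e k)"
begin

lemma linear_dominates:
  assumes "0 \<le> s (x - B)" "0 < s (e c)"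
  shows "0 < s (e c * x + e k)"
proof -
  have "0 < s ((e c * B + e k) + e c * (x - B))"
    by (rule s_pos_add[OF B[OF assms(2)]]) (use assms in \<open>simp add: s_mult\<close>)
  then show ?thesis by (simp add: algebra_simps)
qed

text \<open>
  Horner's scheme: once an inner value exceeds \<open>1\<close>, multiplication by \<open>x\<close> keeps it above every element of the ground ring.
\<close>

lemma poly_dominates:
  assumes x: "0 \<le> s (x - B)" and f: "0 < s (e (lead_coeff f))" "0 < degree f"
  shows "0 < s (poly (map_poly e f) x + e k)"
  using f
proof (induction f arbitrary: k)
  case (pCons a f)
  note ev = map_poly_pCons_morphism[OF e]
  have "f \<noteq> 0" using pCons.prems by auto
  then have lc: "0 < s (e (lead_coeff f))" using pCons.prems by simp
  show ?case
  proof (cases "degree f = 0")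
    case True
    then obtain c where "f = [:c:]" by (elim degree_eq_zeroE)
    with lc linear_dominates[OF x, of c "a + k"] show ?thesis
      by (simp add: ev ring_morphismD[OF e] algebra_simps)
  next
    case False
    have e1: "e 1 = 1" by (simp add: ring_morphismD[OF e])
    have "0 < s (poly (map_poly e f) x + e (- 1))" using pCons.IH[OF lc] False by simp
    then have "0 < s (poly (map_poly e f) x - 1)" by (simp add: ring_morphismD[OF e])
    moreover have "0 < s x" using linear_dominates[OF x, of 1 0] by (simp add: ring_morphismD[OF e] s_one)
    ultimately have "0 \<le> s (x * (poly (map_poly e f) x - 1))" by (simp add: s_mult)
    moreover have "0 < s (x + e (a + k))" using linear_dominates[OF x, of 1 "a + k"] by (simp add: e1 s_one)
    ultimately have "0 < s (x + e (a + k) + x * (poly (map_poly e f) x - 1))" by (rule s_pos_add[rotated])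
    then show ?thesis by (simp add: ev ring_morphismD[OF e] algebra_simps)
  qed
qed simp

lemma poly_sign_right:
  assumes x: "0 \<le> s (x - B)" and f: "s (e (lead_coeff f)) \<noteq> 0"
  shows "s (poly (map_poly e f) x) = s (e (lead_coeff f))"
proof (cases "degree f = 0")
  case True
  then show ?thesis by (elim degree_eq_zeroE) (simp add: map_poly_pCons_morphism[OF e])
next
  case False
  consider "0 < s (e (lead_coeff f))" | "0 < s (e (lead_coeff (- f)))"
    using f by (auto simp: ring_morphismD[OF e] s_minus) (meson linorder_neqE_linordered_idom)
  then show ?thesis
  proof cases
    case 1
    with poly_dominates[OF x 1, of 0] False show ?thesis
      using s_range[of "poly (map_poly e f) x"] s_range[of "e (lead_coeff f)"]
      by (auto simp: ring_morphismD[OF e])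
  next
    case 2
    with poly_dominates[OF x 2, of 0] False show ?thesis
      using s_range[of "poly (map_poly e f) x"] s_range[of "e (lead_coeff f)"]
      by (auto simp: ring_morphismD[OF e] ring_morphismD[OF ring_morphism_map_poly[OF e]] s_minus)
  qed
qed

lemma poly_sign_left:
  assumes x: "s (x + B) \<le> 0" and f: "s (e (lead_coeff f)) \<noteq> 0"
  shows "s (poly (map_poly e f) x) = (-1) ^ degree f * s (e (lead_coeff f))"
proof -
  have "0 \<le> s (- x - B)" using x s_minus[of "x + B"] by simp
  moreover have "e ((-1) ^ n) = (-1) ^ n" for n
    by (simp add: ring_morphism_power[OF e] ring_morphismD[OF e])
  then have lc: "s (e (lead_coeff (pcompose f [:0, -1:]))) = (-1) ^ degree f * s (e (lead_coeff f))"
    unfolding lead_coeff_reflect(2) by (simp add: ring_morphismD[OF e] s_mult s_power s_minus s_one)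
  moreover from this have "s (e (lead_coeff (pcompose f [:0, -1:]))) \<noteq> 0" using f by simp
  ultimately have "s (poly (map_poly e (pcompose f [:0, -1:])) (- x)) = (-1) ^ degree f * s (e (lead_coeff f))"
    using poly_sign_right by metis
  then show ?thesis by (simp add: poly_map_poly_reflect[OF e])
qed

end

end

section \<open>The real line as a model\<close>

interpretation sgn_real: sign_function "sgn :: real \<Rightarrow> real"
proof
  show "sgn (x * y) = sgn x * sgn y" for x y :: real by (rule sgn_mult)
qed (auto simp: sgn_if split: if_splits)

text \<open>
  On the real line the intermediate value theorem holds for every polynomial.
\<close>

lemma sgn_real_div_ivt: "sgn_real.div_ivt p"
  unfolding sgn_real.div_ivt_def sgn_real.ivt_def
proof (intro allI impI)
  fix k :: "real poly" and a b
  assume "0 < sgn (b - a)" "sgn (poly k a) * sgn (poly k b) < 0"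
  then have "a < b" "poly k a * poly k b < 0"
    by (auto simp: sgn_if mult_less_0_iff split: if_splits)
  then obtain c where "a < c" "c < b" "poly k c = 0" using poly_IVT by blast
  then show "\<exists>c. 0 < sgn (c - a) \<and> 0 < sgn (b - c) \<and> sgn (poly k c) = 0" by auto
qed

lemma real_poly_sign_right: "\<exists>b. \<forall>x\<ge>b. sgn (poly p x) = sgn (lead_coeff (p :: real poly))"
proof -
  consider "p = 0" | "0 < lead_coeff p" | "0 < lead_coeff (- p)"
    by (metis leading_coeff_0_iff lead_coeff_minus linorder_neqE_linordered_idom neg_0_less_iff_less)
  then show ?thesis
  proof cases
    case 2
    from poly_pinfty_gt_lc[OF 2] obtain n where "\<forall>x\<ge>n. lead_coeff p \<le> poly p x" by blast
    with 2 show ?thesis by (intro exI[of _ n]) (force simp: sgn_if)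
  next
    case 3
    from poly_pinfty_gt_lc[OF 3] obtain n where "\<forall>x\<ge>n. lead_coeff (- p) \<le> poly (- p) x" by blast
    with 3 show ?thesis by (intro exI[of _ n]) (force simp: sgn_if)
  qed auto
qed

lemma real_poly_signs_outside:
  assumes "finite P"
  shows "\<exists>B>0. \<forall>p\<in>P. \<forall>x. (B \<le> x \<longrightarrow> sgn (poly p x) = sgn (lead_coeff (p :: real poly))) \<and>
    (x \<le> - B \<longrightarrow> sgn (poly p x) = (-1) ^ degree p * sgn (lead_coeff p))"
  using assms
proof (induction P rule: finite_induct)
  case empty
  show ?case by (intro exI[of _ 1]) auto
next
  case (insert p P)
  then obtain B where B: "0 < B" "\<forall>p\<in>P. \<forall>x. (B \<le> x \<longrightarrow> sgn (poly p x) = sgn (lead_coeff p)) \<and>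
    (x \<le> - B \<longrightarrow> sgn (poly p x) = (-1) ^ degree p * sgn (lead_coeff p))" by blast
  obtain b where b: "\<forall>x\<ge>b. sgn (poly p x) = sgn (lead_coeff p)" using real_poly_sign_right by blast
  obtain c where c: "\<forall>x\<ge>c. sgn (poly (pcompose p [:0, -1:]) x) = sgn (lead_coeff (pcompose p [:0, -1:]))"
    using real_poly_sign_right by blast
  have "sgn (poly p x) = (-1) ^ degree p * sgn (lead_coeff p)" if "x \<le> - c" for x
  proof -
    have "sgn (poly (pcompose p [:0, -1:]) (- x)) = sgn (lead_coeff (pcompose p [:0, -1:]))"
      using c that by simp
    moreover have "sgn ((-1 :: real) ^ n) = (-1) ^ n" for n by (cases "even n") auto
    ultimately show ?thesis
      unfolding lead_coeff_reflect(2) by (simp add: poly_pcompose sgn_mult)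
  qed
  with b B show ?case
    by (intro exI[of _ "max B (max b c)"]) auto
qed

section \<open>The Artin-Lang theorem\<close>

text \<open>
  Every finite part of the sign function is that of the evaluation at a real point: a homomorphism that
  fixes the constants is such an evaluation.
\<close>

definition approximable :: "('i mpoly \<Rightarrow> real) \<Rightarrow> bool" where
  "approximable s \<longleftrightarrow> (\<forall>C. finite C \<longrightarrow>
    (\<exists>e. ring_morphism e \<and> (\<forall>r. e (cst r) = r) \<and> (\<forall>c\<in>C. sgn (e c) = s c)))"

text \<open>
  One variable is added. The family consists of the given elements, read as polynomials in \<open>x\<^sub>0\<close>, closed under the
  operations of Cohen and Hoermander; its coefficient signs are realised by a real point by assumption. The first
  model is \<open>s\<close>, extended first by an infinitely large bound and then by a maximal number of roots, with \<open>x\<^sub>0\<close> as the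
  point to be transferred; the second model is the real line.
\<close>

lemma approximable_unshift:
  fixes s :: "poly_omega \<Rightarrow> real"
  assumes s: "sign_function s" and ap: "approximable (\<lambda>x. s (shift x))"
  shows "approximable s"
  unfolding approximable_def
proof (intro allI impI)
  fix C :: "poly_omega set" assume C: "finite C"
  define F where "F = rem_closure (unshift ` C)"
  have F: "finite F" unfolding F_def using C by (intro finite_rem_closure) simp
  let ?D = "\<Union>f\<in>F. coeff f ` {..degree f}"
  have "finite ?D" using F by simp
  then obtain e0 where e0: "ring_morphism e0" "\<And>r. e0 (cst r) = r" "\<forall>c\<in>?D. sgn (e0 c) = s (shift c)"
    using ap unfolding approximable_def by blast
  note shift = ring_morphismD[OF ring_morphism_shift]
  interpret s: sign_function s by (rule s)
  have agree: "sgn (e0 (coeff f i)) = s (shift (coeff f i))" if "f \<in> F" for f i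
  proof (cases "i \<le> degree f")
    case True
    then show ?thesis using e0(3) that by blast
  qed (simp add: coeff_eq_0 ring_morphismD[OF e0(1)] shift)
  \<comment> \<open>The bound exceeds all quotients from the ring that contains the coefficients and the point,
    and this survives the extension that adds roots.\<close>
  obtain s1 h1 B where 1: "sign_extension s s1 h1" "\<And>c x. 0 < s c \<Longrightarrow> 0 < s1 (h1 c * B + h1 x)"
    using sign_extension_infinite[OF s] by blast
  then have s1: "sign_function s1" and h1: "ring_morphism h1" and s1h1: "\<And>x. s1 (h1 x) = s x"
    by (auto simp: sign_extension_def)
  interpret s1: sign_function s1 by (rule s1)
  let ?e1 = "\<lambda>x. h1 (shift x)"
  have e1: "ring_morphism ?e1" by (rule ring_morphism_comp[OF ring_morphism_shift h1])
  obtain s2 h2 where 2: "sign_extension s1 s2 h2"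
    "\<And>f. f \<in> F \<Longrightarrow> \<not> s1.pnull (map_poly ?e1 f) \<Longrightarrow> sign_function.div_ivt s2 (map_poly h2 (map_poly ?e1 f))"
    using sign_extension_div_ivt[OF s1, of "map_poly ?e1 ` F"] F by blast
  then have s2: "sign_function s2" and h2: "ring_morphism h2" and s2h2: "\<And>x. s2 (h2 x) = s1 x"
    by (auto simp: sign_extension_def)
  interpret s2: sign_function s2 by (rule s2)
  let ?e = "\<lambda>x. h2 (?e1 x)"
  have e: "ring_morphism ?e" by (rule ring_morphism_comp[OF e1 h2])
  have s2e: "s2 (?e c) = s (shift c)" for c by (simp add: s2h2 s1h1)
  have B: "0 < s2 (?e c * h2 B + ?e k)" if "0 < s2 (?e c)" for c k
  proof -
    have "?e c * h2 B + ?e k = h2 (h1 (shift c) * B + h1 (shift k))"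
      by (simp add: ring_morphismD[OF h2])
    moreover have "0 < s (shift c)" using that by (simp add: s2e)
    ultimately show ?thesis using 1(2) by (simp add: s2h2)
  qed
  have closed:
    "f \<in> F \<Longrightarrow> 0 < degree f \<Longrightarrow> pderiv f \<in> F"
    "f \<in> F \<Longrightarrow> 0 < degree f \<Longrightarrow> drop_lead f \<in> F"
    "f \<in> F \<Longrightarrow> g \<in> F \<Longrightarrow> 0 < degree g \<Longrightarrow> degree g \<le> degree f \<Longrightarrow>
      \<exists>k q. \<exists>r\<in>F. smult (lead_coeff g ^ k) f = g * q + r \<and> degree r < degree g" for f g
  proof -
    show "f \<in> F \<Longrightarrow> 0 < degree f \<Longrightarrow> pderiv f \<in> F" "f \<in> F \<Longrightarrow> 0 < degree f \<Longrightarrow> drop_lead f \<in> F"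
      unfolding F_def by (auto intro: rem_closure.intros)
    assume "f \<in> F" "g \<in> F" "0 < degree g" "degree g \<le> degree f"
    then have "prem f g \<in> F" unfolding F_def by (intro rem_closure.remainder)
    then show "\<exists>k q. \<exists>r\<in>F. smult (lead_coeff g ^ k) f = g * q + r \<and> degree r < degree g"
      using prem_remainder[OF \<open>0 < degree g\<close>, of f] by blast
  qed
  interpret M: sign_model s2 ?e F "h2 B"
  proof unfold_locales
    show "s2.div_ivt (map_poly ?e f)" if "f \<in> F" "s2 (?e (lead_coeff f)) \<noteq> 0" for f
    proof -
      have "\<not> s1.pnull (map_poly ?e1 f)"
        using that(2) by (auto simp: s1.pnull_def coeff_map_poly ring_morphismD[OF e1] s2h2)
      from 2(2)[OF that(1) this] show ?thesis by (simp add: map_poly_comp_morphism[OF e1 h2])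
    qed
    show "0 < s2 (h2 B)"
      using B[of 1 0] by (simp add: ring_morphismD[OF e] s2.s_one)
  qed (use e F closed s2.poly_sign_right[OF e B] s2.poly_sign_left[OF e B] in blast)+
  obtain R where R: "0 < R" "\<And>p x. p \<in> map_poly e0 ` F \<Longrightarrow> R \<le> x \<Longrightarrow> sgn (poly p x) = sgn (lead_coeff p)"
    "\<And>p x. p \<in> map_poly e0 ` F \<Longrightarrow> x \<le> - R \<Longrightarrow> sgn (poly p x) = (-1) ^ degree p * sgn (lead_coeff p)"
    using real_poly_signs_outside[of "map_poly e0 ` F"] F by blast
  have deg: "degree (map_poly e0 f) = degree f" "lead_coeff (map_poly e0 f) = e0 (lead_coeff f)"
    if "sgn (e0 (lead_coeff f)) \<noteq> 0" for f
  proof -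
    have "coeff (map_poly e0 f) (degree f) \<noteq> 0"
      using that by (auto simp: coeff_map_poly ring_morphismD[OF e0(1)])
    then show d: "degree (map_poly e0 f) = degree f"
      by (intro antisym map_poly_degree_leq le_degree)
    show "lead_coeff (map_poly e0 f) = e0 (lead_coeff f)"
      by (simp add: d coeff_map_poly ring_morphismD[OF e0(1)])
  qed
  interpret N: sign_model sgn e0 F R
  proof unfold_locales
    show "sgn (poly (map_poly e0 f) x) = sgn (e0 (lead_coeff f))"
      if "f \<in> F" "sgn (e0 (lead_coeff f)) \<noteq> 0" "0 \<le> sgn (x - R)" for f x
      using R(2)[of "map_poly e0 f" x] that deg[OF that(2)] by auto
    show "sgn (poly (map_poly e0 f) x) = (-1) ^ degree f * sgn (e0 (lead_coeff f))"
      if "f \<in> F" "sgn (e0 (lead_coeff f)) \<noteq> 0" "sgn (x + R) \<le> 0" for f x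
      using R(3)[of "map_poly e0 f" x] that deg[OF that(2)] by auto
  qed (use e0(1) F closed sgn_real_div_ivt R(1) in auto)
  interpret two_models s2 ?e "h2 B" sgn e0 R F
    by unfold_locales (simp add: s2e agree)
  let ?x = "h2 (h1 (var 0))"
  have dense: "\<exists>c. 0 < sgn (c - a) \<and> 0 < sgn (b - c)" if "0 < sgn (b - a)" for a b :: real
    using that dense[of a b] by auto
  have "0 < s2 (h2 B - ?x)"
    using 1(2)[of 1 "- var 0"] by (simp add: s2h2 ring_morphismD[OF h1] s.s_one flip: ring_morphismD(6)[OF h2])
  moreover have "0 < s2 (?x + h2 B)"
    using 1(2)[of 1 "var 0"] by (simp add: s2h2 ring_morphismD[OF h1] s.s_one add.commute flip: ring_morphismD(2)[OF h2])
  ultimately obtain y where y: "\<forall>f\<in>F. M.sg f ?x = N.sg f y"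
    using sign_transfer dense by blast
  define e' where "e' p = poly (map_poly e0 (unshift p)) y" for p
  have "ring_morphism e'"
    unfolding e'_def by (intro ring_morphism_comp[OF ring_morphism_unshift ring_morphism_poly_map_poly[OF e0(1)]])
  moreover have "e' (cst r) = r" for r
    by (simp add: e'_def unshift_cst map_poly_pCons_morphism[OF e0(1)] e0(2))
  moreover have "sgn (e' c) = s c" if "c \<in> C" for c
  proof -
    have "unshift c \<in> F" unfolding F_def using that by (intro rem_closure.base) simp
    then have "sgn (e' c) = s2 (poly (map_poly ?e (unshift c)) ?x)"
      using y by (simp add: M.sg_def N.sg_def e'_def)
    also have "poly (map_poly ?e (unshift c)) ?x = h2 (h1 (poly (map_poly shift (unshift c)) (var 0)))"
      by (simp add: morphism_poly[OF h1] morphism_poly[OF h2] map_poly_comp_morphism[OF ring_morphism_shift h1]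
          map_poly_comp_morphism[OF e1 h2])
    also have "s2 \<dots> = s c" by (simp add: s2h2 s1h1 poly_unshift)
    finally show ?thesis .
  qed
  ultimately show "\<exists>e. ring_morphism e \<and> (\<forall>r. e (cst r) = r) \<and> (\<forall>c\<in>C. sgn (e c) = s c)" by blast
qed

lemma sign_function_cst:
  fixes s :: "poly_omega \<Rightarrow> real"
  assumes "sign_function s"
  shows "s (cst r) = sgn r"
proof -
  interpret sign_function s by fact
  note c = ring_morphismD[OF ring_morphism_cst]
  have pos: "s (cst r) = 1" if "0 < r" for r
  proof -
    \<comment> \<open>Positive constants are squares and units.\<close>
    have "s (cst r) = s (cst (sqrt r)) * s (cst (sqrt r))"
      using that by (simp flip: s_mult c(3))
    moreover have "s (cst r) * s (cst (1 / r)) = 1"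
      using that by (simp add: c(1) s_one flip: s_mult c(3))
    ultimately show ?thesis using s_range[of "cst r"] s_range[of "cst (sqrt r)"] by auto
  qed
  consider "0 < r" | "r = 0" | "0 < - r" by linarith
  then show ?thesis
  proof cases
    case 3
    then show ?thesis using pos[OF 3] by (simp add: c s_minus)
  qed (simp_all add: pos c)
qed

text \<open>
  If all variables from \<open>n\<close> on have sign \<open>0\<close>, then after \<open>n\<close> shifts nothing but the evaluation at the origin is left.
\<close>

lemma artin_lang:
  fixes s :: "poly_omega \<Rightarrow> real"
  assumes "sign_function s" "\<And>i. n \<le> i \<Longrightarrow> s (var i) = 0"
  shows "approximable s"
  using assms
proof (induction n arbitrary: s)
  case 0
  interpret sign_function s by fact
  define e :: "poly_omega \<Rightarrow> real" where "e = insertion (\<lambda>x. x) (\<lambda>_. 0)"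
  have e: "ring_morphism e" unfolding e_def by (rule ring_morphism_insertion[OF ring_morphism_id])
  have ec: "e (cst r) = r" for r unfolding e_def by (rule insertion_cst[OF ring_morphism_id])
  have ev: "e (var i) = 0" for i unfolding e_def by (rule insertion_var[OF ring_morphism_id])
  note c = ring_morphismD[OF ring_morphism_cst] and e' = ring_morphismD[OF e]
  \<comment> \<open>By induction on the generation of p: modulo the support every element is its constant term.\<close>
  have "s (p - cst (e p)) = 0" for p
  proof (induction p rule: mpoly_induct)
    case (add p q)
    have "p + q - cst (e (p + q)) = (p - cst (e p)) + (q - cst (e q))" by (simp add: c e')
    then show ?case by (simp only: s_null_add[OF add.IH(1)] add.IH(2))
  next
    case (mult p q)
    have "p * q - cst (e (p * q)) = (p - cst (e p)) * q + cst (e p) * (q - cst (e q))"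
      by (simp add: c e' algebra_simps)
    moreover have "s ((p - cst (e p)) * q) = 0" "s (cst (e p) * (q - cst (e q))) = 0"
      using mult by (simp_all add: s_mult)
    ultimately show ?case by (simp only: s_null_add)
  qed (use 0 in \<open>auto simp: ec ev c\<close>)
  then have "s p = sgn (e p)" for p
    using s_cong[of p "cst (e p)"] sign_function_cst[OF \<open>sign_function s\<close>] by simp
  then show ?case unfolding approximable_def using e ec by auto
next
  case (Suc n)
  show ?case
  proof (rule approximable_unshift[OF Suc.prems(1) Suc.IH])
    show "sign_function (\<lambda>x. s (shift x))"
      by (rule sign_function_comp[OF Suc.prems(1) ring_morphism_shift])
    show "s (shift (var i)) = 0" if "n \<le> i" for i
      using Suc.prems(2) that by (simp add: shift_var)
  qed
qed

section \<open>The real Nullstellensatz\<close>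

lemma is_ideal_iff:
  "is_ideal J \<longleftrightarrow> 0 \<in> J \<and> (\<forall>x\<in>J. \<forall>y\<in>J. x + y \<in> J) \<and> (\<forall>c. \<forall>x\<in>J. c * x \<in> (J :: 'a::comm_ring_1 set))"
proof -
  have "module ((*) :: 'a \<Rightarrow> 'a \<Rightarrow> 'a)"
    by unfold_locales (auto simp: algebra_simps)
  then show ?thesis unfolding is_ideal_def by (simp add: module.subspace_def)
qed

definition sos :: "'a::comm_ring_1 set" where
  "sos = range (\<lambda>qs. \<Sum>q\<leftarrow>qs. q ^ 2)"

lemma sos_zero: "0 \<in> sos"
  unfolding sos_def by (rule image_eqI[of _ _ "[]"]) auto

lemma sos_square: "x ^ 2 \<in> sos"
  unfolding sos_def by (rule image_eqI[of _ _ "[x]"]) auto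

lemma sos_add: "p \<in> sos \<Longrightarrow> q \<in> sos \<Longrightarrow> p + q \<in> sos"
  unfolding sos_def
proof (clarify)
  fix qs rs :: "'a list"
  show "(\<Sum>q\<leftarrow>qs. q ^ 2) + (\<Sum>q\<leftarrow>rs. q ^ 2) \<in> range (\<lambda>qs. \<Sum>q\<leftarrow>qs. q ^ 2)"
    by (rule image_eqI[of _ _ "qs @ rs"]) auto
qed

lemma sos_square_mult: "p \<in> sos \<Longrightarrow> x ^ 2 * p \<in> sos"
  unfolding sos_def
proof (clarify)
  fix qs :: "'a list"
  show "x ^ 2 * (\<Sum>q\<leftarrow>qs. q ^ 2) \<in> range (\<lambda>qs. \<Sum>q\<leftarrow>qs. q ^ 2)"
    by (rule image_eqI[of _ _ "map (\<lambda>q. x * q) qs"]) (auto simp: sum_list_const_mult power_mult_distrib o_def)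
qed

lemma sos_mult:
  assumes "p \<in> sos" "q \<in> sos"
  shows "p * q \<in> sos"
proof -
  obtain qs where "q = (\<Sum>x\<leftarrow>qs. x ^ 2)" using assms(2) by (auto simp: sos_def)
  moreover have "p * (\<Sum>x\<leftarrow>qs. x ^ 2) \<in> sos"
  proof (induction qs)
    case (Cons x qs)
    then show ?case using sos_add[OF sos_square_mult[OF assms(1), of x]] by (simp add: distrib_left mult.commute)
  qed (simp add: sos_zero)
  ultimately show ?thesis by simp
qed

text \<open>
  The hypothesis on \<open>p\<close> says that the preordering of sums of squares modulo \<open>K\<close> contains no element \<open>- p\<^sup>2\<^sup>k\<close>. So there is a
  sign function that is \<open>0\<close> on \<open>K\<close> and not at \<open>p\<close>, and it is enough to realise its values on \<open>H\<close> and \<open>p\<close>.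
\<close>

theorem real_zero_off_hypersurface:
  fixes K :: "'n::finite mpoly set" and p :: "'n mpoly"
  assumes K: "is_ideal K" and H: "finite H" "H \<subseteq> K"
    and p: "\<And>k q. q \<in> sos \<Longrightarrow> p ^ (2 * k) + q \<notin> K"
  shows "\<exists>v. (\<forall>h\<in>H. insertion (\<lambda>x. x) v h = 0) \<and> insertion (\<lambda>x. x) v p \<noteq> (0::real)"
proof -
  obtain b :: "nat \<Rightarrow> 'n" and n where b: "bij_betw b {..<n} UNIV"
    using ex_bij_betw_nat_finite[of "UNIV :: 'n set"] by (auto simp: atLeast0LessThan)
  let ?inv = "inv_into {..<n} b"
  have inv: "?inv j < n" "b (?inv j) = j" for j
    using b inv_into_into[of j b "{..<n}"] f_inv_into_f[of j b "{..<n}"] by (auto simp: bij_betw_def)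
  \<comment> \<open>The first n variables are mapped to the given ones, the others to 0; \<sigma> is a section.\<close>
  define \<pi> :: "poly_omega \<Rightarrow> 'n mpoly" where "\<pi> = insertion cst (\<lambda>i. if i < n then var (b i) else 0)"
  define \<sigma> :: "'n mpoly \<Rightarrow> poly_omega" where "\<sigma> = insertion cst (\<lambda>j. var (?inv j))"
  have \<pi>: "ring_morphism \<pi>" unfolding \<pi>_def by (rule ring_morphism_insertion[OF ring_morphism_cst])
  have \<sigma>: "ring_morphism \<sigma>" unfolding \<sigma>_def by (rule ring_morphism_insertion[OF ring_morphism_cst])
  note \<pi>' = ring_morphismD[OF \<pi>]
  have \<pi>\<sigma>: "\<pi> (\<sigma> f) = f" for f
    by (rule morphism_eqI[OF ring_morphism_comp[OF \<sigma> \<pi>] ring_morphism_id])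
      (simp_all add: \<pi>_def \<sigma>_def insertion_cst[OF ring_morphism_cst] insertion_var[OF ring_morphism_cst] inv)
  have \<pi>_var: "\<pi> (var i) = 0" if "n \<le> i" for i
    using that by (simp add: \<pi>_def insertion_var[OF ring_morphism_cst])
  have K0: "0 \<in> K" and Kadd: "\<And>x y. x \<in> K \<Longrightarrow> y \<in> K \<Longrightarrow> x + y \<in> K" and Kmult: "\<And>c x. x \<in> K \<Longrightarrow> c * x \<in> K"
    using K by (auto simp: is_ideal_iff)
  have Kminus: "- x \<in> K" if "x \<in> K" for x using Kmult[OF that, of "- 1"] by simp
  define T where "T = {t. \<exists>q\<in>sos. \<pi> t - q \<in> K}"
  define M where "M = range (\<lambda>k. \<sigma> p ^ (2 * k))"
  have TI: "t \<in> T" if "q \<in> sos" "\<pi> t - q \<in> K" for t q using that by (auto simp: T_def)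
  have null_T: "t \<in> T" if "\<pi> t \<in> K" for t using that by (intro TI[OF sos_zero]) simp
  have "\<exists>s. sign_function s \<and> (\<forall>t\<in>T. 0 \<le> s t) \<and> (\<forall>m\<in>M. s m = 1)"
  proof (rule preordering_extends_to_sign_function)
    show "preordering T"
      unfolding preordering_def
    proof (intro conjI ballI allI)
      fix x y assume "x \<in> T" "y \<in> T"
      then obtain q r where *: "q \<in> sos" "\<pi> x - q \<in> K" "r \<in> sos" "\<pi> y - r \<in> K" by (auto simp: T_def)
      show "x + y \<in> T"
        by (rule TI[OF sos_add[OF *(1,3)]]) (use Kadd[OF *(2,4)] in \<open>simp add: \<pi>' algebra_simps\<close>)
      show "x * y \<in> T"
        by (rule TI[OF sos_mult[OF *(1,3)]])
          (use Kadd[OF Kmult[OF *(2), of "\<pi> y"] Kmult[OF *(4), of q]] in \<open>simp add: \<pi>' algebra_simps\<close>)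
    next
      fix x show "x * x \<in> T"
        by (rule TI[OF sos_square[of "\<pi> x"]]) (simp add: \<pi>' power2_eq_square K0)
    qed
    have \<pi>p: "\<pi> (\<sigma> p ^ (2 * k)) = p ^ (2 * k)" for k
      by (simp add: ring_morphism_power[OF \<pi>] \<pi>\<sigma>)
    show "T \<inter> uminus ` M = {}"
    proof (rule ccontr)
      assume "\<not> ?thesis"
      then obtain k q where q: "q \<in> sos" "\<pi> (- (\<sigma> p ^ (2 * k))) - q \<in> K" by (auto simp: T_def M_def)
      from Kminus[OF q(2)] have "p ^ (2 * k) + q \<in> K" by (simp add: \<pi>' \<pi>p add.commute)
      with p[OF q(1)] show False by blast
    qed
    show "M \<subseteq> T"
    proof
      fix m assume "m \<in> M"
      then obtain k where "m = \<sigma> p ^ (2 * k)" by (auto simp: M_def)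
      then show "m \<in> T" using \<pi>p[of k] K0
        by (intro TI[OF sos_square[of "p ^ k"]]) (simp add: power_mult power2_eq_square flip: power_add mult_2 mult_2_right)
    qed
    show "1 \<in> M" unfolding M_def by (rule image_eqI[of _ _ 0]) auto
    show "x * y \<in> M" if "x \<in> M" "y \<in> M" for x y
    proof -
      from that obtain k l where "x = \<sigma> p ^ (2 * k)" "y = \<sigma> p ^ (2 * l)" by (auto simp: M_def)
      then have "x * y = \<sigma> p ^ (2 * (k + l))" by (simp add: power_add distrib_left)
      then show ?thesis unfolding M_def by (rule range_eqI)
    qed
  qed
  then obtain s where s: "sign_function s" "\<And>t. t \<in> T \<Longrightarrow> 0 \<le> s t" "\<And>m. m \<in> M \<Longrightarrow> s m = 1" by blast
  interpret sign_function s by (rule s(1))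
  have null: "s t = 0" if "\<pi> t \<in> K" for t
  proof -
    have "\<pi> (- t) \<in> K" using Kminus[OF that] by (simp add: \<pi>')
    then show ?thesis using s(2)[OF null_T[OF that]] s(2)[OF null_T] s_minus[of t] by fastforce
  qed
  have "s (\<sigma> p ^ (2 * 1)) = 1" by (intro s(3)[unfolded M_def] rangeI)
  then have sp: "s (\<sigma> p) \<noteq> 0" by (auto simp: s_power)
  have "approximable s"
    by (rule artin_lang[OF s(1), of n]) (simp add: null \<pi>_var K0)
  then obtain e where e: "ring_morphism e" "\<And>r. e (cst r) = r" "\<forall>c\<in>insert (\<sigma> p) (\<sigma> ` H). sgn (e c) = s c"
    unfolding approximable_def using H(1) by (metis finite_imageI finite_insert)
  define v where "v j = e (\<sigma> (var j))" for j
  have ev: "insertion (\<lambda>x. x) v f = e (\<sigma> f)" for f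
  proof (rule morphism_eqI[OF ring_morphism_insertion[OF ring_morphism_id] ring_morphism_comp[OF \<sigma> e(1)]])
    show "insertion (\<lambda>x. x) v (cst r) = e (\<sigma> (cst r))" for r
      by (simp add: insertion_cst[OF ring_morphism_id] \<sigma>_def insertion_cst[OF ring_morphism_cst] e(2))
    show "insertion (\<lambda>x. x) v (var i) = e (\<sigma> (var i))" for i
      by (simp add: insertion_var[OF ring_morphism_id] v_def)
  qed
  have "e (\<sigma> h) = 0" if "h \<in> H" for h
  proof -
    have "sgn (e (\<sigma> h)) = 0" using e(3) that null[of "\<sigma> h"] H(2) by (auto simp: \<pi>\<sigma>)
    then show ?thesis by (simp add: sgn_zero_iff)
  qed
  moreover have "e (\<sigma> p) \<noteq> 0" using e(3) sp by auto
  ultimately show ?thesis by (intro exI[of _ v]) (simp add: ev)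
qed

section \<open>The moment functional and its kernel\<close>

text \<open>
  The linear functional with prescribed values on the monomials; for \<open>f = y\<close> this is the Riesz functional of the
  moment sequence.
\<close>

definition lin :: "('k \<Rightarrow> real) \<Rightarrow> ('k \<Rightarrow>\<^sub>0 real) \<Rightarrow> real" where
  "lin f p = (\<Sum>k\<in>Poly_Mapping.keys p. f k * Poly_Mapping.lookup p k)"

lemma lin_superset:
  "finite A \<Longrightarrow> Poly_Mapping.keys p \<subseteq> A \<Longrightarrow> lin f p = (\<Sum>k\<in>A. f k * Poly_Mapping.lookup p k)"
  unfolding lin_def by (rule sum.mono_neutral_left) (auto simp: in_keys_iff)

lemma lin_add: "lin f (p + q) = lin f p + lin f q"
proof -
  let ?A = "Poly_Mapping.keys p \<union> Poly_Mapping.keys q"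
  have "Poly_Mapping.keys (p + q) \<subseteq> ?A" by (rule Poly_Mapping.keys_add)
  then show ?thesis
    by (simp add: lin_superset[of ?A] lookup_add distrib_left sum.distrib)
qed

lemma lin_zero: "lin f 0 = 0"
  by (simp add: lin_def)

lemma lin_single: "lin f (Poly_Mapping.single k r) = f k * r"
  by (subst lin_superset[of "{k}"]) auto

lemma lin_cst_mult: "lin f (cst r * p) = r * lin f p"
proof (induction p rule: update_induct)
  case (update p a b)
  then show ?case
    by (simp add: update_eq_add_single distrib_left lin_add lin_single cst_def mult_single mult_ac)
qed (simp add: lin_zero)

lemma mat_vec_eq_lin: "mat_vec (moment_matrix y) p \<alpha> = lin y (Poly_Mapping.single \<alpha> 1 * p)"
proof -
  have "lin (\<lambda>\<beta>. y (\<alpha> + \<beta>)) p = lin y (Poly_Mapping.single \<alpha> 1 * p)"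
  proof (induction p rule: update_induct)
    case (update p a b)
    then show ?case
      by (simp add: update_eq_add_single distrib_left lin_add lin_single mult_single)
  qed (simp add: lin_zero)
  then show ?thesis by (simp add: mat_vec_def moment_matrix_def lin_def)
qed

lemma lin_monomial_products:
  fixes p q :: "'i mpoly"
  shows "lin (\<lambda>\<alpha>. lin y (Poly_Mapping.single \<alpha> 1 * q)) p = lin y (p * q)"
proof (induction p rule: update_induct)
  case (update p a b)
  have "Poly_Mapping.single a b * q = cst b * (Poly_Mapping.single a 1 * q)"
    by (simp add: cst_def mult_single flip: mult.assoc)
  with update show ?case
    by (simp add: update_eq_add_single distrib_right lin_add lin_single lin_cst_mult)
qed (simp add: lin_zero)

lemma psd_iff: "psd (moment_matrix y) \<longleftrightarrow> (\<forall>p. 0 \<le> lin y (p * p))"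
proof -
  have "(\<Sum>\<alpha>\<in>Poly_Mapping.keys p. Poly_Mapping.lookup p \<alpha> * mat_vec (moment_matrix y) p \<alpha>) = lin y (p * p)" for p
    using lin_monomial_products[of y p p] by (simp add: mat_vec_eq_lin lin_def[of "\<lambda>\<alpha>. _ \<alpha>"] mult.commute)
  then show ?thesis by (simp add: psd_def)
qed

lemma mat_kernel_iff: "p \<in> mat_kernel (moment_matrix y) \<longleftrightarrow> (\<forall>q. lin y (q * p) = 0)"
proof -
  have "p \<in> mat_kernel (moment_matrix y) \<longleftrightarrow> (\<forall>\<alpha>. lin y (Poly_Mapping.single \<alpha> 1 * p) = 0)"
    by (simp add: mat_kernel_def fun_eq_iff mat_vec_eq_lin)
  moreover have "lin y (q * p) = 0" if "\<forall>\<alpha>. lin y (Poly_Mapping.single \<alpha> 1 * p) = 0" for q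
    using lin_monomial_products[of y p q] that by (simp add: lin_def[of "\<lambda>_. 0"])
  ultimately show ?thesis by blast
qed

lemma moment_feasible_iff:
  "moment_feasible m h y \<longleftrightarrow> (\<forall>p. 0 \<le> lin y (p * p)) \<and> h ` {1..m} \<subseteq> mat_kernel (moment_matrix y)"
proof -
  have "moment_matrix (shifted_seq p y) = 0 \<longleftrightarrow> p \<in> mat_kernel (moment_matrix y)" for p
  proof -
    have "moment_matrix (shifted_seq p y) = 0 \<longleftrightarrow> (\<forall>\<alpha> \<beta>. shifted_seq p y (\<alpha> + \<beta>) = 0)"
      by (simp add: moment_matrix_def fun_eq_iff)
    also have "\<dots> \<longleftrightarrow> (\<forall>\<alpha>. shifted_seq p y \<alpha> = 0)" by (metis add.right_neutral)
    finally show ?thesis by (simp add: shifted_seq_def mat_kernel_def fun_eq_iff)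
  qed
  then show ?thesis by (auto simp: moment_feasible_def psd_iff)
qed

lemma is_ideal_mat_kernel: "is_ideal (mat_kernel (moment_matrix y))"
proof -
  have "c * x \<in> mat_kernel (moment_matrix y)" if "x \<in> mat_kernel (moment_matrix y)" for c x
    unfolding mat_kernel_iff
  proof
    fix q
    have "lin y ((q * c) * x) = 0" using that unfolding mat_kernel_iff by blast
    then show "lin y (q * (c * x)) = 0" by (simp only: mult.assoc)
  qed
  then show ?thesis
    unfolding is_ideal_iff by (auto simp: mat_kernel_iff distrib_left lin_add lin_zero)
qed

text \<open>
  If \<open>L (p p) = 0\<close>, then \<open>t \<mapsto> L ((t p + q)\<^sup>2)\<close> is an affine function of \<open>t\<close> that is nowhere negative, so its slope
  \<open>2 L (q p)\<close> is \<open>0\<close>.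
\<close>

lemma mat_kernel_if_square_null:
  assumes pos: "\<And>p. 0 \<le> lin y (p * p)" and p: "lin y (p * p) = 0"
  shows "p \<in> mat_kernel (moment_matrix y)"
  unfolding mat_kernel_iff
proof (intro allI, rule ccontr)
  fix q assume nz: "lin y (q * p) \<noteq> 0"
  define b c where "b = lin y (q * p)" and "c = lin y (q * q)"
  have "0 \<le> 2 * t * b + c" for t
  proof -
    have eq: "(cst t * p + q) * (cst t * p + q) =
        cst (t * t) * (p * p) + cst t * (q * p) + cst t * (q * p) + q * q"
      by (simp add: algebra_simps ring_morphismD(3)[OF ring_morphism_cst])
    have "0 \<le> lin y (cst (t * t) * (p * p) + cst t * (q * p) + cst t * (q * p) + q * q)"
      unfolding eq[symmetric] by (rule pos)
    then show ?thesis by (simp only: lin_add lin_cst_mult p) (simp add: b_def c_def)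
  qed
  moreover have "2 * (- (c + 1) / (2 * b)) * b = - (c + 1)" using nz by (simp add: b_def divide_simps)
  ultimately show False by (smt (verit))
qed

lemma lin_sos_nonneg:
  assumes pos: "\<And>p. 0 \<le> lin y (p * p)" and "q \<in> sos"
  shows "0 \<le> lin y q"
proof -
  obtain qs where "q = (\<Sum>x\<leftarrow>qs. x ^ 2)" using assms(2) by (auto simp: sos_def)
  moreover have "0 \<le> lin y (\<Sum>x\<leftarrow>qs. x ^ 2)"
    by (induction qs) (auto simp: lin_zero lin_add pos power2_eq_square)
  ultimately show ?thesis by simp
qed

text \<open>
  Applying \<open>L\<close> shows that \<open>p\<^sup>k\<close> has square norm \<open>0\<close>, hence lies in the kernel. From there the exponent is lowered: with
  \<open>l = \<lceil>k / 2\<rceil>\<close> the square of \<open>p\<^sup>l\<close> is a multiple of \<open>p\<^sup>k\<close>.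
\<close>

lemma mat_kernel_real_radical:
  assumes pos: "\<And>p. 0 \<le> lin y (p * p)" and k: "1 \<le> k" and q: "q \<in> sos"
    and mem: "p ^ (2 * k) + q \<in> mat_kernel (moment_matrix y)"
  shows "p \<in> mat_kernel (moment_matrix y)"
proof -
  let ?K = "mat_kernel (moment_matrix y)"
  have mult: "c * x \<in> ?K" if "x \<in> ?K" for c x
    using is_ideal_mat_kernel[of y] that by (simp add: is_ideal_iff)
  have square: "x \<in> ?K" if "x * x \<in> ?K" for x
    using mat_kernel_if_square_null[OF pos, of x] that unfolding mat_kernel_iff[of "x * x"] by (metis mult_1)
  have "lin y (p ^ (2 * k) + q) = 0" using mem unfolding mat_kernel_iff by (metis mult_1)
  moreover have "p ^ (2 * k) = p ^ k * p ^ k" by (simp add: mult_2 power_add)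
  ultimately have "lin y (p ^ k * p ^ k) = 0"
    using lin_sos_nonneg[OF pos q] pos[of "p ^ k"] by (simp add: lin_add)
  then have "p ^ k \<in> ?K" by (rule mat_kernel_if_square_null[OF pos])
  then show ?thesis
    using k
  proof (induction k rule: less_induct)
    case (less k)
    show ?case
    proof (cases "k = 1")
      case False
      define l where "l = (k + 1) div 2"
      have l: "l < k" "1 \<le> l" "2 * l = k + (2 * l - k)" using less.prems False by (auto simp: l_def)
      have "p ^ l * p ^ l = p ^ (2 * l - k) * p ^ k"
        using l(3) by (metis add.commute mult_2 power_add)
      then have "p ^ l * p ^ l \<in> ?K" using mult[OF less.prems(1)] by metis
      then have "p ^ l \<in> ?K" by (rule square)
      with less.IH l show ?thesis by blast
    qed (use less.prems in simp)
  qed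
qed

lemma is_real_radical_ideal_mat_kernel:
  assumes pos: "\<And>p. 0 \<le> lin y (p * p)"
  shows "is_real_radical_ideal (mat_kernel (moment_matrix y))"
proof -
  let ?K = "mat_kernel (moment_matrix y)"
  have "p \<in> real_radical ?K" if "p \<in> ?K" for p
  proof -
    have "p ^ (2 * 1) + (\<Sum>q\<leftarrow>[]. q ^ 2) \<in> ?K"
      using is_ideal_mat_kernel[of y] that by (simp add: is_ideal_iff power2_eq_square)
    then show ?thesis unfolding real_radical_def by blast
  qed
  moreover have "p \<in> ?K" if "p \<in> real_radical ?K" for p
  proof -
    from that obtain k qs where "1 \<le> k" "p ^ (2 * k) + (\<Sum>q\<leftarrow>qs. q ^ 2) \<in> ?K"
      by (auto simp: real_radical_def)
    moreover have "(\<Sum>q\<leftarrow>qs. q ^ 2) \<in> sos" unfolding sos_def by (rule rangeI)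
    ultimately show ?thesis using mat_kernel_real_radical[OF pos] by blast
  qed
  ultimately show ?thesis
    using is_ideal_mat_kernel by (auto simp: is_real_radical_ideal_def)
qed

section \<open>Real zeros and interpolation\<close>

abbreviation ev :: "('i \<Rightarrow> real) \<Rightarrow> 'i mpoly \<Rightarrow> real" where
  "ev \<equiv> insertion (\<lambda>x. x)"

lemmas ring_morphism_ev = ring_morphism_insertion[OF ring_morphism_id]
lemmas ev_simps = ring_morphismD[OF ring_morphism_ev] insertion_cst[OF ring_morphism_id] insertion_var[OF ring_morphism_id]

definition real_point :: "('n \<Rightarrow> real) \<Rightarrow> complex ^ 'n::finite" where
  "real_point a = (\<chi> i. complex_of_real (a i))"

lemma peval_real_point: "peval p (real_point a) = of_real (ev a p)"
proof -
  have "mono_value a \<alpha> = (\<Prod>i\<in>UNIV. a i ^ Poly_Mapping.lookup \<alpha> i)" for \<alpha>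
    by (rule mono_value_superset) auto
  then show ?thesis by (simp add: peval_def insertion_def real_point_def)
qed

lemma inj_real_point: "inj real_point"
  by (rule injI) (simp add: real_point_def vec_eq_iff fun_eq_iff)

lemma real_variety_eq: "real_variety I = real_point ` {a. \<forall>f\<in>I. ev a f = 0}"
proof (intro equalityI subsetI)
  fix v assume v: "v \<in> real_variety I"
  then have "v = real_point (\<lambda>i. Re (v $ i))"
    by (auto simp: real_variety_def real_point_def vec_eq_iff)
  moreover from this have "\<forall>f\<in>I. ev (\<lambda>i. Re (v $ i)) f = 0"
    using v peval_real_point[of _ "\<lambda>i. Re (v $ i)"] by (auto simp: real_variety_def complex_variety_def)
  ultimately show "v \<in> real_point ` {a. \<forall>f\<in>I. ev a f = 0}" by blast
next
  fix v assume "v \<in> real_point ` {a. \<forall>f\<in>I. ev a f = 0}"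
  then show "v \<in> real_variety I"
    by (auto simp: real_variety_def complex_variety_def peval_real_point) (simp add: real_point_def)
qed

lemma zeros_ideal_generated_by:
  "(\<forall>f\<in>ideal_generated_by H. ev a f = 0) \<longleftrightarrow> (\<forall>f\<in>H. ev a f = 0)"
proof -
  interpret module "(*) :: 'a mpoly \<Rightarrow> 'a mpoly \<Rightarrow> 'a mpoly"
    by unfold_locales (auto simp: algebra_simps)
  have "subspace {f. ev a f = 0}"
    by (auto simp: subspace_def ev_simps)
  then show ?thesis
    unfolding ideal_generated_by_def using span_minimal[of H "{f. ev a f = 0}"] span_superset[of H] by blast
qed

text \<open>
  The real Nullstellensatz, applied to the kernel: a polynomial outside the kernel fails to vanish at some real
  common zero of the generators of \<open>I\<close>.
\<close>

lemma vanishing_ideal_subset_mat_kernel: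
  fixes h :: "nat \<Rightarrow> 'n::finite mpoly"
  assumes y: "moment_feasible m h y" and I: "I = ideal_generated_by (h ` {1..m})"
  shows "vanishing_ideal (real_variety I) \<subseteq> mat_kernel (moment_matrix y)"
proof (rule subsetI, rule ccontr)
  let ?K = "mat_kernel (moment_matrix y)"
  fix p assume p: "p \<in> vanishing_ideal (real_variety I)" and np: "p \<notin> ?K"
  have pos: "\<And>p. 0 \<le> lin y (p * p)" and hK: "h ` {1..m} \<subseteq> ?K"
    using y by (auto simp: moment_feasible_iff)
  have "p ^ (2 * k) + q \<notin> ?K" if q: "q \<in> sos" for k q
  proof
    assume mem: "p ^ (2 * k) + q \<in> ?K"
    \<comment> \<open>For k = 0 the radical property does not apply directly; multiplying by the square of p
      makes the exponent positive.\<close>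
    then have "p ^ 2 * (p ^ (2 * k) + q) \<in> ?K" using is_ideal_mat_kernel[of y] by (simp add: is_ideal_iff)
    also have "p ^ 2 * (p ^ (2 * k) + q) = p ^ (2 * Suc k) + p ^ 2 * q"
      by (simp add: distrib_left power2_eq_square mult.assoc)
    finally show False
      using np mat_kernel_real_radical[OF pos, of "Suc k" "p ^ 2 * q" p] sos_square_mult[OF q] by simp
  qed
  then obtain a where a: "\<forall>f\<in>h ` {1..m}. ev a f = 0" "ev a p \<noteq> 0"
    using real_zero_off_hypersurface[OF is_ideal_mat_kernel _ hK] by blast
  then have "real_point a \<in> real_variety I"
    using zeros_ideal_generated_by[of "h ` {1..m}" a] by (auto simp: real_variety_eq I)
  then have "peval p (real_point a) = 0" using p by (simp add: vanishing_ideal_def)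
  with a(2) show False by (simp add: peval_real_point)
qed

text \<open>
  Products of normalised linear forms that separate two points.
\<close>

lemma lagrange_polynomials:
  fixes A :: "('n \<Rightarrow> real) set"
  assumes "finite A"
  shows "\<exists>l. \<forall>a\<in>A. \<forall>b\<in>A. ev b (l a) = (if b = a then 1 else 0)"
proof -
  define q where "q a b = (SOME q. ev a q = 1 \<and> ev b q = 0)" for a b :: "'n \<Rightarrow> real"
  have "\<exists>q. ev a q = 1 \<and> ev b q = 0" if ab: "a \<noteq> b" for a b :: "'n \<Rightarrow> real"
  proof -
    obtain i where "a i \<noteq> b i" using ab by blast
    then show ?thesis by (intro exI[of _ "cst (1 / (a i - b i)) * (var i - cst (b i))"]) (simp add: ev_simps)
  qed
  then have q: "a \<noteq> b \<Longrightarrow> ev a (q a b) = 1 \<and> ev b (q a b) = 0" for a b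
    unfolding q_def by (rule someI_ex)
  have prod: "ev c (\<Prod>b\<in>B. q a b) = (\<Prod>b\<in>B. ev c (q a b))" for a c B
    by (induction B rule: infinite_finite_induct) (auto simp: ev_simps)
  show ?thesis
  proof (intro exI[of _ "\<lambda>a. \<Prod>b\<in>A - {a}. q a b"] ballI)
    fix a b assume "a \<in> A" "b \<in> A"
    show "ev b (\<Prod>b\<in>A - {a}. q a b) = (if b = a then 1 else 0)"
    proof (cases "b = a")
      case True
      have "ev a (q a x) = 1" if "x \<in> A - {a}" for x using q[of a x] that by auto
      then show ?thesis using True by (simp add: prod)
    next
      case False
      then have "b \<in> A - {a}" "ev b (q a b) = 0" using \<open>b \<in> A\<close> q[of a b] by auto
      then show ?thesis using False assms by (auto simp: prod)
    qed
  qed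
qed

section \<open>Rank of the moment matrix\<close>

lemma mat_vec_sum: "mat_vec (moment_matrix y) (\<Sum>a\<in>A. cst (c a) * l a) = (\<Sum>a\<in>A. (\<lambda>\<alpha>. c a * mat_vec (moment_matrix y) (l a) \<alpha>))"
proof (induction A rule: infinite_finite_induct)
  case (insert a A)
  have "mat_vec (moment_matrix y) (cst r * p + q) = (\<lambda>\<alpha>. r * mat_vec (moment_matrix y) p \<alpha>) + mat_vec (moment_matrix y) q" for r p q
    by (simp add: fun_eq_iff mat_vec_eq_lin distrib_left lin_add mult.left_commute lin_cst_mult)
  with insert show ?case by simp
qed (simp_all add: fun_eq_iff mat_vec_eq_lin lin_zero)

lemma mat_vec_eq_iff:
  "mat_vec (moment_matrix y) p = mat_vec (moment_matrix y) q \<longleftrightarrow> p - q \<in> mat_kernel (moment_matrix y)"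
proof -
  have "mat_vec (moment_matrix y) p = mat_vec (moment_matrix y) (p - q) + mat_vec (moment_matrix y) q"
    by (simp add: fun_eq_iff mat_vec_eq_lin flip: lin_add distrib_left)
  then show ?thesis by (auto simp: mat_kernel_def)
qed

lemma sum_fun_apply: "(\<Sum>a\<in>A. f a) x = (\<Sum>a\<in>A. f a x)"
  by (induction A rule: infinite_finite_induct) auto

lemma mat_vec_in_span_columns:
  "mat_vec M p \<in> fun_space.span (range (\<lambda>\<beta> \<alpha>. M \<alpha> \<beta>))"
proof -
  have "mat_vec M p = (\<Sum>\<beta>\<in>Poly_Mapping.keys p. (\<lambda>\<alpha>. Poly_Mapping.lookup p \<beta> * M \<alpha> \<beta>))"
    by (simp add: fun_eq_iff mat_vec_def sum_fun_apply mult.commute)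
  also have "\<dots> \<in> fun_space.span (range (\<lambda>\<beta> \<alpha>. M \<alpha> \<beta>))"
    by (intro fun_space.span_sum fun_space.span_scale fun_space.span_base) auto
  finally show ?thesis .
qed

text \<open>
  With the Lagrange polynomials \<open>l a\<close>, the map from polynomials to columns satisfies \<open>\<Phi> p = \<Sum>a. p(a) \<Phi> (l a)\<close> because its
  kernel contains the polynomials vanishing on \<open>A\<close>. The \<open>card A\<close> vectors \<open>\<Phi> (l a)\<close> thus span the column space. The rank
  is \<open>card A\<close> iff they are distinct and independent, and then \<open>\<Phi> p = 0\<close> only if \<open>p\<close> vanishes on \<open>A\<close>.
\<close>

lemma mat_rank_via_interpolation:
  fixes A :: "('n \<Rightarrow> real) set"
  assumes A: "finite A" and AK: "{p. \<forall>a\<in>A. ev a p = 0} \<subseteq> mat_kernel (moment_matrix y)"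
  shows "mat_rank (moment_matrix y) \<le> enat (card A)"
    and "mat_rank (moment_matrix y) = enat (card A) \<longleftrightarrow> {p. \<forall>a\<in>A. ev a p = 0} = mat_kernel (moment_matrix y)"
proof -
  let ?M = "moment_matrix y" and ?Z = "{p. \<forall>a\<in>A. ev a p = 0}"
  let ?\<Phi> = "mat_vec ?M" and ?C = "range (\<lambda>\<beta> \<alpha>. moment_matrix y \<alpha> \<beta>)"
  obtain l where l: "\<And>a b. a \<in> A \<Longrightarrow> b \<in> A \<Longrightarrow> ev b (l a) = (if b = a then 1 else 0)"
    using lagrange_polynomials[OF A] by blast
  have ev_sum: "ev b (\<Sum>a\<in>A. cst (c a) * l a) = c b" if "b \<in> A" for b c
  proof -
    have "ev b (\<Sum>a\<in>A. cst (c a) * l a) = (\<Sum>a\<in>A. c a * ev b (l a))"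
      by (simp add: ring_morphism_sum[OF ring_morphism_ev] ev_simps)
    also have "\<dots> = (\<Sum>a\<in>A. if a = b then c a else 0)" using l that by (intro sum.cong) auto
    finally show ?thesis using A that by simp
  qed
  have \<Phi>: "?\<Phi> p = (\<Sum>a\<in>A. (\<lambda>\<alpha>. ev a p * ?\<Phi> (l a) \<alpha>))" for p
  proof -
    have "p - (\<Sum>a\<in>A. cst (ev a p) * l a) \<in> ?Z" by (simp add: ev_simps ev_sum)
    then have "?\<Phi> p = ?\<Phi> (\<Sum>a\<in>A. cst (ev a p) * l a)" using AK by (auto simp: mat_vec_eq_iff)
    then show ?thesis by (simp only: mat_vec_sum)
  qed
  let ?B = "(\<lambda>a. ?\<Phi> (l a)) ` A"
  have CB: "?C \<subseteq> fun_space.span ?B"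
  proof
    fix f assume "f \<in> ?C"
    then obtain \<beta> where "f = (\<lambda>\<alpha>. ?M \<alpha> \<beta>)" by blast
    also have "\<dots> = ?\<Phi> (Poly_Mapping.single \<beta> 1)" by (simp add: mat_vec_def)
    also have "\<dots> \<in> fun_space.span ?B"
      by (subst \<Phi>) (intro fun_space.span_sum fun_space.span_scale fun_space.span_base imageI)
    finally show "f \<in> fun_space.span ?B" .
  qed
  have BC: "?B \<subseteq> fun_space.span ?C" using mat_vec_in_span_columns by blast
  have finB: "finite ?B" using A by simp
  have rank: "mat_rank ?M = enat (fun_space.dim ?C)"
    unfolding mat_rank_def Let_def using CB finB by auto
  have dimBC: "fun_space.dim ?C = fun_space.dim ?B"
  proof -
    have "fun_space.span ?C = fun_space.span ?B"
      using CB BC by (intro equalityI fun_space.span_minimal fun_space.subspace_span)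
    then show ?thesis by (metis fun_space.dim_span)
  qed
  have dimB: "fun_space.dim ?B \<le> card ?B"
    by (rule fun_space.dim_le_card[OF fun_space.span_superset finB])
  have cardB: "card ?B \<le> card A" by (rule card_image_le[OF A])
  show "mat_rank ?M \<le> enat (card A)" using rank dimBC dimB cardB by simp
  have "fun_space.dim ?B = card A \<longleftrightarrow> ?Z = mat_kernel ?M"
  proof
    assume d: "fun_space.dim ?B = card A"
    then have "card ?B = card A" using dimB cardB by simp
    then have inj: "inj_on (\<lambda>a. ?\<Phi> (l a)) A" by (rule eq_card_imp_inj_on[OF A])
    \<comment> \<open>A dependent spanning set of card A vectors could be shortened, contradicting the dimension.\<close>
    have ind: "fun_space.independent ?B"
    proof
      assume "fun_space.dependent ?B"
      then obtain b where b: "b \<in> ?B" "b \<in> fun_space.span (?B - {b})" unfolding fun_space.dependent_def by blast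
      then have "f \<in> fun_space.span (?B - {b})" if "f \<in> ?B" for f
        using that by (cases "f = b") (simp_all add: fun_space.span_base)
      then have "?B \<subseteq> fun_space.span (?B - {b})" by (rule subsetI)
      then have "fun_space.dim ?B \<le> card (?B - {b})" using finB by (intro fun_space.dim_le_card) auto
      also have "\<dots> < card ?B" using b(1) finB by (rule card_Diff1_less[rotated])
      finally show False using d cardB by simp
    qed
    have "ev a p = 0" if p: "p \<in> mat_kernel ?M" and a: "a \<in> A" for p a
    proof -
      let ?u = "\<lambda>f. ev (inv_into A (\<lambda>a. ?\<Phi> (l a)) f) p"
      have "(\<Sum>f\<in>?B. (\<lambda>\<alpha>. ?u f * f \<alpha>)) = (\<Sum>a\<in>A. (\<lambda>\<alpha>. ev a p * ?\<Phi> (l a) \<alpha>))"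
        by (subst sum.reindex[OF inj]) (simp add: inv_into_f_f[OF inj])
      also have "\<dots> = 0" using p \<Phi>[of p] by (simp add: mat_kernel_def)
      finally have "?u (?\<Phi> (l a)) = 0"
        using a by (intro fun_space.independentD[OF ind finB order_refl, of ?u]) auto
      then show ?thesis by (simp add: inv_into_f_f[OF inj a])
    qed
    with AK show "?Z = mat_kernel ?M" by blast
  next
    assume K: "?Z = mat_kernel ?M"
    have zero: "c a = 0" if "(\<Sum>a\<in>A. (\<lambda>\<alpha>. c a * ?\<Phi> (l a) \<alpha>)) = 0" "a \<in> A" for c a
    proof -
      have "(\<Sum>a\<in>A. cst (c a) * l a) \<in> mat_kernel ?M"
        using that(1) by (simp only: mat_kernel_def mat_vec_sum mem_Collect_eq)
      then show ?thesis using ev_sum[OF that(2), of c] that(2) K[symmetric] by auto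
    qed
    have inj: "inj_on (\<lambda>a. ?\<Phi> (l a)) A"
    proof (rule inj_onI)
      fix a b assume ab: "a \<in> A" "b \<in> A" "?\<Phi> (l a) = ?\<Phi> (l b)"
      then have "l a - l b \<in> ?Z" using K by (simp only: mat_vec_eq_iff)
      then have "ev a (l a) = ev a (l b)" using ab by (simp add: ev_simps)
      then show "a = b" using l ab by (simp split: if_splits)
    qed
    have "fun_space.independent ?B"
      unfolding fun_space.independent_explicit_finite_subsets
    proof (intro allI impI ballI)
      fix S u v assume S: "S \<subseteq> ?B" "finite S" "(\<Sum>f\<in>S. (\<lambda>\<alpha>. u f * f \<alpha>)) = 0" "v \<in> S"
      \<comment> \<open>A relation between some of the vectors is one between all of them, with coefficients 0
        elsewhere.\<close>
      define c where "c a = (if ?\<Phi> (l a) \<in> S then u (?\<Phi> (l a)) else 0)" for a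
      have "(\<Sum>a\<in>A. (\<lambda>\<alpha>. c a * ?\<Phi> (l a) \<alpha>)) = (\<Sum>f\<in>?B. (\<lambda>\<alpha>. (if f \<in> S then u f else 0) * f \<alpha>))"
        by (subst sum.reindex[OF inj]) (simp add: c_def)
      also have "\<dots> = (\<Sum>f\<in>S. (\<lambda>\<alpha>. (if f \<in> S then u f else 0) * f \<alpha>))"
        using S(1) finB by (intro sum.mono_neutral_right) (auto simp: fun_eq_iff)
      also have "\<dots> = 0" using S(3) by simp
      finally have "c a = 0" if "a \<in> A" for a using zero that by blast
      moreover obtain a where "a \<in> A" "v = ?\<Phi> (l a)" using S(1,4) by blast
      ultimately show "u v = 0" using S(4) c_def[of a] by simp
    qed
    then have "fun_space.dim ?B = card ?B" by (rule fun_space.dim_eq_card_independent)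
    then show "fun_space.dim ?B = card A" using card_image[OF inj] by simp
  qed
  then show "mat_rank ?M = enat (card A) \<longleftrightarrow> ?Z = mat_kernel ?M" using rank dimBC by simp
qed

text \<open>
  For \<open>L p = \<Sum>a. p(a)\<close> one has \<open>L (p p) = 0\<close> only if \<open>p\<close> vanishes on \<open>A\<close>.
\<close>

lemma sum_of_evaluations:
  fixes A :: "('n \<Rightarrow> real) set"
  assumes A: "finite A" and h: "\<And>a j. a \<in> A \<Longrightarrow> j \<in> {1..m} \<Longrightarrow> ev a (h j) = 0"
  shows "\<exists>z. moment_feasible m h z \<and> mat_kernel (moment_matrix z) = {p. \<forall>a\<in>A. ev a p = 0}"
proof -
  define z where "z \<alpha> = (\<Sum>a\<in>A. mono_value a \<alpha>)" for \<alpha>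
  have lin: "lin z p = (\<Sum>a\<in>A. ev a p)" for p
    unfolding lin_def z_def insertion_def
    by (subst sum.swap) (simp add: sum_distrib_left mult.commute)
  have pos: "0 \<le> lin z (p * p)" for p
    by (simp add: lin ev_simps sum_nonneg)
  have K: "mat_kernel (moment_matrix z) = {p. \<forall>a\<in>A. ev a p = 0}"
  proof (intro equalityI subsetI)
    fix p assume "p \<in> mat_kernel (moment_matrix z)"
    then have "(\<Sum>a\<in>A. ev a p * ev a p) = 0" by (simp add: mat_kernel_iff lin ev_simps)
    then show "p \<in> {p. \<forall>a\<in>A. ev a p = 0}" using A by (simp add: sum_nonneg_eq_0_iff)
  qed (simp add: mat_kernel_iff lin ev_simps)
  moreover have "moment_feasible m h z" using pos h by (auto simp: moment_feasible_iff K)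
  ultimately show ?thesis by blast
qed

theorem proposition1p1:
  fixes m :: nat
    and h :: "nat \<Rightarrow> 'n::finite mpoly"
    and I :: "'n mpoly set"
    and y :: "'n monomial \<Rightarrow> real"
  assumes "I = ideal_generated_by (h ` {1..m})"
    and "finite (real_variety I)"
    and "moment_feasible m h y"
  shows "is_real_radical_ideal (mat_kernel (moment_matrix y)) \<and>
    mat_rank (moment_matrix y) \<le> enat (card (real_variety I)) \<and>
    vanishing_ideal (real_variety I) \<subseteq> mat_kernel (moment_matrix y) \<and>
    (vanishing_ideal (real_variety I) = mat_kernel (moment_matrix y) \<longleftrightarrow>
       (\<forall>z. moment_feasible m h z \<longrightarrow> mat_rank (moment_matrix z) \<le> mat_rank (moment_matrix y))) \<and>
    ((\<forall>z. moment_feasible m h z \<longrightarrow> mat_rank (moment_matrix z) \<le> mat_rank (moment_matrix y)) \<longleftrightarrow>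
       mat_rank (moment_matrix y) = enat (card (real_variety I)))"
proof -
  define A where "A = {a. \<forall>f\<in>I. ev a f = 0}"
  have V: "real_variety I = real_point ` A" by (simp add: A_def real_variety_eq)
  have A: "finite A" using assms(2) finite_imageD[OF _ inj_on_subset[OF inj_real_point]] by (auto simp: V)
  have card: "card (real_variety I) = card A"
    unfolding V by (rule card_image[OF inj_on_subset[OF inj_real_point]]) simp
  have van: "vanishing_ideal (real_variety I) = {p. \<forall>a\<in>A. ev a p = 0}"
    by (auto simp: vanishing_ideal_def V peval_real_point)
  have sub: "{p. \<forall>a\<in>A. ev a p = 0} \<subseteq> mat_kernel (moment_matrix z)" if "moment_feasible m h z" for z
    using vanishing_ideal_subset_mat_kernel[OF that assms(1)] by (simp add: van)
  note rank = mat_rank_via_interpolation[OF A sub]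
  obtain z where z: "moment_feasible m h z" "mat_rank (moment_matrix z) = enat (card A)"
  proof -
    have "ev a (h j) = 0" if "a \<in> A" "j \<in> {1..m}" for a j
      using zeros_ideal_generated_by[of "h ` {1..m}" a] that by (auto simp: A_def assms(1))
    then obtain z where "moment_feasible m h z" "mat_kernel (moment_matrix z) = {p. \<forall>a\<in>A. ev a p = 0}"
      using sum_of_evaluations[OF A] by blast
    with rank(2) that show ?thesis by simp
  qed
  have max: "(\<forall>z. moment_feasible m h z \<longrightarrow> mat_rank (moment_matrix z) \<le> mat_rank (moment_matrix y)) \<longleftrightarrow>
       mat_rank (moment_matrix y) = enat (card A)"
    using z rank(1) assms(3) by (metis antisym)
  have "is_real_radical_ideal (mat_kernel (moment_matrix y))"
    using assms(3) by (intro is_real_radical_ideal_mat_kernel) (simp add: moment_feasible_iff)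
  with max rank[OF assms(3)] sub[OF assms(3)] show ?thesis unfolding card van by blast
qed

end
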